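(* Let an $r$-regular wavelet basis ($r$-RWB) be given such that there exists $0<\delta_1<1$ with $\psi(x)\ne0$ for all $x\in(0,1+\delta_1]$. Fix the class $\mathcal{S}([-1,1],d(r),\Delta_1,\Delta_2,N_S)$, a number $0<\pi<1$ and $C_1>0$, and let $\xi=\xi_{d(r)+2}$, where $$\xi_\tau(x)=\frac{(2\tau+3)!}{[(\tau+1)!]^2}\,3^{-(2\tau+3)}(1.5-x)^{\tau+1}(1.5+x)^{\tau+1}\,\mathbf{1}_{[-1.5,1.5]}(x).$$ There is $C>0$ such that for every probability density $f\in\mathcal{S}([-1,1],d(r),\Delta_1,\Delta_2,N_S)$, with $m=id(f)$ and $f_\pi=(1-\pi)f+\pi\xi$, there is a constant $N\in\mathbb{N}$ such that for all $j\ge N$ and all $n\ge C_12^{j(2m+3)}$ $$\sup_{z\in\mathbb{R}}\left(P\left(\frac{\sqrt n}{2\tilde\sigma_j(f_\pi)}\left[L_{n,j}-\|Q_jf_\pi\|_2^2\right]\le z\right)-\Phi(z)\right)^2\le C\,n^{-\frac{1}{2m+3}},$$ where $L_{n,j}$ is computed from a sample $X_1,\dots,X_n$ of $n$ i.i.d. random variables with density $f_\pi$ (the enriched sample, $n$ being its size).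
   Context: **Wavelets.** Let $r\ge1$ be an integer. An $r$-regular wavelet basis ($r$-RWB) consists of a scaling function $\phi$ of a multiresolution analysis of $L^2(\mathbb{R})$ and the associated orthonormal real-valued wavelet $\psi$, both of class $C^r$ and compactly supported; we assume $\mathrm{supp}\,\psi=[0,S(r)]$ with $S(r)\in\mathbb{N}$. Put $\psi_{j,k}(x)=2^{j/2}\psi(2^jx-k)$. The integer $d(r)\ge r$ is the one for which $\int_{\mathbb{R}}x^k\psi(x)\,dx=0$ for $0\le k\le d(r)$ and $\int_{\mathbb{R}}x^{d(r)+1}\psi(x)\,dx\ne0$. For $j\ge0$ let $G_j(x,y)=\sum_{k\in\mathbb{Z}}\psi_{j,k}(x)\psi_{j,k}(y)$ and $Q_jf(x)=\int_{\mathbb{R}}G_j(x,y)f(y)\,dy$. $\|\cdot\|_p$ is the norm of $L^p(\mathbb{R})$. **Piecewise-smooth functions.** A function $f$ is piecewise-smooth with index $id(f)=m\ge0$ ($m$ an integer) if $f\in C^{m-1}(\mathbb{R})$ when $m\ge1$, and there exist $n\in\mathbb{N}$ and points $a_1<\dots<a_n$ (the defect points) such that $f\notin C^m(\{a_i\})$ for some $i$ and $f\in C^{m+1}$ on each of $(-\infty,a_1]$, $[a_i,a_{i+1}]$ ($i=1,\dots,n-1$), $[a_n,\infty)$. Here membership in $C^{m+1}$ of a closed interval means that the restriction to the interior extends to a $C^{m+1}$ function on the closed interval, and $f\notin C^m(\{a\})$ means $f^{(m)}(a^-)\neq f^{(m)}(a^+)$. **The class $\mathcal{S}$.** For $0<\Delta_1\le\Delta_2$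 and $N_S\in\mathbb{N}$, $f\in\mathcal{S}([-1,1],d(r),\Delta_1,\Delta_2,N_S)$ means: $\mathrm{supp}\,f\subset[-1,1]$; $f$ is piecewise-smooth with $id(f)=m\le d(r)$; for each defect point $d$ of $f$, $\Delta_1\le|f^{(m)}(d^-)-f^{(m)}(d^+)|\le\Delta_2$; and the number of defect points is at most $N_S$. **Statistics.** For a sample $X_1,\dots,X_n$, $L_{n,j}=\frac{2}{n(n-1)}\sum_{i=1}^{n-1}\sum_{l=i+1}^nG_j(X_i,X_l)$. For a density $g$, $\tilde\sigma_j(g)=\sqrt{\int_{\mathbb{R}}(Q_jg(x))^2g(x)\,dx-\left(\int_{\mathbb{R}}(Q_jg(x))^2dx\right)^2}$. $\Phi$ is the standard normal distribution function. **Enrichment procedure.** To a sample of size $n_0$ from $f$ one adds a sample of size $n_1=\pi n_0/(1-\pi)$ from $\xi$; the result is treated as an i.i.d. sample of size $n=n_0/(1-\pi)$ from $f_\pi=(1-\pi)f+\pi\xi$. *)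

theory Defs
  imports "HOL-Probability.Probability"
begin

section \<open>Smoothness\<close>

text \<open>
  \<open>C_k_on k I f\<close>: \<open>f\<close> is of class \<open>C\<^sup>k\<close> on \<open>I\<close>, with one-sided derivatives at the
  end points that belong to \<open>I\<close>; \<open>D i\<close> is the \<open>i\<close>-th derivative.  It is only used for
  \<open>I = UNIV\<close> and for nondegenerate closed intervals.
\<close>

definition C_k_on :: "nat \<Rightarrow> real set \<Rightarrow> (real \<Rightarrow> real) \<Rightarrow> bool" where
  "C_k_on k I f \<longleftrightarrow>
     (\<exists>D :: nat \<Rightarrow> real \<Rightarrow> real.
        (\<forall>x\<in>I. D 0 x = f x) \<and>
        (\<forall>i<k. \<forall>x\<in>I. (D i has_real_derivative D (Suc i) x) (at x within I)) \<and>
        continuous_on I (D k))"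

definition extends_C_k_on :: "nat \<Rightarrow> real set \<Rightarrow> (real \<Rightarrow> real) \<Rightarrow> bool" where
  "extends_C_k_on k I f \<longleftrightarrow> (\<exists>g. C_k_on k I g \<and> (\<forall>x\<in>interior I. g x = f x))"

definition supp :: "(real \<Rightarrow> real) \<Rightarrow> real set" where
  "supp f = closure {x. f x \<noteq> 0}"


section \<open>Multiresolution analyses and wavelets\<close>

text \<open>
  Elements of \<open>L\<^sup>2\<close> are represented by Borel functions, not by equivalence classes.  The
  subspaces below are closed under \<open>L\<^sup>2\<close>-limits, hence also under equality almost everywhere.
\<close>

definition L2 :: "(real \<Rightarrow> real) set" where
  "L2 = {f \<in> borel_measurable lborel. integrable lborel (\<lambda>x. (f x)\<^sup>2)}"

definition l2_inner :: "(real \<Rightarrow> real) \<Rightarrow> (real \<Rightarrow> real) \<Rightarrow> real" where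
  "l2_inner f g = (\<integral>x. f x * g x \<partial>lborel)"

definition l2_norm :: "(real \<Rightarrow> real) \<Rightarrow> real" where
  "l2_norm f = sqrt (\<integral>x. (f x)\<^sup>2 \<partial>lborel)"

definition l2_closed_subspace :: "(real \<Rightarrow> real) set \<Rightarrow> bool" where
  "l2_closed_subspace V \<longleftrightarrow>
     V \<subseteq> L2 \<and> (\<lambda>x. 0) \<in> V \<and>
     (\<forall>f\<in>V. \<forall>g\<in>V. \<forall>a b. (\<lambda>x. a * f x + b * g x) \<in> V) \<and>
     (\<forall>u. \<forall>g\<in>L2. (\<forall>n::nat. u n \<in> V) \<longrightarrow>
        (\<lambda>n. l2_norm (\<lambda>x. u n x - g x)) \<longlonglongrightarrow> 0 \<longrightarrow> g \<in> V)"

definition l2_orthonormal_basis :: "(real \<Rightarrow> real) set \<Rightarrow> (int \<Rightarrow> real \<Rightarrow> real) \<Rightarrow> bool" where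
  "l2_orthonormal_basis V e \<longleftrightarrow>
     (\<forall>k. e k \<in> V) \<and>
     (\<forall>k l. l2_inner (e k) (e l) = (if k = l then 1 else 0)) \<and>
     (\<forall>f\<in>V. \<forall>\<epsilon>>0. \<exists>K c. finite K \<and> l2_norm (\<lambda>x. f x - (\<Sum>k\<in>K. c k * e k x)) < \<epsilon>)"

definition multiresolution_analysis ::
    "(int \<Rightarrow> (real \<Rightarrow> real) set) \<Rightarrow> (real \<Rightarrow> real) \<Rightarrow> bool" where
  "multiresolution_analysis V \<phi> \<longleftrightarrow>
     (\<forall>j. l2_closed_subspace (V j)) \<and>
     (\<forall>j. V j \<subseteq> V (j + 1)) \<and>
     (\<forall>f\<in>L2. \<forall>\<epsilon>>0. \<exists>j. \<exists>g\<in>V j. l2_norm (\<lambda>x. f x - g x) < \<epsilon>) \<and>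
     (\<forall>f. (\<forall>j. f \<in> V j) \<longrightarrow> (AE x in lborel. f x = 0)) \<and>
     (\<forall>j f. f \<in> V j \<longleftrightarrow> (\<lambda>x. f (2 * x)) \<in> V (j + 1)) \<and>
     l2_orthonormal_basis (V 0) (\<lambda>k x. \<phi> (x - of_int k))"

text \<open>
  \<open>\<psi>\<close> is an orthonormal wavelet associated with \<open>V\<close>: its integer translates form an orthonormal
  basis of the orthogonal complement of \<open>V 0\<close> in \<open>V 1\<close>.
\<close>

definition associated_wavelet ::
    "(int \<Rightarrow> (real \<Rightarrow> real) set) \<Rightarrow> (real \<Rightarrow> real) \<Rightarrow> bool" where
  "associated_wavelet V \<psi> \<longleftrightarrow>
     l2_orthonormal_basis {f \<in> V 1. \<forall>g\<in>V 0. l2_inner f g = 0} (\<lambda>k x. \<psi> (x - of_int k))"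

definition regular_wavelet_basis :: "nat \<Rightarrow> (real \<Rightarrow> real) \<Rightarrow> (real \<Rightarrow> real) \<Rightarrow> bool" where
  "regular_wavelet_basis r \<phi> \<psi> \<longleftrightarrow>
     (\<exists>V. multiresolution_analysis V \<phi> \<and> associated_wavelet V \<psi>) \<and>
     C_k_on r UNIV \<phi> \<and> C_k_on r UNIV \<psi> \<and>
     compact (supp \<phi>) \<and> (\<exists>S::nat. supp \<psi> = {0..real S})"

text \<open>The number \<open>d(r)\<close>; it is determined uniquely by \<open>\<psi>\<close>.\<close>

definition vanishing_moments :: "nat \<Rightarrow> (real \<Rightarrow> real) \<Rightarrow> nat \<Rightarrow> bool" where
  "vanishing_moments r \<psi> d \<longleftrightarrow>
     r \<le> d \<and> (\<forall>k\<le>d. (\<integral>x. x ^ k * \<psi> x \<partial>lborel) = 0) \<and>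
     (\<integral>x. x ^ (d + 1) * \<psi> x \<partial>lborel) \<noteq> 0"

definition wavelet :: "(real \<Rightarrow> real) \<Rightarrow> nat \<Rightarrow> int \<Rightarrow> real \<Rightarrow> real" where
  "wavelet \<psi> j k x = 2 powr (real j / 2) * \<psi> (2 ^ j * x - of_int k)"

text \<open>For compactly supported \<open>\<psi>\<close> only finitely many terms of the sum are nonzero.\<close>

definition wavelet_kernel :: "(real \<Rightarrow> real) \<Rightarrow> nat \<Rightarrow> real \<Rightarrow> real \<Rightarrow> real" where
  "wavelet_kernel \<psi> j x y = (\<Sum>\<^sub>\<infinity>k\<in>(UNIV :: int set). wavelet \<psi> j k x * wavelet \<psi> j k y)"

definition wavelet_proj :: "(real \<Rightarrow> real) \<Rightarrow> nat \<Rightarrow> (real \<Rightarrow> real) \<Rightarrow> real \<Rightarrow> real" where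
  "wavelet_proj \<psi> j f x = (\<integral>y. wavelet_kernel \<psi> j x y * f y \<partial>lborel)"


section \<open>Piecewise-smooth functions\<close>

text \<open>
  The one-sided limits of the \<open>m\<close>-th derivative.  \<open>Lim\<close> is unspecified when the limit does not
  exist; for piecewise-smooth functions as below both limits exist at every defect point.
\<close>

definition left_deriv_lim :: "nat \<Rightarrow> (real \<Rightarrow> real) \<Rightarrow> real \<Rightarrow> real" where
  "left_deriv_lim m f a = Lim (at_left a) ((deriv ^^ m) f)"

definition right_deriv_lim :: "nat \<Rightarrow> (real \<Rightarrow> real) \<Rightarrow> real \<Rightarrow> real" where
  "right_deriv_lim m f a = Lim (at_right a) ((deriv ^^ m) f)"

text \<open>\<open>f\<close> is piecewise-smooth with index \<open>m\<close> and defect points \<open>as\<close>, listed in increasing order.\<close>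

definition piecewise_smooth :: "(real \<Rightarrow> real) \<Rightarrow> nat \<Rightarrow> real list \<Rightarrow> bool" where
  "piecewise_smooth f m as \<longleftrightarrow>
     (m \<ge> 1 \<longrightarrow> C_k_on (m - 1) UNIV f) \<and>
     as \<noteq> [] \<and> sorted_wrt (<) as \<and>
     (\<exists>a\<in>set as. left_deriv_lim m f a \<noteq> right_deriv_lim m f a) \<and>
     extends_C_k_on (m + 1) {..hd as} f \<and>
     (\<forall>i. i + 1 < length as \<longrightarrow> extends_C_k_on (m + 1) {as ! i..as ! (i + 1)} f) \<and>
     extends_C_k_on (m + 1) {last as..} f"

text \<open>
  \<open>id(f) = m\<close>, as a relation.  At most one \<open>m\<close> satisfies it: if \<open>m < m'\<close> and \<open>f\<close> has index
  \<open>m'\<close>, then \<open>f\<close> is of class \<open>C\<^sup>m\<close>, so its \<open>m\<close>-th derivative has no jump.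
\<close>

definition has_index :: "(real \<Rightarrow> real) \<Rightarrow> nat \<Rightarrow> bool" where
  "has_index f m \<longleftrightarrow> (\<exists>as. piecewise_smooth f m as)"

text \<open>
  The lower bound \<open>\<Delta>\<^sub>1 > 0\<close> makes each listed point a genuine jump, so the list \<open>as\<close> is
  determined by \<open>f\<close> and \<open>length as\<close> is the number of defect points.
\<close>

definition S_class :: "nat \<Rightarrow> real \<Rightarrow> real \<Rightarrow> nat \<Rightarrow> (real \<Rightarrow> real) set" where
  "S_class d \<Delta>\<^sub>1 \<Delta>\<^sub>2 N\<^sub>S =
     {f. supp f \<subseteq> {-1..1} \<and>
         (\<exists>m as. piecewise_smooth f m as \<and> m \<le> d \<and>
            (\<forall>a\<in>set as. \<Delta>\<^sub>1 \<le> \<bar>left_deriv_lim m f a - right_deriv_lim m f a\<bar> \<and>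
                        \<bar>left_deriv_lim m f a - right_deriv_lim m f a\<bar> \<le> \<Delta>\<^sub>2) \<and>
            length as \<le> N\<^sub>S)}"


section \<open>Statistics\<close>

definition prob_density :: "(real \<Rightarrow> real) \<Rightarrow> bool" where
  "prob_density f \<longleftrightarrow> f \<in> borel_measurable borel \<and> (\<forall>x. 0 \<le> f x) \<and> has_bochner_integral lborel f 1"

definition xi :: "nat \<Rightarrow> real \<Rightarrow> real" where
  "xi \<tau> x = fact (2 * \<tau> + 3) / (fact (\<tau> + 1))\<^sup>2 * (1 / 3 ^ (2 * \<tau> + 3)) *
            (3/2 - x) ^ (\<tau> + 1) * (3/2 + x) ^ (\<tau> + 1) * indicator {-3/2..3/2} x"

definition enriched :: "real \<Rightarrow> (real \<Rightarrow> real) \<Rightarrow> (real \<Rightarrow> real) \<Rightarrow> real \<Rightarrow> real" where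
  "enriched p \<xi> f x = (1 - p) * f x + p * \<xi> x"

definition L_stat :: "(real \<Rightarrow> real) \<Rightarrow> nat \<Rightarrow> nat \<Rightarrow> (nat \<Rightarrow> real) \<Rightarrow> real" where
  "L_stat \<psi> n j X =
     2 / (real n * (real n - 1)) *
     (\<Sum>i=1..n-1. \<Sum>l=i+1..n. wavelet_kernel \<psi> j (X i) (X l))"

definition sigma_tilde :: "(real \<Rightarrow> real) \<Rightarrow> nat \<Rightarrow> (real \<Rightarrow> real) \<Rightarrow> real" where
  "sigma_tilde \<psi> j g =
     sqrt ((\<integral>x. (wavelet_proj \<psi> j g x)\<^sup>2 * g x \<partial>lborel)
           - (\<integral>x. (wavelet_proj \<psi> j g x)\<^sup>2 \<partial>lborel)\<^sup>2)"

text \<open>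
  The law of an i.i.d. sample \<open>X 1, \<dots>, X n\<close> with density \<open>g\<close>.  By the lemma below,
  probabilities of events about an i.i.d. sample on any probability space are computed by it.
\<close>

definition sample_law :: "nat \<Rightarrow> (real \<Rightarrow> real) \<Rightarrow> (nat \<Rightarrow> real) measure" where
  "sample_law n g = PiM {1..n} (\<lambda>_. density lborel (\<lambda>x. ennreal (g x)))"

lemma (in prob_space) prob_iid_sample:
  fixes X :: "nat \<Rightarrow> 'a \<Rightarrow> real"
  assumes "n \<ge> 1"
    and indep: "indep_vars (\<lambda>_. borel) X {1..n}"
    and dist: "\<And>i. i \<in> {1..n} \<Longrightarrow> distributed M lborel (X i) (\<lambda>x. ennreal (g x))"
    and T: "T \<in> borel_measurable (PiM {1..n} (\<lambda>_. borel))"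
  shows "\<P>(\<omega> in M. T (\<lambda>i\<in>{1..n}. X i \<omega>) \<le> z) = \<P>(x in sample_law n g. T x \<le> (z::real))"
proof -
  have rv: "random_variable borel (X i)" if "i \<in> {1..n}" for i
    using distributed_measurable[OF dist[OF that]] by simp
  have "distr M (PiM {1..n} (\<lambda>_. borel)) (\<lambda>\<omega>. \<lambda>i\<in>{1..n}. X i \<omega>)
      = PiM {1..n} (\<lambda>i. distr M borel (X i))"
    using indep indep_vars_iff_distr_eq_PiM'[of "{1..n}" X "\<lambda>_. borel"] rv assms(1) by simp
  also have "\<dots> = sample_law n g"
    unfolding sample_law_def
  proof (rule PiM_cong)
    fix i assume "i \<in> {1..n}"
    then have "distr M lborel (X i) = density lborel (\<lambda>x. ennreal (g x))"
      using dist distributed_distr_eq_density by blast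
    then show "distr M borel (X i) = density lborel (\<lambda>x. ennreal (g x))"
      by (simp cong: distr_cong)
  qed simp
  finally have law: "sample_law n g
      = distr M (PiM {1..n} (\<lambda>_. borel)) (\<lambda>\<omega>. \<lambda>i\<in>{1..n}. X i \<omega>)" ..
  have meas: "(\<lambda>\<omega>. \<lambda>i\<in>{1..n}. X i \<omega>) \<in> measurable M (PiM {1..n} (\<lambda>_. borel))"
    using rv by (intro measurable_restrict) auto
  show ?thesis
  proof -
    have "Measurable.pred (PiM {1..n} (\<lambda>_. borel)) (\<lambda>x. T x \<le> z)"
      using T by measurable
    then have ev: "{x \<in> space (PiM {1..n} (\<lambda>_. borel)). T x \<le> z} \<in> sets (PiM {1..n} (\<lambda>_. borel))"
      by (simp add: pred_def)
    have "(\<lambda>\<omega>. \<lambda>i\<in>{1..n}. X i \<omega>) -` {x \<in> space (PiM {1..n} (\<lambda>_. borel)). T x \<le> z} \<inter> space M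
        = {\<omega> \<in> space M. T (\<lambda>i\<in>{1..n}. X i \<omega>) \<le> z}"
      using measurable_space[OF meas] by blast
    then show ?thesis
      unfolding law by (simp only: space_distr measure_distr[OF meas ev])
  qed
qed

end

theory Submission
  imports Defs "HOL-Probability.Probability"
begin

text \<open>
  The centred and normalized statistic is a martingale \<open>T\<^sub>n = \<Sum>\<^bsub>i\<le>n\<^esub> (\<xi> (X i) + \<Sum>\<^bsub>l<i\<^esub> h (X l) (X i))\<close>
  with \<open>h\<close> degenerate (Hoeffding decomposition).  The function \<open>u(t, x) = \<Phi>((z - x) / \<surd>t)\<close> solves the
  heat equation, so replacing \<open>T\<^sub>k\<close> at time \<open>t\<close> by \<open>T\<^bsub>k-1\<^esub>\<close> at time \<open>t + 1/n\<close> costs only third moments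
  of \<open>\<xi>\<close>, second moments of \<open>h\<close> and the covariance of \<open>\<xi>\<close> with \<open>h\<close>; telescoping compares
  \<open>T\<^sub>n\<close>, smoothed at scale \<open>e\<close>, with a normal variable.  Here \<open>e\<^sup>2\<close> is the rate \<open>n powr (- 1 / (2 m + 3))\<close>.

  A bound by the standard deviation of the degenerate part would not give a constant \<open>C\<close>
  independent of \<open>f\<close>, since that standard deviation involves \<open>\<parallel>f\<^sub>\<pi>\<parallel>\<^sub>2\<close>, which is unbounded on the class.
  In the argument above only the third moment of \<open>\<xi>\<close> contributes at order \<open>e\<close>; all terms with
  constants depending on \<open>f\<close> are of order \<open>e powr (3/2)\<close> and are absorbed by the choice of \<open>N\<close>.

  Near a defect point the wavelet coefficients of \<open>f\<^sub>\<pi>\<close> are those of a truncated power times the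
  jump, up to a factor \<open>1 + O(2\<^sup>-\<^sup>j)\<close>.  This gives the uniform bounds \<open>\<bar>Q\<^sub>j f\<^sub>\<pi>\<bar> \<le> U 2 powr (- j m)\<close> and
  \<open>\<sigma>\<^sup>2 \<ge> c 2 powr (- j (2 m + 1))\<close>; the latter uses that \<open>\<psi>\<close> has constant sign on \<open>(0, 1 + \<delta>\<^sub>1]\<close> and that
  the enriching density keeps \<open>f\<^sub>\<pi>\<close> away from \<open>0\<close> near the defect points.
\<close>

section \<open>The normal distribution function\<close>

text \<open>The condition on \<open>n\<close> becomes
  \<open>2 ^ j * e\<^sup>2 \<le> \<Lambda>\<close>, while \<open>1 / n = e ^ (4 * m + 6)\<close>.
  Since \<open>\<sigma>\<^sup>2\<close> is only known to be at least of order
  \<open>2 powr (- j * (2 * m + 1))\<close>, the degenerate part has relative variance up to order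
  \<open>2 ^ j / (n * \<sigma>\<^sup>2)\<close>, hence \<open>e\<^sup>2\<close>: its standard
  deviation reaches exactly the critical order \<open>e\<close>, which is why its constant would
  matter. The heat flow meets the variance itself, multiplied by the sum of
  \<open>1 / (n * t)\<close> over the times \<open>t\<close>, a logarithm of \<open>1 / e\<close>;
  the product is \<open>o(e)\<close> whatever its constant. The third moments are multiplied by the
  sum of \<open>1 / (n * t * sqrt t)\<close>, of order \<open>1 / e\<close>. As the quotient of
  \<open>\<bar>Q\<bar>\<close> by \<open>\<sigma>\<close> is uniformly of order
  \<open>2 powr (j / 2)\<close>, they contribute \<open>e\<close> with a uniform constant. Removing
  the Gaussian smoothing costs another multiple of \<open>e\<close>, and the square of the total is
  the stated rate.\<close>

abbreviation Phi :: "real \<Rightarrow> real" where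
  "Phi \<equiv> cdf std_normal_distribution"

interpretation std_normal: real_distribution std_normal_distribution
  by (rule real_dist_normal_dist)

lemma Phi_diff_eq:
  assumes "a \<le> b"
  shows "Phi b - Phi a = integral {a..b} std_normal_density"
proof (cases "a = b")
  case False
  have "Phi b - Phi a = measure std_normal_distribution {a<..b}"
    using False assms by (intro std_normal.cdf_diff_eq) auto
  also have "\<dots> = (LINT x:{a<..b}|lborel. std_normal_density x)"
  proof -
    have "measure std_normal_distribution {a<..b} = (\<integral>x. indicator {a<..b} x \<partial>std_normal_distribution)"
      by simp
    also have "\<dots> = (\<integral>x. std_normal_density x * indicator {a<..b} x \<partial>lborel)"
      by (intro integral_real_density) auto
    finally show ?thesis by (simp add: set_lebesgue_integral_def mult.commute)
  qed
  also have "\<dots> = (LINT x:{a..b}|lborel. std_normal_density x)"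
  proof (rule set_integral_cong_set)
    have "AE x in lborel. x \<noteq> a" by (rule AE_lborel_singleton)
    then show "AE x in lborel. (x \<in> {a..b}) = (x \<in> {a<..b})" by eventually_elim auto
  qed (auto simp: set_borel_measurable_def)
  also have "\<dots> = integral {a..b} std_normal_density"
    by (intro set_borel_integral_eq_integral(2)) (auto simp: set_integrable_def mult.commute intro!: integrable_real_mult_indicator)
  finally show ?thesis .
qed auto

lemma Phi_has_derivative: "(Phi has_real_derivative std_normal_density x) (at x)"
proof -
  let ?a = "x - 1" and ?b = "x + 1"
  have cont: "continuous_on {?a..?b} std_normal_density"
    unfolding std_normal_density_def by (intro continuous_intros) auto
  have "((\<lambda>u. integral {?a..u} std_normal_density) has_real_derivative std_normal_density x)
          (at x within {?a..?b})"
    using integral_has_real_derivative[OF cont, of x] by simp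
  then have *: "((\<lambda>u. integral {?a..u} std_normal_density) has_real_derivative std_normal_density x) (at x)"
    by (simp add: at_within_Icc_at)
  have "((\<lambda>u. Phi ?a + integral {?a..u} std_normal_density) has_real_derivative std_normal_density x) (at x)"
    using DERIV_add[OF DERIV_const *] by simp
  then show ?thesis
  proof (rule has_field_derivative_transform_within_open)
    show "open {?a<..<?b}" "x \<in> {?a<..<?b}" by auto
    fix y assume "y \<in> {?a<..<?b}"
    then show "Phi ?a + integral {?a..y} std_normal_density = Phi y"
      using Phi_diff_eq[of ?a y] by auto
  qed
qed

lemma Phi_has_derivative_within [derivative_intros]:
  assumes "(f has_real_derivative f') (at x within A)"
  shows "((\<lambda>x. Phi (f x)) has_real_derivative std_normal_density (f x) * f') (at x within A)"
  by (rule DERIV_chain2[where f=Phi, OF Phi_has_derivative assms])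

lemma std_normal_density_has_derivative [derivative_intros]:
  assumes "(f has_real_derivative f') (at x within A)"
  shows "((\<lambda>x. std_normal_density (f x)) has_real_derivative
           - f x * std_normal_density (f x) * f') (at x within A)"
  unfolding std_normal_density_def
  by (rule DERIV_cong, (rule derivative_intros assms)+) (simp_all add: field_simps)

lemma isCont_Phi: "isCont Phi x"
  using Phi_has_derivative DERIV_isCont by blast

lemma Phi_bounds: "0 \<le> Phi x" "Phi x \<le> 1"
  using std_normal.cdf_nonneg std_normal.cdf_bounded_prob by auto

lemma Phi_measurable [measurable]: "Phi \<in> borel_measurable borel"
  by (intro borel_measurable_continuous_onI continuous_at_imp_continuous_on) (simp add: isCont_Phi)

lemma std_normal_density_le: "std_normal_density x \<le> exp (- x\<^sup>2 / 2) / 2"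
proof -
  have "2 \<le> sqrt (2 * pi)"
    using pi_gt3 by (intro real_le_rsqrt) auto
  then show ?thesis
    unfolding std_normal_density_def by (auto intro!: divide_left_mono simp: field_simps)
qed

text \<open>With \<open>y = x\<^sup>2 / 2\<close> the density is at most
  \<open>1 / (2 * (1 + y + y\<^sup>2 / 2))\<close>, whose denominator has degree four in
  \<open>x\<close>; this beats every power up to the cube.\<close>

lemma std_normal_density_bounds:
  shows "std_normal_density x \<le> 1"
    and "x\<^sup>2 * std_normal_density x \<le> 1"
    and "\<bar>x\<bar> * std_normal_density x \<le> 1"
    and "\<bar>x\<bar> ^ 3 * std_normal_density x \<le> 4"
proof -
  let ?y = "x\<^sup>2 / 2"
  have e: "1 + ?y + ?y\<^sup>2 / 2 \<le> exp ?y"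
    by (rule exp_lower_Taylor_quadratic) auto
  have *: "c * std_normal_density x \<le> C" if "0 \<le> c" "c \<le> 2 * C * (1 + ?y + ?y\<^sup>2 / 2)" "0 \<le> C" for c C
  proof -
    have "c * std_normal_density x \<le> c * (exp (- ?y) / 2)"
      using std_normal_density_le[of x] that by (intro mult_left_mono) auto
    also have "\<dots> \<le> (2 * C * exp ?y) * (exp (- ?y) / 2)"
      using that e mult_left_mono[OF e, of "2 * C"] by (intro mult_right_mono) auto
    also have "\<dots> = C" by (simp add: exp_minus)
    finally show ?thesis .
  qed
  show 1: "std_normal_density x \<le> 1" using *[of 1 1] by simp
  show 2: "x\<^sup>2 * std_normal_density x \<le> 1" by (rule *) auto
  have "2 * \<bar>x\<bar> \<le> 1 + x\<^sup>2" using sum_squares_bound[of "\<bar>x\<bar>" 1] by simp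
  then show "\<bar>x\<bar> * std_normal_density x \<le> 1"
  proof (intro *)
    show "\<bar>x\<bar> \<le> 2 * 1 * (1 + ?y + ?y\<^sup>2 / 2)"
      using zero_le_power2[of "?y"] zero_le_power2[of x] \<open>2 * \<bar>x\<bar> \<le> 1 + x\<^sup>2\<close>
      unfolding distrib_left by linarith
  qed auto
  have "\<bar>x\<bar> ^ 3 = \<bar>x\<bar> * x\<^sup>2" by (simp add: power3_eq_cube power2_eq_square)
  moreover have "2 * \<bar>x\<bar> * x\<^sup>2 \<le> (1 + x\<^sup>2) * x\<^sup>2"
    using \<open>2 * \<bar>x\<bar> \<le> 1 + x\<^sup>2\<close> by (intro mult_right_mono) auto
  ultimately have "2 * \<bar>x\<bar> ^ 3 \<le> x\<^sup>2 + 4 * ?y\<^sup>2"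
    by (simp add: algebra_simps power2_eq_square)
  moreover have "8 * (1 + ?y + ?y\<^sup>2 / 2) = 8 + 4 * x\<^sup>2 + 4 * ?y\<^sup>2" by simp
  ultimately have "\<bar>x\<bar> ^ 3 \<le> 8 * (1 + ?y + ?y\<^sup>2 / 2)"
    using zero_le_power2[of "?y"] zero_le_power2[of x] by linarith
  then show "\<bar>x\<bar> ^ 3 * std_normal_density x \<le> 4"
    by (intro *) simp_all
qed

lemma Phi_Lipschitz: "\<bar>Phi x - Phi y\<bar> \<le> \<bar>x - y\<bar>"
proof -
  have "norm (Phi x - Phi y) \<le> 1 * norm (x - y)"
    by (rule field_differentiable_bound[where S=UNIV and f'=std_normal_density])
       (auto intro: Phi_has_derivative std_normal_density_bounds)
  then show ?thesis by simp
qed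

text \<open>The remainder is quadratic in \<open>b\<close> only, so no third moment of \<open>b\<close> will be needed.\<close>

lemma Phi_expansion:
  "\<bar>Phi (w + a + b) - Phi w - (a + b) * std_normal_density w
      + (a\<^sup>2 / 2 + a * b) * (w * std_normal_density w)\<bar> \<le> 8 * (b\<^sup>2 + \<bar>a\<bar> ^ 3)"
proof -
  let ?n = std_normal_density
  define c where "c = a + b"
  define R where "R = Phi (w + c) - Phi w - c * ?n w"
  define D where "D = (\<lambda>i::nat. if i = 0 then Phi else if i = 1 then ?n
      else if i = 2 then (\<lambda>x. - x * ?n x) else (\<lambda>x. (x\<^sup>2 - 1) * ?n x))"
  have D: "(D i has_real_derivative D (Suc i) x) (at x within UNIV)" if "i \<le> 2" for i x
  proof -
    consider "i = 0" | "i = 1" | "i = 2" using \<open>i \<le> 2\<close> by linarith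
    then show ?thesis
    proof cases
      case 3
      have "((\<lambda>x. - x * ?n x) has_real_derivative (x\<^sup>2 - 1) * ?n x) (at x)"
        by (rule derivative_eq_intros refl)+ (simp add: algebra_simps power2_eq_square)
      then show ?thesis using 3 by (simp add: D_def)
    next
      case 2
      have "(?n has_real_derivative - x * ?n x) (at x)"
        by (rule derivative_eq_intros refl | simp)+
      then show ?thesis using 2 by (simp add: D_def)
    qed (auto simp: D_def Phi_has_derivative)
  qed
  have m: "\<bar>w * ?n w\<bar> \<le> 1" for w
    using std_normal_density_bounds(3)[of w] by (simp add: abs_mult)
  have m2: "\<bar>(w\<^sup>2 - 1) * ?n w\<bar> \<le> 1" for w
    using std_normal_density_bounds(1,2)[of w] normal_density_nonneg[of 0 1 w]
      mult_nonneg_nonneg[OF zero_le_power2[of w] normal_density_nonneg[of 0 1 w]]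
    by (simp only: abs_le_iff left_diff_distrib) linarith
  have "norm (D 0 (w + c) - (\<Sum>i\<le>1. D i w * (w + c - w) ^ i / fact i)) \<le> 1 * norm (w + c - w) ^ Suc 1 / fact 1"
  proof (rule field_Taylor[where S=UNIV and n=1])
    show "(D i has_real_derivative D (Suc i) x) (at x within UNIV)" if "i \<le> 1" for i x
      using that by (intro D) simp
    show "norm (D (Suc 1) x) \<le> 1" for x using m by (simp add: D_def numeral_2_eq_2)
  qed auto
  then have R2: "\<bar>R\<bar> \<le> c\<^sup>2"
    by (simp add: D_def R_def algebra_simps power2_eq_square)
  have "norm (D 0 (w + c) - (\<Sum>i\<le>2. D i w * (w + c - w) ^ i / fact i)) \<le> 1 * norm (w + c - w) ^ Suc 2 / fact 2"
  proof (rule field_Taylor[where S=UNIV and n=2])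
    show "(D i has_real_derivative D (Suc i) x) (at x within UNIV)" if "i \<le> 2" for i x
      using that by (intro D) simp
    show "norm (D (Suc 2) x) \<le> 1" for x using m2 by (simp add: D_def)
  qed auto
  moreover have "D 0 (w + c) - (\<Sum>i\<le>2. D i w * (w + c - w) ^ i / fact i) = R + c\<^sup>2 / 2 * (w * ?n w)"
    by (simp add: D_def R_def algebra_simps eval_nat_numeral)
  ultimately have "\<bar>R + c\<^sup>2 / 2 * (w * ?n w)\<bar> \<le> \<bar>c\<bar> ^ 3 / 2"
    by (simp add: eval_nat_numeral)
  then have R3: "\<bar>R + c\<^sup>2 / 2 * (w * ?n w)\<bar> \<le> \<bar>c\<bar> ^ 3" by linarith
  have eq: "Phi (w + a + b) - Phi w - (a + b) * ?n w + (a\<^sup>2 / 2 + a * b) * (w * ?n w)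
      = R + c\<^sup>2 / 2 * (w * ?n w) - b\<^sup>2 / 2 * (w * ?n w)"
    by (simp add: R_def c_def algebra_simps power2_eq_square)
  have bb: "\<bar>e * (w * ?n w)\<bar> \<le> e" if "0 \<le> e" for e
    using mult_left_mono[OF m[of w], of e] that by (simp add: abs_mult)
  have tri: "\<bar>r + p - q\<bar> \<le> \<bar>r\<bar> + \<bar>p\<bar> + \<bar>q\<bar>" for r p q :: real by simp
  have half_pos: "0 \<le> e\<^sup>2 / 2" for e :: real by simp
  \<comment> \<open>If \<open>a\<close> dominates, the third order remainder is a multiple of
    \<open>\<bar>a\<bar> ^ 3\<close>; if \<open>b\<close> dominates, the second order remainder and
    all quadratic terms are multiples of \<open>b\<^sup>2\<close>. The term with
    \<open>b\<^sup>2 / 2\<close> of the expansion is left out of the statement and joins the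
    error.\<close>
  show ?thesis
  proof (cases "\<bar>b\<bar> \<le> \<bar>a\<bar>")
    case True
    then have "\<bar>c\<bar> \<le> 2 * \<bar>a\<bar>" by (simp add: c_def)
    then have "\<bar>c\<bar> ^ 3 \<le> (2 * \<bar>a\<bar>) ^ 3" by (intro power_mono) auto
    then show ?thesis
      unfolding eq using R3 bb[of "b\<^sup>2 / 2"] zero_le_power2[of b] by (simp add: abs_le_iff)
  next
    case False
    then have "\<bar>c\<bar> \<le> 2 * \<bar>b\<bar>" by (simp add: c_def)
    then have "\<bar>c\<bar> ^ 2 \<le> (2 * \<bar>b\<bar>) ^ 2" by (intro power_mono) auto
    then have "c\<^sup>2 \<le> 4 * b\<^sup>2" by (simp add: power_mult_distrib)
    moreover have "0 \<le> \<bar>a\<bar> ^ 3" by simp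
    ultimately show ?thesis
      unfolding eq using R2 bb[of "b\<^sup>2 / 2", OF half_pos] bb[of "c\<^sup>2 / 2", OF half_pos]
        tri[of R "c\<^sup>2 / 2 * (w * ?n w)" "b\<^sup>2 / 2 * (w * ?n w)"] zero_le_power2[of b]
      by (simp only: distrib_left)
  qed
qed

text \<open>The time derivative of \<open>Phi (y / sqrt t)\<close> is half its second derivative in
  \<open>y\<close>, so the term linear in \<open>s\<close> cancels the \<open>a\<^sup>2 / 2\<close>
  term of \<open>Phi_expansion\<close> when \<open>a\<close> is an increment of variance
  \<open>s\<close> divided by \<open>sqrt t\<close>. The second time derivative is at most
  \<open>2 / t\<^sup>2\<close> on \<open>{t..}\<close>.\<close>

lemma Phi_time_expansion:
  assumes t: "0 < t" and s: "0 \<le> s"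
  shows "\<bar>Phi (y / sqrt (t + s)) - Phi (y / sqrt t)
      + s / (2 * t) * (y / sqrt t * std_normal_density (y / sqrt t))\<bar> \<le> 2 * (s / t)\<^sup>2"
proof -
  let ?n = std_normal_density
  define D where "D = (\<lambda>(i::nat) \<tau>. let v = y / sqrt \<tau> in if i = 0 then Phi v
      else if i = 1 then - (v * ?n v) / (2 * \<tau>)
      else ?n v * (3/4 * v - v ^ 3 / 4) / \<tau>\<^sup>2)"
  have v: "((\<lambda>\<tau>. y / sqrt \<tau>) has_real_derivative - (y / sqrt \<tau>) / (2 * \<tau>)) (at \<tau> within {t..})"
    if "0 < \<tau>" for \<tau>
    using that by (auto intro!: derivative_eq_intros simp: field_simps power2_eq_square)
  have D: "(D i has_real_derivative D (Suc i) x) (at x within {t..})" if "i \<le> 1" "x \<in> {t..}" for i x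
  proof -
    have x: "0 < x" using that t by auto
    consider "i = 0" | "i = 1" using \<open>i \<le> 1\<close> by linarith
    then show ?thesis
    proof cases
      case 1
      then show ?thesis unfolding D_def Let_def using x
        by (auto intro!: derivative_eq_intros v simp: field_simps)
    next
      case 2
      define q where "q = sqrt x"
      define v where "v = y / q"
      have q: "0 < q" "x = q * q" "sqrt x = q" "y = v * q" using x by (auto simp: q_def v_def)
      have "((\<lambda>\<tau>. - (y / sqrt \<tau> * ?n (y / sqrt \<tau>)) / (2 * \<tau>)) has_real_derivative 
          ?n (y / sqrt x) * (3/4 * (y / sqrt x) - (y / sqrt x) ^ 3 / 4) / x\<^sup>2) (at x within {t..})"
        by (rule derivative_eq_intros v refl x | use x in \<open>simp; fail\<close>)+
           (use q(1) in \<open>simp only: q(2-4), simp add: divide_simps, simp add: algebra_simps eval_nat_numeral\<close>)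
      then show ?thesis using 2 by (simp add: D_def Let_def)
    qed
  qed
  have b: "norm (D (Suc 1) x) \<le> 2 / t\<^sup>2" if "x \<in> {t..}" for x
  proof -
    define v where "v = y / sqrt x"
    have "\<bar>?n v * (3/4 * v - v ^ 3 / 4)\<bar> \<le> 3/4 * (\<bar>v\<bar> * ?n v) + (\<bar>v\<bar> ^ 3 * ?n v) / 4"
    proof -
      have "\<bar>3/4 * v - v ^ 3 / 4\<bar> \<le> 3/4 * \<bar>v\<bar> + \<bar>v\<bar> ^ 3 / 4"
        by (rule order_trans[OF abs_triangle_ineq4]) (simp add: abs_mult power_abs)
      from mult_left_mono[OF this, of "?n v"] show ?thesis
        by (simp add: abs_mult distrib_left mult_ac)
    qed
    also have "\<dots> \<le> 2" using std_normal_density_bounds(3,4)[of v] by auto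
    finally have "\<bar>?n v * (3/4 * v - v ^ 3 / 4)\<bar> \<le> 2" .
    moreover have "t\<^sup>2 \<le> x\<^sup>2" using that t by (intro power_mono) auto
    moreover have "norm (D (Suc 1) x) = \<bar>?n v * (3/4 * v - v ^ 3 / 4)\<bar> / x\<^sup>2"
      by (simp only: D_def Let_def v_def) simp
    ultimately show ?thesis using t that
      by (simp only:) (rule frac_le, auto)
  qed
  have "norm (D 0 (t + s) - (\<Sum>i\<le>1. D i t * (t + s - t) ^ i / fact i)) \<le> 2 / t\<^sup>2 * norm (t + s - t) ^ Suc 1 / fact 1"
    by (rule field_Taylor[where S="{t..}" and n=1, OF _ D b]) (use s in auto)
  moreover have "D 0 (t + s) - (\<Sum>i\<le>1. D i t * (t + s - t) ^ i / fact i) = Phi (y / sqrt (t + s)) - Phi (y / sqrt t)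
      + s / (2 * t) * (y / sqrt t * ?n (y / sqrt t))"
    by (simp add: D_def Let_def mult_ac)
  ultimately show ?thesis using s
    by (simp add: power_divide power2_eq_square[of s])
qed

section \<open>Smoothing inequality for distribution functions\<close>

lemma std_normal_moments:
  shows "integrable std_normal_distribution (\<lambda>x. x\<^sup>2)" "(\<integral>x. x\<^sup>2 \<partial>std_normal_distribution) = 1"
    and "integrable std_normal_distribution (\<lambda>x. \<bar>x\<bar>)" "(\<integral>x. \<bar>x\<bar> \<partial>std_normal_distribution) \<le> 1"
proof -
  show 1: "integrable std_normal_distribution (\<lambda>x. x\<^sup>2)" "(\<integral>x. x\<^sup>2 \<partial>std_normal_distribution) = 1"
    using std_normal_distribution_even_moments[of 1] by (auto simp: numeral_2_eq_2)
  have le: "\<bar>x\<bar> \<le> (1 + x\<^sup>2) / 2" for x :: real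
    using sum_squares_bound[of 1 "\<bar>x\<bar>"] by simp
  have i: "integrable std_normal_distribution (\<lambda>x. (1 + x\<^sup>2) / 2)"
    using 1 by simp
  show 2: "integrable std_normal_distribution (\<lambda>x. \<bar>x\<bar>)"
    by (rule Bochner_Integration.integrable_bound[OF i]) (use le in auto)
  have "(\<integral>x. \<bar>x\<bar> \<partial>std_normal_distribution) \<le> (\<integral>x. (1 + x\<^sup>2) / 2 \<partial>std_normal_distribution)"
    by (intro integral_mono 2 i le)
  also have "\<dots> = 1" using 1 by (simp add: std_normal.prob_space[simplified])
  finally show "(\<integral>x. \<bar>x\<bar> \<partial>std_normal_distribution) \<le> 1" .
qed

text \<open>Both sides are the probability that \<open>T + e * Y \<le> z\<close> for a standard
  normal \<open>Y\<close> independent of \<open>T\<close>, with a different variable integrated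
  first.\<close>

lemma (in prob_space) expectation_Phi_eq:
  assumes [measurable]: "T \<in> borel_measurable M" and e: "0 < e"
  shows "(\<integral>x. Phi ((z - T x) / e) \<partial>M)
    = (\<integral>y. prob {x \<in> space M. T x \<le> z - e * y} \<partial>std_normal_distribution)"
proof -
  interpret pair: pair_prob_space M std_normal_distribution ..
  let ?f = "\<lambda>x y. indicator {y. T x \<le> z - e * y} y :: real"
  have m: "(\<lambda>(x, y). ?f x y) \<in> borel_measurable (M \<Otimes>\<^sub>M std_normal_distribution)"
    by (simp add: indicator_def case_prod_beta) measurable
  have i: "integrable (M \<Otimes>\<^sub>M std_normal_distribution) (\<lambda>(x, y). ?f x y)"
    by (rule pair.integrable_const_bound[where B=1, OF _ m]) (auto simp: indicator_def)
  have "(\<integral>x. Phi ((z - T x) / e) \<partial>M) = (\<integral>x. (\<integral>y. ?f x y \<partial>std_normal_distribution) \<partial>M)"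
  proof (rule Bochner_Integration.integral_cong[OF refl])
    fix x
    have "{y. T x \<le> z - e * y} = {..(z - T x) / e}"
      using e by (auto simp: field_simps)
    then show "Phi ((z - T x) / e) = (\<integral>y. ?f x y \<partial>std_normal_distribution)"
      by (simp add: cdf_def)
  qed
  also have "\<dots> = (\<integral>y. (\<integral>x. ?f x y \<partial>M) \<partial>std_normal_distribution)"
    by (rule pair.Fubini_integral[OF i, symmetric])
  also have "\<dots> = (\<integral>y. prob {x \<in> space M. T x \<le> z - e * y} \<partial>std_normal_distribution)"
  proof (rule Bochner_Integration.integral_cong[OF refl])
    fix y
    have "(\<integral>x. ?f x y \<partial>M) = (\<integral>x. indicator {x \<in> space M. T x \<le> z - e * y} x \<partial>M)"
      by (rule Bochner_Integration.integral_cong) (auto simp: indicator_def)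
    then show "(\<integral>x. ?f x y \<partial>M) = prob {x \<in> space M. T x \<le> z - e * y}"
      by simp
  qed
  finally show ?thesis .
qed

text \<open>Smoothing at scale \<open>e\<close> adds \<open>e\<^sup>2\<close> to the variance of the
  normal limit; this is the price of going back to variance 1.\<close>

lemma Phi_contraction:
  assumes "0 < e" "e \<le> 1"
  shows "\<bar>Phi (z / sqrt (1 + e\<^sup>2)) - Phi z\<bar> \<le> 5/2 * e"
proof -
  have "\<bar>Phi (z / sqrt (1 + e\<^sup>2)) - Phi z + e\<^sup>2 / 2 * (z * std_normal_density z)\<bar> \<le> 2 * (e\<^sup>2)\<^sup>2"
    using Phi_time_expansion[of 1 "e\<^sup>2" z] by simp
  moreover have "\<bar>e\<^sup>2 / 2 * (z * std_normal_density z)\<bar> \<le> e\<^sup>2 / 2"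
    using std_normal_density_bounds(3)[of z] mult_left_mono[of "\<bar>z\<bar> * std_normal_density z" 1 "e\<^sup>2 / 2"]
    by (simp add: abs_mult)
  moreover have "e\<^sup>2 \<le> e" using assms by (simp add: power2_eq_square mult_left_le)
  moreover have "(e\<^sup>2)\<^sup>2 \<le> e" using assms \<open>e\<^sup>2 \<le> e\<close>
    by (smt (verit) mult_left_le power2_eq_square zero_le_power2)
  ultimately show ?thesis by linarith
qed

text \<open>
  If the discrepancy \<open>D\<close> is nearly maximal at \<open>x\<close>, monotonicity of the distribution function keeps
  it large on \<open>[x, x + 4 e]\<close>, so averaging over the Gaussian window of width \<open>e\<close> centred at
  \<open>x + 2 e\<close> retains a fixed proportion of the supremum.
\<close>

lemma (in prob_space) Kolmogorov_smoothing:
  assumes T [measurable]: "T \<in> borel_measurable M" and e: "0 < e" "e \<le> 1"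
    and close: "\<And>z. \<bar>(\<integral>x. Phi ((z - T x) / e) \<partial>M) - Phi (z / sqrt (1 + e\<^sup>2))\<bar> \<le> \<eta>"
  shows "\<bar>prob {x \<in> space M. T x \<le> z} - Phi z\<bar> \<le> 2 * \<eta> + 15 * e"
proof -
  let ?N = std_normal_distribution
  define F where "F = (\<lambda>z. prob {x \<in> space M. T x \<le> z})"
  have F_mono: "F x \<le> F y" if "x \<le> y" for x y
    unfolding F_def using that by (intro finite_measure_mono) auto
  have F_bounds: "0 \<le> F x" "F x \<le> 1" for x unfolding F_def by auto
  have F_meas [measurable]: "F \<in> borel_measurable borel"
    by (rule borel_measurable_mono) (auto simp: mono_def F_mono)
  define D where "D = (\<lambda>z. F z - Phi z)"
  have D_meas [measurable]: "D \<in> borel_measurable borel" unfolding D_def by measurable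
  have D1: "\<bar>D x\<bar> \<le> 1" for x
    using F_bounds[of x] Phi_bounds[of x] unfolding D_def abs_le_iff by linarith
  define K where "K = (SUP x. \<bar>D x\<bar>)"
  have bdd: "bdd_above (range (\<lambda>x. \<bar>D x\<bar>))" using D1 by (auto intro!: bdd_aboveI)
  have DK: "\<bar>D x\<bar> \<le> K" for x unfolding K_def by (rule cSUP_upper[OF _ bdd]) auto
  have int_b: "integrable ?N f" if "f \<in> borel_measurable borel" "\<And>x. \<bar>f x\<bar> \<le> 1" for f :: "real \<Rightarrow> real"
    using that by (intro std_normal.integrable_const_bound[where B=1]) auto
  have iD: "integrable ?N (\<lambda>y. D (z - e * y))" for z
    by (rule int_b) (use D1 in auto)
  have sm: "\<bar>\<integral>y. D (z - e * y) \<partial>?N\<bar> \<le> \<eta> + 7/2 * e" for z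
  proof -
    have iF: "integrable ?N (\<lambda>y. F (z - e * y))"
      by (rule int_b) (use F_bounds in \<open>auto simp: abs_le_iff intro: order_trans[of _ 0]\<close>)
    have iP: "integrable ?N (\<lambda>y. Phi (z - e * y))"
      by (rule int_b) (use Phi_bounds in \<open>auto simp: abs_le_iff intro: order_trans[of _ 0]\<close>)
    have "(\<integral>y. D (z - e * y) \<partial>?N) = (\<integral>y. F (z - e * y) \<partial>?N) - (\<integral>y. Phi (z - e * y) \<partial>?N)"
      unfolding D_def by (rule Bochner_Integration.integral_diff[OF iF iP])
    also have "(\<integral>y. F (z - e * y) \<partial>?N) = (\<integral>x. Phi ((z - T x) / e) \<partial>M)"
      unfolding F_def by (rule expectation_Phi_eq[OF T e(1), symmetric])
    finally have *: "(\<integral>y. D (z - e * y) \<partial>?N)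
      = (\<integral>x. Phi ((z - T x) / e) \<partial>M) - (\<integral>y. Phi (z - e * y) \<partial>?N)" .
    have "(\<integral>y. Phi (z - e * y) \<partial>?N) - Phi z = (\<integral>y. Phi (z - e * y) - Phi z \<partial>?N)"
      using iP by (simp add: std_normal.prob_space[simplified])
    moreover have "\<bar>\<integral>y. Phi (z - e * y) - Phi z \<partial>?N\<bar> \<le> (\<integral>y. e * \<bar>y\<bar> \<partial>?N)"
    proof (rule order_trans[OF integral_abs_bound integral_mono])
      show "\<bar>Phi (z - e * y) - Phi z\<bar> \<le> e * \<bar>y\<bar>" for y
        using Phi_Lipschitz[of "z - e * y" z] e by (simp add: abs_mult)
    qed (use iP std_normal_moments in auto)
    moreover have "(\<integral>y. e * \<bar>y\<bar> \<partial>?N) \<le> e"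
      using std_normal_moments(4) e by simp
    ultimately have "\<bar>(\<integral>y. Phi (z - e * y) \<partial>?N) - Phi z\<bar> \<le> e" by linarith
    then show ?thesis using * close[of z] Phi_contraction[OF e, of z] by linarith
  qed
  \<comment> \<open>The parabola \<open>(c - 4 * e) - (K + c) / 4 * y\<^sup>2\<close> lies below the
    integrand: for \<open>\<bar>y\<bar> \<le> 2\<close> by assumption, outside because it has
    dropped to at most \<open>- K\<close>. Its Gaussian mean needs only the second moment.\<close>
  have low: "3/4 * c - 4 * e - K / 4 \<le> \<eta> + 7/2 * e"
    if c: "\<bar>c\<bar> \<le> K" and b: "\<And>y. \<bar>y\<bar> \<le> 2 \<Longrightarrow> c - 4 * e \<le> sg * D (z - e * y)" and s: "\<bar>sg\<bar> = 1" for c sg z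
  proof -
    have i2: "integrable ?N (\<lambda>y. (c - 4 * e) - (K + c) / 4 * y\<^sup>2)"
      using std_normal_moments by auto
    have "3/4 * c - 4 * e - K / 4 = (\<integral>y. (c - 4 * e) - (K + c) / 4 * y\<^sup>2 \<partial>?N)"
      using std_normal_moments by (simp add: std_normal.prob_space[simplified] field_simps)
    also have "\<dots> \<le> (\<integral>y. sg * D (z - e * y) \<partial>?N)"
    proof (rule integral_mono[OF i2])
      fix y
      have Kc: "0 \<le> K + c" using c by linarith
      show "(c - 4 * e) - (K + c) / 4 * y\<^sup>2 \<le> sg * D (z - e * y)"
      proof (cases "\<bar>y\<bar> \<le> 2")
        case True
        have "0 \<le> (K + c) / 4 * y\<^sup>2" using Kc by simp
        then show ?thesis using b[OF True] by linarith
      next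
        case False
        then have "2\<^sup>2 \<le> \<bar>y\<bar>\<^sup>2" by (intro power_mono) auto
        then have "(K + c) / 4 * 4 \<le> (K + c) / 4 * y\<^sup>2" using Kc by (intro mult_left_mono) auto
        moreover have "\<bar>sg * D (z - e * y)\<bar> \<le> K" using DK s by (simp add: abs_mult)
        then have "- (sg * D (z - e * y)) \<le> K" by linarith
        moreover have "(K + c) / 4 * 4 = K + c" by simp
        ultimately show ?thesis using e by linarith
      qed
    qed (use iD in auto)
    also have "\<dots> \<le> \<bar>sg * (\<integral>y. D (z - e * y) \<partial>?N)\<bar>" by simp
    also have "\<dots> \<le> \<eta> + 7/2 * e" using sm[of z] s by (simp add: abs_mult)
    finally show ?thesis .
  qed
  have "\<bar>D x\<bar> \<le> 4/3 * (\<eta> + 15/2 * e + K / 4)" for x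
  proof -
    have L: "Phi u \<le> Phi x + 4 * e" "Phi x \<le> Phi u + 4 * e" if "\<bar>u - x\<bar> \<le> 4 * e" for u
      using Phi_Lipschitz[of u x] that by linarith+
    have ey: "\<bar>e * y\<bar> \<le> 2 * e" if "\<bar>y\<bar> \<le> 2" for y
      using that e by (simp add: abs_mult)
    have "3/4 * D x - 4 * e - K / 4 \<le> \<eta> + 7/2 * e"
    proof (rule low[of "D x" 1 "x + 2 * e"])
      show "D x - 4 * e \<le> 1 * D (x + 2 * e - e * y)" if "\<bar>y\<bar> \<le> 2" for y
      proof -
        have "x \<le> x + 2 * e - e * y" "\<bar>x + 2 * e - e * y - x\<bar> \<le> 4 * e"
          using ey[OF that] by linarith+
        from F_mono[OF this(1)] L[OF this(2)] show ?thesis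
          by (simp add: D_def)
      qed
    qed (use DK in auto)
    moreover have "3/4 * (- D x) - 4 * e - K / 4 \<le> \<eta> + 7/2 * e"
    proof (rule low[of "- D x" "- 1" "x - 2 * e"])
      show "- D x - 4 * e \<le> - 1 * D (x - 2 * e - e * y)" if "\<bar>y\<bar> \<le> 2" for y
      proof -
        have "x - 2 * e - e * y \<le> x" "\<bar>x - 2 * e - e * y - x\<bar> \<le> 4 * e"
          using ey[OF that] by linarith+
        from F_mono[OF this(1)] L[OF this(2)] show ?thesis
          by (simp add: D_def)
      qed
    qed (use DK in auto)
    ultimately show ?thesis by argo
  qed
  \<comment> \<open>On the right the finite supremum \<open>K\<close> has coefficient 1/3, so the
    inequality can be solved for it.\<close>
  then have "K \<le> 4/3 * (\<eta> + 15/2 * e + K / 4)"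
    unfolding K_def by (intro cSUP_least) auto
  then have "K \<le> 2 * \<eta> + 15 * e" by argo
  then show ?thesis using DK[of z] unfolding D_def F_def by linarith
qed

section \<open>Independent samples\<close>

locale iid_sample = prob_space M for M :: "'a measure" +
  fixes I :: "nat set"
begin

abbreviation P :: "(nat \<Rightarrow> 'a) measure" where
  "P \<equiv> PiM I (\<lambda>_. M)"

sublocale P: prob_space P
  by (intro prob_space_PiM) (rule prob_space_axioms)

lemma fun_upd_measurable [measurable]:
  assumes "k \<in> I"
  shows "(\<lambda>(y, X). X(k := y)) \<in> M \<Otimes>\<^sub>M P \<rightarrow>\<^sub>M P"
proof -
  have "(\<lambda>p. (snd p)(k := fst p)) \<in> M \<Otimes>\<^sub>M P \<rightarrow>\<^sub>M P"
    by (rule measurable_fun_upd[where J=I]) (use assms in auto)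
  then show ?thesis by (simp add: case_prod_beta')
qed

text \<open>Replacing coordinate \<open>k\<close> by an independent copy leaves the product law
  unchanged. The inner integral over \<open>y\<close> plays the part of the conditional expectation
  given the other coordinates.\<close>

lemma resample:
  fixes F :: "(nat \<Rightarrow> 'a) \<Rightarrow> real"
  assumes k: "k \<in> I" and F [measurable]: "F \<in> borel_measurable P" and B: "\<And>X. X \<in> space P \<Longrightarrow> \<bar>F X\<bar> \<le> B"
  shows "(\<integral>X. F X \<partial>P) = (\<integral>X. (\<integral>y. F (X(k := y)) \<partial>M) \<partial>P)"
    and "(\<lambda>X. \<integral>y. F (X(k := y)) \<partial>M) \<in> borel_measurable P"
proof -
  interpret pair: pair_prob_space M P ..
  note [measurable] = fun_upd_measurable[OF k]
  have m: "(\<lambda>(y, X). F (X(k := y))) \<in> borel_measurable (M \<Otimes>\<^sub>M P)"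
    using measurable_compose[OF fun_upd_measurable[OF k] F] by (simp add: case_prod_beta')
  have sp: "X(k := y) \<in> space P" if "y \<in> space M" "X \<in> space P" for X y
    using that k by (auto simp: space_PiM PiE_iff extensional_def)
  have i: "integrable (M \<Otimes>\<^sub>M P) (\<lambda>(y, X). F (X(k := y)))"
    by (rule pair.integrable_const_bound[where B=B, OF _ m]) (auto simp: space_pair_measure intro!: B sp)
  have "P = distr (M \<Otimes>\<^sub>M P) P (\<lambda>(y, X). X(k := y))"
    using distr_pair_PiM_eq_PiM[of I "\<lambda>_. M" k] k prob_space_axioms by (simp add: insert_absorb)
  then have "(\<integral>X. F X \<partial>P) = (\<integral>X. F X \<partial>distr (M \<Otimes>\<^sub>M P) P (\<lambda>(y, X). X(k := y)))"
    by simp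
  also have "\<dots> = (\<integral>p. F (case p of (y, X) \<Rightarrow> X(k := y)) \<partial>(M \<Otimes>\<^sub>M P))"
    by (intro integral_distr) measurable
  also have "\<dots> = (\<integral>p. (case p of (y, X) \<Rightarrow> F (X(k := y))) \<partial>(M \<Otimes>\<^sub>M P))"
    by (simp add: case_prod_beta')
  also have "\<dots> = (\<integral>X. (\<integral>y. F (X(k := y)) \<partial>M) \<partial>P)"
    by (rule pair.integral_snd[OF i, symmetric])
  finally show "(\<integral>X. F X \<partial>P) = (\<integral>X. (\<integral>y. F (X(k := y)) \<partial>M) \<partial>P)" .
  have "(\<lambda>(X, y). F (X(k := y))) \<in> borel_measurable (P \<Otimes>\<^sub>M M)"
    using measurable_compose[OF measurable_pair_swap' m] by (simp add: case_prod_beta')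
  then show "(\<lambda>X. \<integral>y. F (X(k := y)) \<partial>M) \<in> borel_measurable P"
    by (rule borel_measurable_lebesgue_integral)
qed

lemma component_measurable:
  assumes "f \<in> borel_measurable M" "k \<in> I"
  shows "(\<lambda>X. f (X k)) \<in> borel_measurable P"
  using assms by measurable

lemma component_space: "X \<in> space P \<Longrightarrow> k \<in> I \<Longrightarrow> X k \<in> space M"
  by (auto simp: space_PiM)

lemma integral_component:
  fixes f :: "'a \<Rightarrow> real"
  assumes "f \<in> borel_measurable M" "k \<in> I" "\<And>x. x \<in> space M \<Longrightarrow> \<bar>f x\<bar> \<le> B"
  shows "(\<integral>X. f (X k) \<partial>P) = (\<integral>x. f x \<partial>M)"
  using resample(1)[OF assms(2) component_measurable[OF assms(1,2)], of B] assms(2,3)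
  by (simp add: component_space P.prob_space[simplified])

text \<open>Off the diagonal one of the two coordinates can be resampled, and its mean is 0.\<close>

lemma second_moment_centered_sum:
  fixes w :: "'a \<Rightarrow> real"
  assumes w [measurable]: "w \<in> borel_measurable M" and B: "\<And>x. x \<in> space M \<Longrightarrow> \<bar>w x\<bar> \<le> B"
    and c: "(\<integral>x. w x \<partial>M) = 0" and A: "A \<subseteq> I" "finite A"
  shows "(\<integral>X. (\<Sum>l\<in>A. w (X l))\<^sup>2 \<partial>P) = card A * (\<integral>x. (w x)\<^sup>2 \<partial>M)"
proof -
  have wm: "(\<lambda>X. w (X l)) \<in> borel_measurable P" if "l \<in> A" for l
    using component_measurable[OF w] that A by blast
  have bd: "\<bar>w (X k) * w (X l)\<bar> \<le> B * B" if "X \<in> space P" "k \<in> A" "l \<in> A" for X k l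
    unfolding abs_mult using B component_space that A
    by (intro mult_mono) (auto intro: order_trans[OF abs_ge_zero B[OF component_space]])
  have i: "integrable P (\<lambda>X. w (X k) * w (X l))" if "k \<in> A" "l \<in> A" for k l
    using that by (intro P.integrable_const_bound[where B="B * B"] AE_I2) (auto intro!: bd borel_measurable_times wm)
  have val: "(\<integral>X. w (X k) * w (X l) \<partial>P) = (if k = l then (\<integral>x. (w x)\<^sup>2 \<partial>M) else 0)" if kl: "k \<in> A" "l \<in> A" for k l
  proof (cases "k = l")
    case True
    have "\<bar>(w x)\<^sup>2\<bar> \<le> B\<^sup>2" if "x \<in> space M" for x
      using power_mono[OF B[OF that], of 2] by simp
    then show ?thesis using True integral_component[of "\<lambda>x. (w x)\<^sup>2" k "B\<^sup>2"] kl A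
      by (auto simp: power2_eq_square)
  next
    case False
    have "(\<integral>X. w (X k) * w (X l) \<partial>P) = (\<integral>X. (\<integral>y. w y * w (X l) \<partial>M) \<partial>P)"
      using resample(1)[of k "\<lambda>X. w (X k) * w (X l)" "B * B"] kl A False bd wm by auto
    then show ?thesis using False c by simp
  qed
  have "(\<integral>X. (\<Sum>l\<in>A. w (X l))\<^sup>2 \<partial>P) = (\<integral>X. (\<Sum>k\<in>A. \<Sum>l\<in>A. w (X k) * w (X l)) \<partial>P)"
    by (simp add: power2_eq_square sum_product)
  also have "\<dots> = (\<Sum>k\<in>A. \<Sum>l\<in>A. (\<integral>X. w (X k) * w (X l) \<partial>P))"
    using i by (simp add: Bochner_Integration.integral_sum Bochner_Integration.integrable_sum)
  also have "\<dots> = (\<Sum>k\<in>A. \<Sum>l\<in>A. if k = l then (\<integral>x. (w x)\<^sup>2 \<partial>M) else 0)"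
    using val by (intro sum.cong) auto
  also have "\<dots> = card A * (\<integral>x. (w x)\<^sup>2 \<partial>M)"
    using A by simp
  finally show ?thesis .
qed

end

section \<open>Normal approximation of degenerate U-statistics\<close>

text \<open>
  Telescoping bounds for the error sums of the heat-flow argument, where \<open>s = 1 / n\<close> and \<open>t\<close> runs
  through \<open>e\<^sup>2 + i / n\<close> for \<open>i < n\<close>.
\<close>

lemma step_sqrt_bound:
  fixes s t :: real
  assumes "0 < s" "s \<le> t"
  shows "s / (t * sqrt t) \<le> 4 * (1 / sqrt t - 1 / sqrt (t + s))"
proof -
  define p where "p = sqrt t"
  define q where "q = sqrt (t + s)"
  have p: "0 < p" and q: "0 < q" and pp: "p * p = t" and qq: "q * q = t + s"
    using assms by (auto simp: p_def q_def)
  have pq: "p \<le> q" unfolding p_def q_def using assms by auto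
  \<comment> \<open>From \<open>s \<le> t\<close> follows
    \<open>q\<^sup>2 \<le> 2 * p\<^sup>2\<close>, hence \<open>q \<le> 3/2 * p\<close>. The factor
    \<open>q * (p + q)\<close> in \<open>s * q = (q - p) * (q * (p + q))\<close> is then at most
    \<open>15/4 * p\<^sup>2\<close>.\<close>
  have "q\<^sup>2 \<le> (3/2 * p)\<^sup>2" using assms pp qq by (simp add: power2_eq_square)
  then have q2: "q \<le> 3/2 * p" using p by (intro power2_le_imp_le[of q]) auto
  have "q * (p + q) \<le> (3/2 * p) * (p + 3/2 * p)"
    using q2 p q by (intro mult_mono add_left_mono) auto
  also have "\<dots> \<le> 4 * (p * p)" using p by (simp add: algebra_simps)
  finally have a: "q * (p + q) \<le> 4 * (p * p)" .
  have "s = (q - p) * (p + q)" using pp qq by (simp add: algebra_simps)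
  then have "s * q = (q - p) * (q * (p + q))" by simp
  also have "\<dots> \<le> (q - p) * (4 * (p * p))" using a pq by (intro mult_left_mono) auto
  finally have "s * q \<le> 4 * (q - p) * (p * p)" by (simp only: mult_ac)
  then have "s / (p * p * p) \<le> 4 * (1 / p - 1 / q)"
    using p q by (simp add: field_simps)
  then show ?thesis by (simp add: pp p_def[symmetric] q_def[symmetric])
qed

lemma step_ln_bound:
  fixes s t :: real
  assumes "0 < s" "s \<le> t"
  shows "s / t \<le> 2 * (ln (t + s) - ln t)"
proof -
  have "ln (t / (t + s)) \<le> t / (t + s) - 1"
    using assms by (intro ln_le_minus_one) auto
  also have "\<dots> = - (s / (t + s))" using assms by (simp add: field_simps)
  finally have "s / (t + s) \<le> ln (t + s) - ln t"
    using assms by (simp add: ln_div)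
  moreover have "s / (2 * t) \<le> s / (t + s)"
    using assms by (intro divide_left_mono) auto
  ultimately show ?thesis by simp
qed

section \<open>Martingale increments and the heat flow comparison\<close>

context iid_sample
begin

definition ustat_incr :: "('a \<Rightarrow> 'a \<Rightarrow> real) \<Rightarrow> nat \<Rightarrow> (nat \<Rightarrow> 'a) \<Rightarrow> 'a \<Rightarrow> real" where
  "ustat_incr h k X y = (\<Sum>l\<in>{1..<k}. h (X l) y)"

definition ustat :: "('a \<Rightarrow> real) \<Rightarrow> ('a \<Rightarrow> 'a \<Rightarrow> real) \<Rightarrow> nat \<Rightarrow> (nat \<Rightarrow> 'a) \<Rightarrow> real" where
  "ustat \<xi> h k X = (\<Sum>i\<in>{1..k}. \<xi> (X i) + ustat_incr h i X (X i))"

end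

text \<open>\<open>xi_var\<close> makes the linear parts of the \<open>n\<close> observations add up
  to variance 1. \<open>B\<close> serves integrability; the estimates are expressed through the
  moments \<open>\<beta>\<close>, \<open>\<tau>2\<close> and \<open>\<rho>\<close>.\<close>

locale degenerate_ustat = iid_sample M I for M :: "'a measure" and I +
  fixes n :: nat and \<xi> :: "'a \<Rightarrow> real" and h :: "'a \<Rightarrow> 'a \<Rightarrow> real" and B :: real
  assumes I_eq: "I = {1..n}"
    and n_pos: "n \<ge> 1"
    and xi_meas [measurable]: "\<xi> \<in> borel_measurable M"
    and h_meas [measurable]: "(\<lambda>(x, y). h x y) \<in> borel_measurable (M \<Otimes>\<^sub>M M)"
    and xi_bound: "\<And>x. x \<in> space M \<Longrightarrow> \<bar>\<xi> x\<bar> \<le> B"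
    and h_bound: "\<And>x y. x \<in> space M \<Longrightarrow> y \<in> space M \<Longrightarrow> \<bar>h x y\<bar> \<le> B"
    and h_sym: "\<And>x y. h x y = h y x"
    and xi_mean: "(\<integral>x. \<xi> x \<partial>M) = 0"
    and xi_var: "(\<integral>x. (\<xi> x)\<^sup>2 \<partial>M) = 1 / n"
    and h_degenerate: "\<And>x. x \<in> space M \<Longrightarrow> (\<integral>y. h x y \<partial>M) = 0"
begin

definition \<beta> where "\<beta> = (\<integral>x. \<bar>\<xi> x\<bar> ^ 3 \<partial>M)"
definition \<tau>2 where "\<tau>2 = (\<integral>y. (\<integral>x. (h x y)\<^sup>2 \<partial>M) \<partial>M)"
text \<open>The covariance of \<open>\<xi>\<close> with the degenerate kernel, one argument frozen.
  Its norm \<open>\<rho>\<close> can be much smaller than what Cauchy-Schwarz gives from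
  \<open>\<tau>2\<close>.\<close>

definition \<kappa> where "\<kappa> x = (\<integral>y. \<xi> y * h x y \<partial>M)"
definition \<rho> where "\<rho> = sqrt (\<integral>x. (\<kappa> x)\<^sup>2 \<partial>M)"

lemma B_nonneg: "0 \<le> B"
  using not_empty xi_bound by (metis abs_ge_zero ex_in_conv order_trans)

lemma h_meas1: "x \<in> space M \<Longrightarrow> h x \<in> borel_measurable M"
  by measurable

lemma h_meas2: "y \<in> space M \<Longrightarrow> (\<lambda>x. h x y) \<in> borel_measurable M"
  by measurable

lemma kappa_meas [measurable]: "\<kappa> \<in> borel_measurable M"
  unfolding \<kappa>_def by (rule borel_measurable_lebesgue_integral) measurable

lemma bounded_integrable:
  fixes f :: "'a \<Rightarrow> real"
  assumes "f \<in> borel_measurable M" "\<And>x. x \<in> space M \<Longrightarrow> \<bar>f x\<bar> \<le> C"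
  shows "integrable M f"
  using assms by (intro integrable_const_bound[where B=C]) auto

lemma kappa_bound: "x \<in> space M \<Longrightarrow> \<bar>\<kappa> x\<bar> \<le> B * B"
proof -
  assume x: "x \<in> space M"
  have b: "\<bar>\<xi> y * h x y\<bar> \<le> B * B" if "y \<in> space M" for y
    unfolding abs_mult using xi_bound h_bound that x B_nonneg by (intro mult_mono) auto
  have i: "integrable M (\<lambda>y. \<xi> y * h x y)"
    using b x by (intro bounded_integrable[where C="B * B"]) (auto intro: h_meas1)
  have "\<bar>\<kappa> x\<bar> \<le> (\<integral>y. \<bar>\<xi> y * h x y\<bar> \<partial>M)" unfolding \<kappa>_def by (rule integral_abs_bound)
  also have "\<dots> \<le> (\<integral>y. B * B \<partial>M)" using i b by (intro integral_mono) auto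
  finally show ?thesis using prob_space by simp
qed

lemma kappa_mean: "(\<integral>x. \<kappa> x \<partial>M) = 0"
proof -
  interpret pair: pair_prob_space M M ..
  have "(\<lambda>(x, y). \<xi> y * h x y) \<in> borel_measurable (M \<Otimes>\<^sub>M M)" by measurable
  then have i: "integrable (M \<Otimes>\<^sub>M M) (\<lambda>(x, y). \<xi> y * h x y)"
    by (intro pair.integrable_const_bound[where B="B * B"])
       (auto simp: space_pair_measure abs_mult intro!: AE_I2 mult_mono xi_bound h_bound B_nonneg)
  have "(\<integral>x. \<kappa> x \<partial>M) = (\<integral>y. (\<integral>x. \<xi> y * h x y \<partial>M) \<partial>M)"
    unfolding \<kappa>_def by (rule pair.Fubini_integral[OF i, symmetric])
  also have "\<dots> = (\<integral>y. \<xi> y * (\<integral>x. h y x \<partial>M) \<partial>M)"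
    by (simp add: h_sym)
  also have "\<dots> = (\<integral>y. 0 \<partial>M)"
    by (rule Bochner_Integration.integral_cong) (auto simp: h_degenerate)
  finally show ?thesis by simp
qed

lemma incr_meas [measurable]:
  assumes "k \<le> Suc n"
  shows "(\<lambda>(X, y). ustat_incr h k X y) \<in> borel_measurable (P \<Otimes>\<^sub>M M)"
  unfolding ustat_incr_def split_beta
proof (rule borel_measurable_sum)
  fix l assume "l \<in> {1..<k}"
  then have l: "l \<in> I" using assms by (auto simp: I_eq)
  have "(\<lambda>p. (fst p l, snd p)) \<in> P \<Otimes>\<^sub>M M \<rightarrow>\<^sub>M M \<Otimes>\<^sub>M M"
    using l by measurable
  from measurable_compose[OF this h_meas]
  show "(\<lambda>p. h (fst p l) (snd p)) \<in> borel_measurable (P \<Otimes>\<^sub>M M)" by simp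
qed

lemma incr_meas_component:
  assumes "k \<le> n" "1 \<le> k"
  shows "(\<lambda>X. ustat_incr h k X (X k)) \<in> borel_measurable P"
proof -
  have "(\<lambda>X. (X, X k)) \<in> P \<rightarrow>\<^sub>M P \<Otimes>\<^sub>M M"
  proof -
    have "k \<in> I" using assms by (auto simp: I_eq)
    then show ?thesis by measurable
  qed
  from measurable_compose[OF this incr_meas[of k]] assms show ?thesis by simp
qed

lemma ustat_meas: "k \<le> n \<Longrightarrow> ustat \<xi> h k \<in> borel_measurable P"
  unfolding ustat_def
  by (intro borel_measurable_sum borel_measurable_add incr_meas_component component_measurable) (auto simp: I_eq)

lemma incr_bound:
  assumes "X \<in> space P" "y \<in> space M" "k \<le> Suc n"
  shows "\<bar>ustat_incr h k X y\<bar> \<le> n * B"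
proof -
  have "\<bar>ustat_incr h k X y\<bar> \<le> (\<Sum>l\<in>{1..<k}. \<bar>h (X l) y\<bar>)"
    unfolding ustat_incr_def by (rule sum_abs)
  also have "\<dots> \<le> (\<Sum>l\<in>{1..<k}. B)"
  proof (intro sum_mono h_bound)
    fix l assume "l \<in> {1..<k}"
    then show "X l \<in> space M" using assms by (intro component_space) (auto simp: I_eq)
  qed (use assms in auto)
  also have "\<dots> \<le> n * B" using assms B_nonneg by (auto intro!: mult_right_mono)
  finally show ?thesis .
qed

text \<open>For frozen \<open>y\<close> the increment is a sum of independent terms, centred by
  degeneracy, so its second moment grows linearly in the number of terms.\<close>

lemma incr_second_moment:
  assumes "k \<le> n"
  shows "(\<integral>X. (\<integral>y. (ustat_incr h k X y)\<^sup>2 \<partial>M) \<partial>P) \<le> n * \<tau>2"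
proof -
  interpret pair: pair_prob_space P M ..
  have sq: "\<bar>(ustat_incr h k X y)\<^sup>2\<bar> \<le> (n * B)\<^sup>2" if "X \<in> space P" "y \<in> space M" for X y
    using power_mono[OF incr_bound[OF that, of k], of 2] assms by simp
  have "integrable (P \<Otimes>\<^sub>M M) (\<lambda>(X, y). (ustat_incr h k X y)\<^sup>2)"
    using sq assms by (intro pair.integrable_const_bound[where B="(n * B)\<^sup>2"])
      (auto simp: space_pair_measure incr_meas[unfolded split_beta'] case_prod_beta' intro!: AE_I2 borel_measurable_power)
  from pair.Fubini_integral[OF this]
  have "(\<integral>X. (\<integral>y. (ustat_incr h k X y)\<^sup>2 \<partial>M) \<partial>P) = (\<integral>y. (\<integral>X. (ustat_incr h k X y)\<^sup>2 \<partial>P) \<partial>M)" by simp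
  also have "\<dots> = (\<integral>y. card {1..<k} * (\<integral>x. (h x y)\<^sup>2 \<partial>M) \<partial>M)"
  proof (rule Bochner_Integration.integral_cong[OF refl])
    fix y assume y: "y \<in> space M"
    show "(\<integral>X. (ustat_incr h k X y)\<^sup>2 \<partial>P) = card {1..<k} * (\<integral>x. (h x y)\<^sup>2 \<partial>M)"
      unfolding ustat_incr_def
    proof (rule second_moment_centered_sum[where B=B])
      have "(\<integral>x. h x y \<partial>M) = (\<integral>x. h y x \<partial>M)" by (subst h_sym) simp
      then show "(\<integral>x. h x y \<partial>M) = 0" using h_degenerate[OF y] by simp
    qed (use y assms h_bound h_meas2 in \<open>auto simp: I_eq\<close>)
  qed
  also have "\<dots> = card {1..<k} * \<tau>2" by (simp add: \<tau>2_def)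
  also have "\<dots> \<le> n * \<tau>2"
    using assms unfolding \<tau>2_def by (intro mult_right_mono Bochner_Integration.integral_nonneg) auto
  finally show ?thesis .
qed

text \<open>Integrating out \<open>y\<close> turns the increment into a sum of the centred variables
  \<open>\<kappa> (X l)\<close>, whose mean size is of order \<open>sqrt n\<close>; absolute values
  taken term by term would give \<open>n\<close>.\<close>

lemma incr_covariance:
  assumes "k \<le> n"
  shows "(\<integral>X. \<bar>\<integral>y. \<xi> y * ustat_incr h k X y \<partial>M\<bar> \<partial>P) \<le> sqrt n * \<rho>"
proof -
  have *: "(\<integral>y. \<xi> y * ustat_incr h k X y \<partial>M) = (\<Sum>l\<in>{1..<k}. \<kappa> (X l))" if X: "X \<in> space P" for X
  proof -
    have i: "integrable M (\<lambda>y. \<xi> y * h (X l) y)" if "l \<in> {1..<k}" for l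
    proof -
      have "X l \<in> space M" using component_space[OF X, of l] that assms by (auto simp: I_eq)
      then show ?thesis
        by (intro bounded_integrable[where C="B * B"])
           (auto intro!: borel_measurable_times h_meas1 mult_mono xi_bound h_bound B_nonneg simp: abs_mult)
    qed
    have "(\<integral>y. \<xi> y * ustat_incr h k X y \<partial>M) = (\<integral>y. (\<Sum>l\<in>{1..<k}. \<xi> y * h (X l) y) \<partial>M)"
      by (simp add: ustat_incr_def sum_distrib_left)
    also have "\<dots> = (\<Sum>l\<in>{1..<k}. \<kappa> (X l))"
      unfolding \<kappa>_def using i by (rule Bochner_Integration.integral_sum)
    finally show ?thesis .
  qed
  define S where "S = (\<lambda>X. \<Sum>l\<in>{1..<k}. \<kappa> (X l))"
  have Sm [measurable]: "S \<in> borel_measurable P"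
    using assms unfolding S_def by (intro borel_measurable_sum component_measurable kappa_meas) (auto simp: I_eq)
  have Sb: "\<bar>S X\<bar> \<le> (\<Sum>l\<in>{1..<k}. B * B)" if "X \<in> space P" for X
    using that assms unfolding S_def
    by (intro order_trans[OF sum_abs] sum_mono kappa_bound component_space) (auto simp: I_eq)
  have "(\<integral>X. \<bar>\<integral>y. \<xi> y * ustat_incr h k X y \<partial>M\<bar> \<partial>P) = (\<integral>X. \<bar>S X\<bar> \<partial>P)"
    using * by (intro Bochner_Integration.integral_cong) (auto simp: S_def)
  also have "\<dots> \<le> sqrt (\<integral>X. (\<bar>S X\<bar>)\<^sup>2 \<partial>P)"
  proof (rule real_le_rsqrt)
    have i1: "integrable P (\<lambda>X. \<bar>S X\<bar>)"
      using Sb by (intro P.integrable_const_bound[where B="\<Sum>l\<in>{1..<k}. B * B"]) auto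
    have i2: "integrable P (\<lambda>X. \<bar>S X\<bar>\<^sup>2)"
      using Sb power_mono[OF Sb, of _ 2] by (intro P.integrable_const_bound[where B="(\<Sum>l\<in>{1..<k}. B * B)\<^sup>2"]) auto
    have "0 \<le> P.variance (\<lambda>X. \<bar>S X\<bar>)" by simp
    then show "(\<integral>X. \<bar>S X\<bar> \<partial>P)\<^sup>2 \<le> (\<integral>X. (\<bar>S X\<bar>)\<^sup>2 \<partial>P)"
      using P.variance_eq[OF i1 i2] by simp
  qed
  also have "(\<integral>X. (\<bar>S X\<bar>)\<^sup>2 \<partial>P) = card {1..<k} * (\<integral>x. (\<kappa> x)\<^sup>2 \<partial>M)"
    unfolding power2_abs S_def using assms kappa_bound kappa_mean
    by (intro second_moment_centered_sum[where B="B * B"]) (auto simp: I_eq)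
  also have "sqrt \<dots> = sqrt (card {1..<k}) * \<rho>" by (simp add: real_sqrt_mult \<rho>_def)
  also have "\<dots> \<le> sqrt n * \<rho>"
    using assms unfolding \<rho>_def by (intro mult_right_mono) auto
  finally show ?thesis .
qed


lemma ustat_fun_upd:
  assumes "k \<ge> 1"
  shows "ustat \<xi> h k (X(k := y)) = ustat \<xi> h (k - 1) X + \<xi> y + ustat_incr h k X y"
proof -
  obtain j where k: "k = Suc j" using assms by (cases k) auto
  have a: "ustat_incr h i (X(k := y)) z = ustat_incr h i X z" if "i \<le> k" for i z
    unfolding ustat_incr_def using that by (intro sum.cong) auto
  have "{1..k} = insert k {1..j}" using k by auto
  then have "ustat \<xi> h k (X(k := y)) = \<xi> y + ustat_incr h k X y
      + (\<Sum>i\<in>{1..j}. \<xi> ((X(k := y)) i) + ustat_incr h i (X(k := y)) ((X(k := y)) i))"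
    unfolding ustat_def using k a[OF le_refl, of y] by simp
  also have "(\<Sum>i\<in>{1..j}. \<xi> ((X(k := y)) i) + ustat_incr h i (X(k := y)) ((X(k := y)) i)) = ustat \<xi> h j X"
    unfolding ustat_def using k a by (intro sum.cong) auto
  finally show ?thesis using k by (simp add: fun_upd_def)
qed

text \<open>With \<open>X\<close> frozen and only the new observation \<open>y\<close> random, the
  linear terms of \<open>Phi_expansion\<close> integrate to 0, the variance \<open>1 / n\<close> of
  \<open>\<xi>\<close> cancels the time step, and the product of \<open>\<xi> y\<close> with the
  increment leaves the covariance term. The square of the increment and the cube of
  \<open>\<xi>\<close> bound the rest.\<close>

lemma heat_flow_step_pointwise:
  assumes X: "X \<in> space P" and k: "k \<in> {1..n}" and t: "0 < t"
  shows "\<bar>(\<integral>y. Phi ((z - (u + \<xi> y + ustat_incr h k X y)) / sqrt t) \<partial>M) - Phi ((z - u) / sqrt (t + 1 / n))\<bar>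
    \<le> \<bar>\<integral>y. \<xi> y * ustat_incr h k X y \<partial>M\<bar> / t
      + 8 * ((\<integral>y. (ustat_incr h k X y)\<^sup>2 \<partial>M) / t + \<beta> / (t * sqrt t)) + 2 * (1 / n / t)\<^sup>2"
proof -
  define q where "q = sqrt t"
  have q: "0 < q" "q * q = t" using t by (auto simp: q_def)
  define w where "w = (z - u) / q"
  define H where "H = ustat_incr h k X"
  define \<phi> where "\<phi> = std_normal_density w"
  define A where "A = (\<integral>y. \<xi> y * H y \<partial>M)"
  have wp: "\<bar>w * \<phi>\<bar> \<le> 1"
    using std_normal_density_bounds(3)[of w] by (simp add: \<phi>_def abs_mult)
  have Hb: "\<bar>H y\<bar> \<le> n * B" if "y \<in> space M" for y
    unfolding H_def using incr_bound[OF X that] k by auto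
  have Hm [measurable]: "H \<in> borel_measurable M"
  proof -
    have "(\<lambda>y. (X, y)) \<in> M \<rightarrow>\<^sub>M P \<Otimes>\<^sub>M M" using X by measurable
    from measurable_compose[OF this incr_meas[of k]] k show ?thesis by (simp add: H_def[abs_def])
  qed
  have i_xi: "integrable M \<xi>" by (rule bounded_integrable[OF xi_meas xi_bound])
  have i_H: "integrable M H" by (rule bounded_integrable[OF Hm Hb])
  have i_xi2: "integrable M (\<lambda>y. (\<xi> y)\<^sup>2)"
    using power_mono[OF xi_bound, of _ 2] by (intro bounded_integrable[where C="B\<^sup>2"]) auto
  have i_xi3: "integrable M (\<lambda>y. \<bar>\<xi> y\<bar> ^ 3)"
    using power_mono[OF xi_bound, of _ 3] by (intro bounded_integrable[where C="B ^ 3"]) auto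
  have i_H2: "integrable M (\<lambda>y. (H y)\<^sup>2)"
    using power_mono[OF Hb, of _ 2] by (intro bounded_integrable[where C="(n * B)\<^sup>2"]) auto
  have i_xiH: "integrable M (\<lambda>y. \<xi> y * H y)"
    using xi_bound Hb B_nonneg
    by (intro bounded_integrable[where C="B * (n * B)"]) (auto simp: abs_mult intro!: mult_mono)
  have H0: "(\<integral>y. H y \<partial>M) = 0"
  proof -
    have "X l \<in> space M" if "l \<in> {1..<k}" for l
      using component_space[OF X, of l] that k by (auto simp: I_eq)
    then have "(\<integral>y. H y \<partial>M) = (\<Sum>l\<in>{1..<k}. (\<integral>y. h (X l) y \<partial>M))"
      unfolding H_def ustat_incr_def
      by (intro Bochner_Integration.integral_sum bounded_integrable[where C=B] h_meas1 h_bound) auto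
    also have "\<dots> = 0" using \<open>\<And>l. l \<in> {1..<k} \<Longrightarrow> X l \<in> space M\<close>
      by (intro sum.neutral) (auto simp: h_degenerate)
    finally show ?thesis .
  qed
  let ?G = "\<lambda>y. Phi (w + (- \<xi> y / q) + (- H y / q))"
  let ?L = "\<lambda>y. Phi w + (- \<phi> / q) * \<xi> y + (- \<phi> / q) * H y
      - (w * \<phi> / (2 * t)) * (\<xi> y)\<^sup>2 - (w * \<phi> / t) * (\<xi> y * H y)"
  have i_G: "integrable M ?G"
    by (rule bounded_integrable[where C=1])
       (use Phi_bounds in \<open>auto simp: abs_le_iff intro: order_trans[of _ 0]\<close>)
  have i_L: "integrable M ?L"
    using i_xi i_H i_xi2 i_xiH by auto
  have L: "(\<integral>y. ?L y \<partial>M) = Phi w - w * \<phi> / (2 * t) * (1 / n) - w * \<phi> / t * A"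
    using i_xi i_H i_xi2 i_xiH by (simp add: xi_mean H0 xi_var A_def prob_space)
  have exp1: "\<bar>?G y - ?L y\<bar> \<le> 8 * ((H y)\<^sup>2 / t + \<bar>\<xi> y\<bar> ^ 3 / (t * q))" for y
  proof -
    have "?G y - ?L y = Phi (w + (- \<xi> y / q) + (- H y / q)) - Phi w - ((- \<xi> y / q) + (- H y / q)) * \<phi>
      + ((- \<xi> y / q)\<^sup>2 / 2 + (- \<xi> y / q) * (- H y / q)) * (w * \<phi>)"
      by (simp add: q(2)[symmetric] power_divide power2_eq_square field_simps)
    moreover have "(- H y / q)\<^sup>2 + \<bar>- \<xi> y / q\<bar> ^ 3 = (H y)\<^sup>2 / t + \<bar>\<xi> y\<bar> ^ 3 / (t * q)"
      using q(1) by (simp add: q(2)[symmetric] power_divide power2_eq_square power3_eq_cube)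
    ultimately show ?thesis
      using Phi_expansion[of w "- \<xi> y / q" "- H y / q"] by (simp only: \<phi>_def)
  qed
  have "\<bar>(\<integral>y. ?G y \<partial>M) - (\<integral>y. ?L y \<partial>M)\<bar> = \<bar>\<integral>y. ?G y - ?L y \<partial>M\<bar>"
    by (rule arg_cong[where f=abs], rule Bochner_Integration.integral_diff[OF i_G i_L, symmetric])
  also have "\<dots> \<le> (\<integral>y. 8 * ((H y)\<^sup>2 / t + \<bar>\<xi> y\<bar> ^ 3 / (t * q)) \<partial>M)"
  proof (rule order_trans[OF integral_abs_bound integral_mono])
    show "integrable M (\<lambda>y. \<bar>?G y - ?L y\<bar>)" by (rule integrable_abs[OF Bochner_Integration.integrable_diff[OF i_G i_L]])
  qed (use exp1 i_H2 i_xi3 in auto)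
  also have "\<dots> = 8 * ((\<integral>y. (H y)\<^sup>2 \<partial>M) / t + \<beta> / (t * q))"
    using i_H2 i_xi3 by (simp add: \<beta>_def)
  finally have 1: "\<bar>(\<integral>y. ?G y \<partial>M) - (Phi w - w * \<phi> / (2 * t) * (1 / n) - w * \<phi> / t * A)\<bar>
    \<le> 8 * ((\<integral>y. (H y)\<^sup>2 \<partial>M) / t + \<beta> / (t * q))" unfolding L .
  have 2: "\<bar>Phi ((z - u) / sqrt (t + 1 / n)) - Phi w + w * \<phi> / (2 * t) * (1 / n)\<bar> \<le> 2 * (1 / n / t)\<^sup>2"
    using Phi_time_expansion[OF t, of "1 / n" "z - u"] by (simp add: w_def \<phi>_def q_def mult_ac)
  have 3: "\<bar>w * \<phi> / t * A\<bar> \<le> \<bar>A\<bar> / t"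
    using mult_right_mono[OF wp, of "\<bar>A\<bar> / t"] t by (simp add: abs_mult)
  have 4: "(\<integral>y. Phi ((z - (u + \<xi> y + H y)) / sqrt t) \<partial>M) = (\<integral>y. ?G y \<partial>M)"
    by (rule Bochner_Integration.integral_cong) (auto simp: w_def q_def diff_divide_distrib add_divide_distrib diff_diff_eq add.assoc)
  show ?thesis
    unfolding H_def[symmetric] A_def[symmetric] q_def[symmetric] 4[unfolded q_def[symmetric]]
    using 1 2 3 unfolding q_def[symmetric] by argo
qed

lemma heat_flow_step:
  assumes k: "k \<in> {1..n}" and t: "0 < t"
  shows "\<bar>(\<integral>X. Phi ((z - ustat \<xi> h k X) / sqrt t) \<partial>P)
      - (\<integral>X. Phi ((z - ustat \<xi> h (k - 1) X) / sqrt (t + 1 / n)) \<partial>P)\<bar>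
    \<le> sqrt n * \<rho> / t + 8 * (n * \<tau>2 / t + \<beta> / (t * sqrt t)) + 2 * (1 / n / t)\<^sup>2"
proof -
  have kI: "k \<in> I" and kn: "k \<le> n" and k1: "k \<ge> 1" using k by (auto simp: I_eq)
  note [measurable] = ustat_meas[OF kn] incr_meas[OF le_SucI[OF kn]]
  have Phib: "\<bar>Phi x\<bar> \<le> 1" for x
    using Phi_bounds[of x] by simp
  define F where "F = (\<lambda>X. Phi ((z - ustat \<xi> h k X) / sqrt t))"
  define F' where "F' = (\<lambda>X. Phi ((z - ustat \<xi> h (k - 1) X) / sqrt (t + 1 / n)))"
  define R where "R = (\<lambda>X. \<integral>y. F (X(k := y)) \<partial>M)"
  define a where "a = (\<lambda>X. \<bar>\<integral>y. \<xi> y * ustat_incr h k X y \<partial>M\<bar>)"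
  define b where "b = (\<lambda>X. \<integral>y. (ustat_incr h k X y)\<^sup>2 \<partial>M)"
  have Fm: "F \<in> borel_measurable P" unfolding F_def by measurable
  have F'm: "F' \<in> borel_measurable P" unfolding F'_def using ustat_meas[of "k - 1"] kn by simp
  have Fb: "\<bar>F X\<bar> \<le> 1" "\<bar>F' X\<bar> \<le> 1" for X unfolding F_def F'_def by (rule Phib)+
  have R: "(\<integral>X. F X \<partial>P) = (\<integral>X. R X \<partial>P)" "R \<in> borel_measurable P"
    unfolding R_def by (rule resample[OF kI Fm Fb(1)])+
  \<comment> \<open>A non-integrable \<open>f\<close> has integral 0, so the bound holds for it as
    well.\<close>
  have bd: "\<bar>\<integral>y. f y \<partial>M\<bar> \<le> C" if "\<And>y. y \<in> space M \<Longrightarrow> \<bar>f y\<bar> \<le> C" "0 \<le> C" for f :: "'a \<Rightarrow> real" and C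
  proof (cases "integrable M f")
    case True
    have "\<bar>\<integral>y. f y \<partial>M\<bar> \<le> (\<integral>y. \<bar>f y\<bar> \<partial>M)" by (rule integral_abs_bound)
    also have "\<dots> \<le> (\<integral>y. C \<partial>M)" using True that(1) by (intro integral_mono) auto
    finally show ?thesis using prob_space by simp
  qed (use that in \<open>simp add: not_integrable_integral_eq\<close>)
  have i: "integrable P R" "integrable P F'" "integrable P a" "integrable P b"
  proof -
    have Hb: "\<bar>ustat_incr h k X y\<bar> \<le> n * B" if "X \<in> space P" "y \<in> space M" for X y
      using incr_bound[OF that, of k] kn by simp
    show "integrable P R"
      by (rule P.integrable_const_bound[where B=1, OF _ R(2)]) (auto simp: R_def intro!: bd Fb AE_I2)
    show "integrable P F'"
      by (rule P.integrable_const_bound[where B=1]) (auto simp: F'm Fb)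
    have "\<bar>\<xi> y * ustat_incr h k X y\<bar> \<le> B * (n * B)" if "X \<in> space P" "y \<in> space M" for X y
      unfolding abs_mult using that by (intro mult_mono xi_bound Hb B_nonneg) auto
    then show "integrable P a"
      by (intro P.integrable_const_bound[where B="B * (n * B)"] AE_I2)
         (auto simp: a_def B_nonneg intro!: bd borel_measurable_abs borel_measurable_lebesgue_integral)
    have "\<bar>(ustat_incr h k X y)\<^sup>2\<bar> \<le> (n * B)\<^sup>2" if "X \<in> space P" "y \<in> space M" for X y
      using power_mono[OF Hb[OF that], of 2] by simp
    then have "AE X in P. norm (b X) \<le> (n * B)\<^sup>2"
      unfolding b_def real_norm_def by (intro AE_I2 bd) auto
    then show "integrable P b"
      by (rule P.integrable_const_bound)
         (auto simp: b_def intro!: borel_measurable_lebesgue_integral)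
  qed
  have "\<bar>(\<integral>X. F X \<partial>P) - (\<integral>X. F' X \<partial>P)\<bar> = \<bar>\<integral>X. R X - F' X \<partial>P\<bar>"
    unfolding R(1) using i by simp
  also have "\<dots> \<le> (\<integral>X. a X / t + 8 * (b X / t + \<beta> / (t * sqrt t)) + 2 * (1 / n / t)\<^sup>2 \<partial>P)"
  proof (rule order_trans[OF integral_abs_bound integral_mono])
    fix X assume X: "X \<in> space P"
    show "\<bar>R X - F' X\<bar> \<le> a X / t + 8 * (b X / t + \<beta> / (t * sqrt t)) + 2 * (1 / n / t)\<^sup>2"
      using heat_flow_step_pointwise[OF X k t, of z "ustat \<xi> h (k - 1) X"]
      unfolding R_def F_def F'_def a_def b_def ustat_fun_upd[OF k1] .
  qed (use i in auto)
  also have "\<dots> = (\<integral>X. a X \<partial>P) / t + 8 * ((\<integral>X. b X \<partial>P) / t + \<beta> / (t * sqrt t)) + 2 * (1 / n / t)\<^sup>2"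
    using i by (simp add: P.prob_space)
  also have "\<dots> \<le> sqrt n * \<rho> / t + 8 * (n * \<tau>2 / t + \<beta> / (t * sqrt t)) + 2 * (1 / n / t)\<^sup>2"
    using incr_covariance[OF kn] incr_second_moment[OF kn] t
    by (intro add_mono mult_left_mono divide_right_mono) (auto simp: a_def b_def)
  finally show ?thesis unfolding F_def F'_def .
qed

text \<open>Along the time grid the terms with \<open>1 / t\<close> add up to the logarithm and
  those with \<open>1 / (t * sqrt t)\<close> to at most \<open>4 / e\<close>. The assumption
  \<open>1 \<le> n * e\<^sup>2\<close> keeps the step \<open>1 / n\<close> below the smallest time
  \<open>e\<^sup>2\<close>.\<close>

theorem ustat_smoothed_normal_approximation:
  fixes e z :: real
  assumes e: "0 < e" and ne: "1 \<le> n * e\<^sup>2"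
  shows "\<bar>(\<integral>X. Phi ((z - ustat \<xi> h n X) / e) \<partial>P) - Phi (z / sqrt (1 + e\<^sup>2))\<bar>
    \<le> 2 * ln ((1 + e\<^sup>2) / e\<^sup>2) * (n * (sqrt n * \<rho> + 8 * n * \<tau>2)) + 4 * (8 * n * \<beta> + 2 / sqrt n) / e"
proof -
  define s where "s = 1 / real n"
  have s: "0 < s" "n * s = 1" "s \<le> e\<^sup>2" "1 / sqrt n = sqrt s"
    using n_pos ne by (auto simp: s_def field_simps real_sqrt_divide)
  \<comment> \<open>Time falls from \<open>1 + e\<^sup>2\<close> for the empty sum to
    \<open>e\<^sup>2\<close> for the full one: the variance of the observations still missing is
    supplied by the heat kernel.\<close>
  define t where "t = (\<lambda>i::nat. e\<^sup>2 + (real n - real i) * s)"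
  have t_pos: "s \<le> t i" if "i \<le> n" for i
    using s that by (simp add: t_def add_increasing2)
  have t_Suc: "t i = t (Suc i) + s" for i by (simp add: t_def algebra_simps)
  define A where "A = (\<lambda>i. \<integral>X. Phi ((z - ustat \<xi> h i X) / sqrt (t i)) \<partial>P)"
  define c1 where "c1 = n * (sqrt n * \<rho> + 8 * n * \<tau>2)"
  define c2 where "c2 = 8 * n * \<beta> + 2 / sqrt n"
  have nn: "0 \<le> \<rho>" "0 \<le> \<tau>2" "0 \<le> \<beta>"
    by (auto simp: \<rho>_def \<tau>2_def \<beta>_def intro!: Bochner_Integration.integral_nonneg)
  then have c: "0 \<le> c1" "0 \<le> c2" by (auto simp: c1_def c2_def)
  have step: "\<bar>A (Suc i) - A i\<bar> \<le> c1 * (2 * (ln (t i) - ln (t (Suc i))))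
      + c2 * (4 * (1 / sqrt (t (Suc i)) - 1 / sqrt (t i)))" if i: "Suc i \<le> n" for i
  proof -
    define T where "T = t (Suc i)"
    have T: "0 < T" "s \<le> T" using t_pos[OF i] s(1) by (auto simp: T_def)
    have "s / T = (s / sqrt T) / sqrt T" using T by (simp add: field_simps)
    \<comment> \<open>\<open>s \<le> T\<close> trades the time error \<open>(s / T)\<^sup>2\<close>
      for \<open>sqrt s\<close> times a summand of the type \<open>s / (T * sqrt T)\<close>; this is
      the origin of \<open>2 / sqrt n\<close> in \<open>c2\<close>.\<close>
    have "s = sqrt s * sqrt s" using s by simp
    also have "\<dots> \<le> sqrt s * sqrt T" using T s by (intro mult_left_mono) auto
    finally have "s / sqrt T \<le> sqrt s" using T by (simp add: field_simps)
    then have "(s / sqrt T) * (s / (T * sqrt T)) \<le> sqrt s * (s / (T * sqrt T))"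
      using T s by (intro mult_right_mono) auto
    moreover have "(s / T)\<^sup>2 = (s / sqrt T) * (s / (T * sqrt T))"
      using T by (simp add: power2_eq_square field_simps)
    ultimately have sq: "(s / T)\<^sup>2 \<le> sqrt s * (s / (T * sqrt T))" by simp
    have "\<bar>A (Suc i) - A i\<bar> \<le> sqrt n * \<rho> / T + 8 * (n * \<tau>2 / T + \<beta> / (T * sqrt T)) + 2 * (s / T)\<^sup>2"
      using heat_flow_step[of "Suc i" T z] i T unfolding A_def t_Suc[of i] T_def s_def by simp
    also have "\<dots> \<le> sqrt n * \<rho> / T + 8 * (n * \<tau>2 / T + \<beta> / (T * sqrt T)) + 2 * (sqrt s * (s / (T * sqrt T)))"
      using sq by simp
    also have "\<dots> = c1 * (s / T) + c2 * (s / (T * sqrt T))"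
    proof -
      have "c1 * s = (n * s) * (sqrt n * \<rho> + 8 * n * \<tau>2)"
        "c2 * s = (n * s) * (8 * \<beta>) + 2 * sqrt s * s"
        unfolding c1_def c2_def s(4)[symmetric] by (simp_all add: algebra_simps)
      then have "c1 * s = sqrt n * \<rho> + 8 * n * \<tau>2" "c2 * s = 8 * \<beta> + 2 * sqrt s * s"
        using s(2) by simp_all
      then have "c1 * (s / T) = (sqrt n * \<rho> + 8 * n * \<tau>2) / T"
        "c2 * (s / (T * sqrt T)) = (8 * \<beta> + 2 * sqrt s * s) / (T * sqrt T)" by simp_all
      then show ?thesis by (simp add: add_divide_distrib)
    qed
    also have "\<dots> \<le> c1 * (2 * (ln (T + s) - ln T)) + c2 * (4 * (1 / sqrt T - 1 / sqrt (T + s)))"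
      using c s T by (intro add_mono mult_left_mono step_ln_bound step_sqrt_bound) auto
    finally show ?thesis unfolding t_Suc[of i] T_def .
  qed
  have "\<bar>A k - A 0\<bar> \<le> c1 * (2 * (ln (t 0) - ln (t k))) + c2 * (4 * (1 / sqrt (t k) - 1 / sqrt (t 0)))" if "k \<le> n" for k
    using that
  proof (induction k)
    case (Suc k)
    have "\<bar>A (Suc k) - A 0\<bar> \<le> \<bar>A (Suc k) - A k\<bar> + \<bar>A k - A 0\<bar>" by linarith
    then show ?case using step[of k] Suc by (simp add: algebra_simps)
  qed simp
  from this[of n]
  have "\<bar>A n - A 0\<bar> \<le> c1 * (2 * (ln (t 0) - ln (t n))) + c2 * (4 * (1 / sqrt (t n) - 1 / sqrt (t 0)))" by simp
  also have "t n = e\<^sup>2" by (simp add: t_def)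
  also have t0: "t 0 = 1 + e\<^sup>2" using s by (simp add: t_def)
  also have "ln (1 + e\<^sup>2) - ln (e\<^sup>2) = ln ((1 + e\<^sup>2) / e\<^sup>2)"
    using e by (subst ln_div) (auto simp: add_nonneg_eq_0_iff)
  also have "c2 * (4 * (1 / sqrt (e\<^sup>2) - 1 / sqrt (1 + e\<^sup>2))) \<le> c2 * (4 * (1 / e))"
    using c e by (intro mult_left_mono) auto
  finally have "\<bar>A n - A 0\<bar> \<le> c1 * (2 * ln ((1 + e\<^sup>2) / e\<^sup>2)) + c2 * (4 * (1 / e))" by simp
  moreover have "A n = (\<integral>X. Phi ((z - ustat \<xi> h n X) / e) \<partial>P)"
    using e by (simp add: A_def t_def)
  moreover have "A 0 = Phi (z / sqrt (1 + e\<^sup>2))"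
    unfolding A_def t0 by (simp add: ustat_def P.prob_space)
  ultimately show ?thesis unfolding c1_def c2_def by (simp add: mult_ac)
qed

end

section \<open>Wavelet kernels and projections\<close>

locale compact_wavelet =
  fixes \<psi> :: "real \<Rightarrow> real" and S d :: nat and A :: real
  assumes cont: "continuous_on UNIV \<psi>"
    and vanish: "\<And>x. x \<notin> {0..real S} \<Longrightarrow> \<psi> x = 0"
    and bound: "\<And>x. \<bar>\<psi> x\<bar> \<le> A"
    and orth: "\<And>(k::int) (l::int). (\<integral>x. \<psi> (x - k) * \<psi> (x - l) \<partial>lborel) = (if k = l then 1 else 0)"
    and moments: "\<And>i. i \<le> d \<Longrightarrow> (\<integral>x. x ^ i * \<psi> x \<partial>lborel) = 0"
begin

lemma A_nonneg: "0 \<le> A"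
  using bound[of 0] by linarith

lemma psi_meas [measurable]: "\<psi> \<in> borel_measurable borel"
  using cont by (rule borel_measurable_continuous_onI)

lemma wavelet_meas [measurable]: "wavelet \<psi> j k \<in> borel_measurable borel"
  unfolding wavelet_def[abs_def] by measurable

lemma half_powr_square: "(2 powr (real j / 2)) * (2 powr (real j / 2)) = (2::real) ^ j"
  by (simp add: powr_add[symmetric] powr_realpow)

lemma wavelet_nonzeroD:
  assumes "wavelet \<psi> j k x \<noteq> 0"
  shows "real_of_int k \<le> 2 ^ j * x" "2 ^ j * x \<le> k + S"
  using assms vanish[of "2 ^ j * x - k"] by (force simp: wavelet_def)+

lemma wavelet_bound: "\<bar>wavelet \<psi> j k x\<bar> \<le> 2 powr (real j / 2) * A"
  unfolding wavelet_def abs_mult using bound by (auto intro!: mult_left_mono)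

lemma wavelet_prod_bound: "\<bar>wavelet \<psi> j k x * wavelet \<psi> j l y\<bar> \<le> 2 ^ j * A\<^sup>2"
proof -
  have "\<bar>wavelet \<psi> j k x * wavelet \<psi> j l y\<bar> \<le> (2 powr (real j / 2) * A) * (2 powr (real j / 2) * A)"
    unfolding abs_mult by (intro mult_mono wavelet_bound) (auto simp: A_nonneg)
  also have "\<dots> = (2 powr (real j / 2) * 2 powr (real j / 2)) * A\<^sup>2"
    by (simp only: power2_eq_square mult_ac)
  also have "\<dots> = 2 ^ j * A\<^sup>2" by (simp only: half_powr_square)
  finally show ?thesis .
qed

text \<open>Contains every translate that is nonzero at \<open>x\<close>. Listing them as an image
  of \<open>{0..S}\<close> gives the kernel as a sum over an index set that does not move with
  \<open>x\<close>, hence its joint measurability.\<close>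

definition active :: "nat \<Rightarrow> real \<Rightarrow> int set" where
  "active j x = (\<lambda>i. \<lfloor>2 ^ j * x\<rfloor> - int i) ` {0..S}"

lemma finite_active: "finite (active j x)" and card_active: "card (active j x) \<le> S + 1"
  unfolding active_def using card_image_le[of "{0..S}"] by auto

lemma wavelet_nonzero_active:
  assumes "wavelet \<psi> j k x \<noteq> 0"
  shows "k \<in> active j x"
proof -
  note * = wavelet_nonzeroD[OF assms]
  have 1: "k \<le> \<lfloor>2 ^ j * x\<rfloor>" using *(1) by (simp add: le_floor_iff)
  have "\<lfloor>2 ^ j * x\<rfloor> \<le> k + int S" using *(2) by linarith
  then show ?thesis unfolding active_def using 1
    by (intro image_eqI[of _ _ "nat (\<lfloor>2 ^ j * x\<rfloor> - k)"]) auto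
qed

lemma kernel_eq_sum:
  assumes "finite K" "\<And>k. wavelet \<psi> j k x * wavelet \<psi> j k y \<noteq> 0 \<Longrightarrow> k \<in> K"
  shows "wavelet_kernel \<psi> j x y = (\<Sum>k\<in>K. wavelet \<psi> j k x * wavelet \<psi> j k y)"
proof -
  have "wavelet_kernel \<psi> j x y = (\<Sum>\<^sub>\<infinity>k\<in>K. wavelet \<psi> j k x * wavelet \<psi> j k y)"
    unfolding wavelet_kernel_def using assms(2) by (intro infsum_cong_neutral) auto
  then show ?thesis using assms(1) by simp
qed

lemma kernel_sym: "wavelet_kernel \<psi> j x y = wavelet_kernel \<psi> j y x"
  unfolding wavelet_kernel_def by (simp add: mult.commute)

lemma kernel_active: "wavelet_kernel \<psi> j x y
    = (\<Sum>k\<in>active j x. wavelet \<psi> j k x * wavelet \<psi> j k y)"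
  by (rule kernel_eq_sum) (auto simp: finite_active wavelet_nonzero_active)

lemma kernel_meas [measurable]: "(\<lambda>(x, y). wavelet_kernel \<psi> j x y) \<in> borel_measurable (borel \<Otimes>\<^sub>M borel)"
proof -
  have inj: "inj_on (\<lambda>i. \<lfloor>2 ^ j * x\<rfloor> - int i) {0..S}" for x :: real
    by (auto simp: inj_on_def)
  have "(\<lambda>(x, y). wavelet_kernel \<psi> j x y) = (\<lambda>p. \<Sum>i\<in>{0..S}.
      (2 powr (real j / 2) * \<psi> (2 ^ j * fst p - real_of_int (\<lfloor>2 ^ j * fst p\<rfloor> - int i))) *
      (2 powr (real j / 2) * \<psi> (2 ^ j * snd p - real_of_int (\<lfloor>2 ^ j * fst p\<rfloor> - int i))))"
    unfolding kernel_active active_def sum.reindex[OF inj]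
    by (simp add: wavelet_def case_prod_beta' o_def)
  also have "\<dots> \<in> borel_measurable (borel \<Otimes>\<^sub>M borel)" by measurable
  finally show ?thesis .
qed

lemma kernel_bound: "\<bar>wavelet_kernel \<psi> j x y\<bar> \<le> (real S + 1) * A\<^sup>2 * 2 ^ j"
proof -
  have "\<bar>wavelet_kernel \<psi> j x y\<bar> \<le> (\<Sum>k\<in>active j x. \<bar>wavelet \<psi> j k x * wavelet \<psi> j k y\<bar>)"
    unfolding kernel_active by (rule sum_abs)
  also have "\<dots> \<le> card (active j x) * (2 ^ j * A\<^sup>2)"
    using sum_bounded_above[of "active j x" "\<lambda>k. \<bar>wavelet \<psi> j k x * wavelet \<psi> j k y\<bar>" "2 ^ j * A\<^sup>2"] wavelet_prod_bound by simp
  also have "\<dots> \<le> real (S + 1) * (2 ^ j * A\<^sup>2)"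
    using card_active by (intro mult_right_mono) (auto simp only: of_nat_le_iff, simp)
  finally show ?thesis by (simp add: mult_ac add.commute)
qed

lemma kernel_local:
  assumes "wavelet_kernel \<psi> j x y \<noteq> 0"
  shows "\<bar>x - y\<bar> \<le> S / 2 ^ j"
proof -
  obtain k where "wavelet \<psi> j k x * wavelet \<psi> j k y \<noteq> 0"
    using assms unfolding kernel_active by (meson sum.not_neutral_contains_not_neutral)
  then have "\<bar>2 ^ j * x - 2 ^ j * y\<bar> \<le> S"
    using wavelet_nonzeroD[of j k x] wavelet_nonzeroD[of j k y] by auto
  then have "2 ^ j * \<bar>x - y\<bar> \<le> S"
    by (simp add: abs_mult right_diff_distrib[symmetric])
  then show ?thesis by (simp add: field_simps)
qed

lemma orth_scaled: "(\<integral>x. wavelet \<psi> j k x * wavelet \<psi> j l x \<partial>lborel) = (if k = l then 1 else 0)"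
proof -
  have "(\<integral>x. \<psi> (x - k) * \<psi> (x - l) \<partial>lborel)
      = \<bar>2 ^ j\<bar> *\<^sub>R (\<integral>x. \<psi> ((0 + 2 ^ j * x) - k) * \<psi> ((0 + 2 ^ j * x) - l) \<partial>lborel)"
    by (rule lborel_integral_real_affine) auto
  also have "\<dots> = (\<integral>x. 2 ^ j * (\<psi> (2 ^ j * x - k) * \<psi> (2 ^ j * x - l)) \<partial>lborel)" by simp
  also have "\<dots> = (\<integral>x. wavelet \<psi> j k x * wavelet \<psi> j l x \<partial>lborel)"
    unfolding wavelet_def half_powr_square[symmetric] by (intro Bochner_Integration.integral_cong) (auto simp: mult_ac)
  finally show ?thesis using orth[of k l] by simp
qed

lemma bounded_support_integrable:
  fixes g :: "real \<Rightarrow> real"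
  assumes "g \<in> borel_measurable borel" "\<And>x. \<bar>g x\<bar> \<le> C" "\<And>x. x \<notin> {a..b} \<Longrightarrow> g x = 0"
  shows "integrable lborel g"
proof -
  have "integrable lborel (\<lambda>x. C * indicator {a..b} x :: real)"
    by (intro integrable_mult_right integrable_real_indicator) (auto simp: emeasure_lborel_Icc_eq)
  then show ?thesis
    by (rule Bochner_Integration.integrable_bound)
       (use assms order_trans[OF abs_ge_zero assms(2)] in \<open>auto simp: indicator_def\<close>)
qed

lemma wavelet_support:
  assumes "x \<notin> {real_of_int k / 2 ^ j..(real_of_int k + real S) / 2 ^ j}"
  shows "wavelet \<psi> j k x = 0"
  using wavelet_nonzeroD[of j k x] assms by (auto simp: field_simps)

lemma wavelet_times_integrable:
  assumes [measurable]: "g \<in> borel_measurable borel" and "\<And>x. \<bar>g x\<bar> \<le> C"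
  shows "integrable lborel (\<lambda>x. wavelet \<psi> j k x * g x)"
  using assms wavelet_support[where k=k and j=j]
  by (intro bounded_support_integrable[where C="2 powr (real j / 2) * A * C" and a="real_of_int k / 2 ^ j" and b="(real_of_int k + real S) / 2 ^ j"])
     (auto simp: abs_mult A_nonneg intro!: mult_mono wavelet_bound)

definition coef :: "nat \<Rightarrow> (real \<Rightarrow> real) \<Rightarrow> int \<Rightarrow> real" where
  "coef j g k = (\<integral>x. wavelet \<psi> j k x * g x \<partial>lborel)"

text \<open>A finite set containing all translates that are nonzero somewhere on
  \<open>[-2, 2]\<close>; the functions projected below vanish outside that interval.\<close>

definition relevant :: "nat \<Rightarrow> int set" where
  "relevant j = {- (2 * 2 ^ j + int S)..2 * 2 ^ j + int S}"

lemma relevantI: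
  assumes "wavelet \<psi> j k x \<noteq> 0" "x \<in> {-2..2}"
  shows "k \<in> relevant j"
proof -
  note * = wavelet_nonzeroD[OF assms(1)]
  have "2 ^ j * x \<le> 2 ^ j * 2" "2 ^ j * (-2) \<le> 2 ^ j * x"
    using assms(2) by (intro mult_left_mono; simp)+
  then have "real_of_int k \<le> real_of_int (2 * 2 ^ j + int S)" "real_of_int (- (2 * 2 ^ j + int S)) \<le> k"
  proof -
    have "real_of_int (2 * 2 ^ j + int S) = 2 ^ j * 2 + real S"
      "real_of_int (- (2 * 2 ^ j + int S)) = 2 ^ j * (-2) - real S" by simp_all
    then show "real_of_int k \<le> real_of_int (2 * 2 ^ j + int S)" "real_of_int (- (2 * 2 ^ j + int S)) \<le> k"
      using * \<open>2 ^ j * x \<le> 2 ^ j * 2\<close> \<open>2 ^ j * (-2) \<le> 2 ^ j * x\<close> by linarith+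
  qed
  then show ?thesis unfolding relevant_def of_int_le_iff by simp
qed

end

section \<open>Projections of bounded functions supported in [-2, 2]\<close>

locale compact_wavelet_function = compact_wavelet +
  fixes g :: "real \<Rightarrow> real" and C :: real
  assumes g_meas [measurable]: "g \<in> borel_measurable borel"
    and g_bound: "\<And>x. \<bar>g x\<bar> \<le> C"
    and g_support: "\<And>x. x \<notin> {-2..2} \<Longrightarrow> g x = 0"
begin

lemma proj_eq_sum: "wavelet_proj \<psi> j g x = (\<Sum>k\<in>relevant j. coef j g k * wavelet \<psi> j k x)"
proof -
  have "wavelet_kernel \<psi> j x y * g y = (\<Sum>k\<in>relevant j. wavelet \<psi> j k x * (wavelet \<psi> j k y * g y))" for y
  proof (cases "y \<in> {-2..2}")
    case True
    then have "wavelet_kernel \<psi> j x y = (\<Sum>k\<in>relevant j. wavelet \<psi> j k x * wavelet \<psi> j k y)"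
      by (intro kernel_eq_sum) (auto simp: relevant_def[symmetric] intro: relevantI, simp add: relevant_def)
    then show ?thesis by (simp add: sum_distrib_left sum_distrib_right mult_ac)
  qed (simp add: g_support)
  then have "wavelet_proj \<psi> j g x
      = (\<Sum>k\<in>relevant j. (\<integral>y. wavelet \<psi> j k x * (wavelet \<psi> j k y * g y) \<partial>lborel))"
    unfolding wavelet_proj_def
    by (simp add: Bochner_Integration.integral_sum wavelet_times_integrable[OF g_meas g_bound])
  then show ?thesis by (simp add: coef_def mult.commute)
qed

lemma coef_irrelevant:
  assumes "k \<notin> relevant j"
  shows "coef j g k = 0"
proof -
  have "wavelet \<psi> j k x * g x = 0" for x
    using relevantI[of j k x] g_support[of x] assms by auto
  then show ?thesis by (simp only: coef_def) simp
qed

lemma proj_meas [measurable]: "wavelet_proj \<psi> j g \<in> borel_measurable borel"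
  unfolding proj_eq_sum[abs_def] by measurable

text \<open>At most \<open>S + 1\<close> terms are active at \<open>x\<close>. Coefficients need to
  be bounded only for translates that do not vanish at \<open>x\<close>, so that points far from all
  defect points profit from the smaller coefficients there.\<close>

lemma proj_bound:
  assumes "\<And>k. k \<in> relevant j \<Longrightarrow> wavelet \<psi> j k x \<noteq> 0 \<Longrightarrow> \<bar>coef j g k\<bar> \<le> D" "0 \<le> D"
  shows "\<bar>wavelet_proj \<psi> j g x\<bar> \<le> (real S + 1) * A * (2 powr (real j / 2) * D)"
proof -
  let ?t = "\<lambda>k. \<bar>coef j g k * wavelet \<psi> j k x\<bar>"
  have "\<bar>wavelet_proj \<psi> j g x\<bar> \<le> (\<Sum>k\<in>relevant j. ?t k)"
    unfolding proj_eq_sum by (rule sum_abs)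
  also have "\<dots> = (\<Sum>k\<in>relevant j \<inter> active j x. ?t k)"
    by (rule sum.mono_neutral_right) (auto simp: relevant_def dest: wavelet_nonzero_active)
  also have "\<dots> \<le> card (relevant j \<inter> active j x) * (D * (2 powr (real j / 2) * A))"
  proof -
    have "?t k \<le> D * (2 powr (real j / 2) * A)" if "k \<in> relevant j \<inter> active j x" for k
    proof (cases "wavelet \<psi> j k x = 0")
      case False
      then show ?thesis unfolding abs_mult using that assms wavelet_bound
        by (intro mult_mono) auto
    qed (use assms A_nonneg in auto)
    then show ?thesis
      using sum_bounded_above[of "relevant j \<inter> active j x" ?t] by simp
  qed
  also have "\<dots> \<le> real (S + 1) * (D * (2 powr (real j / 2) * A))"
  proof (intro mult_right_mono)
    have "card (relevant j \<inter> active j x) \<le> card (active j x)"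
      by (intro card_mono finite_active) auto
    then show "real (card (relevant j \<inter> active j x)) \<le> real (S + 1)"
      using card_active[of j x] by simp
  qed (use assms A_nonneg in auto)
  finally show ?thesis by (simp add: mult_ac add.commute)
qed

lemma proj_bounded: "\<exists>D. \<forall>x. \<bar>wavelet_proj \<psi> j g x\<bar> \<le> D"
proof (intro exI allI)
  let ?D = "\<Sum>k\<in>relevant j. \<bar>coef j g k\<bar>"
  show "\<bar>wavelet_proj \<psi> j g x\<bar> \<le> (real S + 1) * A * (2 powr (real j / 2) * ?D)" for x
    by (rule proj_bound) (auto intro!: member_le_sum sum_nonneg simp: relevant_def)
qed

lemma proj_support:
  assumes "x \<notin> {- (2 + S / 2 ^ j)..2 + S / 2 ^ j}"
  shows "wavelet_proj \<psi> j g x = 0"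
proof -
  have "coef j g k * wavelet \<psi> j k x = 0" for k
  proof (rule ccontr)
    assume *: "coef j g k * wavelet \<psi> j k x \<noteq> 0"
    have "\<exists>y. wavelet \<psi> j k y * g y \<noteq> 0"
    proof (rule ccontr)
      assume "\<nexists>y. wavelet \<psi> j k y * g y \<noteq> 0"
      then have "wavelet \<psi> j k y * g y = 0" for y by blast
      then have "coef j g k = 0" by (simp only: coef_def) simp
      then show False using * by simp
    qed
    then obtain y where y: "wavelet \<psi> j k y * g y \<noteq> 0" by blast
    then have "y \<in> {-2..2}" using g_support[of y] by auto
    have "\<bar>2 ^ j * x - 2 ^ j * y\<bar> \<le> S"
      using wavelet_nonzeroD[of j k x] wavelet_nonzeroD[of j k y] y * by auto
    then have "2 ^ j * \<bar>x - y\<bar> \<le> S"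
      by (simp add: abs_mult right_diff_distrib[symmetric])
    then have "\<bar>x - y\<bar> \<le> S / 2 ^ j" by (simp add: field_simps)
    then show False using \<open>y \<in> {-2..2}\<close> assms by (auto simp: abs_le_iff)
  qed
  then show ?thesis unfolding proj_eq_sum by (intro sum.neutral ballI)
qed

lemma inner_proj:
  assumes [measurable]: "u \<in> borel_measurable borel" and b: "\<And>x. \<bar>u x\<bar> \<le> D"
  shows "(\<integral>x. wavelet_proj \<psi> j g x * u x \<partial>lborel) = (\<Sum>k\<in>relevant j. coef j g k * coef j u k)"
proof -
  have "(\<integral>x. wavelet_proj \<psi> j g x * u x \<partial>lborel)
    = (\<integral>x. (\<Sum>k\<in>relevant j. coef j g k * (wavelet \<psi> j k x * u x)) \<partial>lborel)"
    unfolding proj_eq_sum by (simp add: sum_distrib_left sum_distrib_right mult_ac)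
  also have "\<dots> = (\<Sum>k\<in>relevant j. (\<integral>x. coef j g k * (wavelet \<psi> j k x * u x) \<partial>lborel))"
    by (rule Bochner_Integration.integral_sum) (simp add: wavelet_times_integrable[OF assms])
  finally show ?thesis by (simp add: coef_def)
qed

lemma coef_proj: "coef j (wavelet_proj \<psi> j g) k = coef j g k"
proof -
  have "coef j (wavelet_proj \<psi> j g) k = (\<integral>x. wavelet_proj \<psi> j g x * wavelet \<psi> j k x \<partial>lborel)"
    by (simp add: coef_def mult.commute)
  also have "\<dots> = (\<Sum>l\<in>relevant j. coef j g l * coef j (wavelet \<psi> j k) l)"
    by (rule inner_proj[OF wavelet_meas wavelet_bound])
  also have "\<dots> = (\<Sum>l\<in>relevant j. if k = l then coef j g k else 0)"
    by (intro sum.cong) (auto simp: coef_def orth_scaled)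
  also have "\<dots> = coef j g k"
    using coef_irrelevant[of k j] by (simp add: relevant_def)
  finally show ?thesis .
qed

lemma proj_integrable:
  assumes [measurable]: "u \<in> borel_measurable borel" and b: "\<And>x. \<bar>u x\<bar> \<le> D"
  shows "integrable lborel (\<lambda>x. wavelet_proj \<psi> j g x * u x)"
proof -
  obtain E where E: "\<And>x. \<bar>wavelet_proj \<psi> j g x\<bar> \<le> E" using proj_bounded by blast
  have "0 \<le> E" using order_trans[OF abs_ge_zero E] .
  then show ?thesis
    using E b proj_support[where j=j]
    by (intro bounded_support_integrable[where C="E * D" and a="- (2 + S / 2 ^ j)" and b="2 + S / 2 ^ j"])
       (auto simp: abs_mult intro!: mult_mono)
qed

lemma proj_square_integrable: "integrable lborel (\<lambda>x. (wavelet_proj \<psi> j g x)\<^sup>2)"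
  using proj_bounded[of j] proj_integrable[OF proj_meas] by (auto simp: power2_eq_square)

text \<open>The projection is symmetric and idempotent. This makes its squared norm the mean of
  \<open>wavelet_proj \<psi> j g\<close> under the density \<open>g\<close>, and thus the right
  centring of the linear part.\<close>

lemma proj_square_integral: "(\<integral>x. (wavelet_proj \<psi> j g x)\<^sup>2 \<partial>lborel) = (\<integral>x. wavelet_proj \<psi> j g x * g x \<partial>lborel)"
proof -
  obtain E where E: "\<And>x. \<bar>wavelet_proj \<psi> j g x\<bar> \<le> E" using proj_bounded by blast
  show ?thesis
    unfolding power2_eq_square inner_proj[OF proj_meas E] inner_proj[OF g_meas g_bound] coef_proj ..
qed

lemma g_square_integrable: "integrable lborel (\<lambda>x. (g x)\<^sup>2)"
  using power_mono[OF g_bound, of _ 2]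
  by (intro bounded_support_integrable[where C="C\<^sup>2" and a="-2" and b=2]) (auto simp: g_support)

lemma Bessel: "(\<integral>x. (wavelet_proj \<psi> j g x)\<^sup>2 \<partial>lborel) \<le> (\<integral>x. (g x)\<^sup>2 \<partial>lborel)"
proof -
  have "0 \<le> (\<integral>x. (g x - wavelet_proj \<psi> j g x)\<^sup>2 \<partial>lborel)" by simp
  also have "\<dots> = (\<integral>x. (g x)\<^sup>2 - 2 * (wavelet_proj \<psi> j g x * g x) + (wavelet_proj \<psi> j g x)\<^sup>2 \<partial>lborel)"
    by (simp add: power2_eq_square algebra_simps)
  also have "\<dots> = (\<integral>x. (g x)\<^sup>2 \<partial>lborel) - (\<integral>x. (wavelet_proj \<psi> j g x)\<^sup>2 \<partial>lborel)"
    using g_square_integrable proj_square_integrable proj_integrable[OF g_meas g_bound, of j]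
    by (simp add: proj_square_integral)
  finally show ?thesis by simp
qed

text \<open>The Cauchy-Schwarz inequality on the support of one wavelet, by completing a square. One
  large coefficient thus forces energy of the projection at a known place, where the density can be
  bounded below.\<close>

lemma coef_square_le_local:
  "(coef j g k)\<^sup>2 \<le> (\<integral>x. (wavelet_proj \<psi> j g x)\<^sup>2 * indicator {real_of_int k / 2 ^ j..(real_of_int k + real S) / 2 ^ j} x \<partial>lborel)"
proof -
  let ?I = "{real_of_int k / 2 ^ j..(real_of_int k + real S) / 2 ^ j}"
  let ?c = "coef j g k" and ?Q = "wavelet_proj \<psi> j g" and ?w = "wavelet \<psi> j k"
  have i1: "integrable lborel (\<lambda>x. (?Q x)\<^sup>2 * indicator ?I x)"
    by (rule integrable_real_mult_indicator[OF _ proj_square_integrable]) simp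
  have i2: "integrable lborel (\<lambda>x. ?Q x * ?w x)"
    by (rule proj_integrable[OF wavelet_meas wavelet_bound])
  have i3: "integrable lborel (\<lambda>x. ?w x * ?w x)"
    by (rule wavelet_times_integrable[OF wavelet_meas wavelet_bound])
  have eq: "(?Q x * indicator ?I x - ?c * ?w x)\<^sup>2
      = (?Q x)\<^sup>2 * indicator ?I x - 2 * ?c * (?Q x * ?w x) + ?c\<^sup>2 * (?w x * ?w x)" for x
    using wavelet_support[where x=x and k=k and j=j] by (auto simp: indicator_def power2_eq_square algebra_simps)
  have "0 \<le> (\<integral>x. (?Q x * indicator ?I x - ?c * ?w x)\<^sup>2 \<partial>lborel)" by simp
  also have "\<dots> = (\<integral>x. (?Q x)\<^sup>2 * indicator ?I x \<partial>lborel) - 2 * ?c * (\<integral>x. ?Q x * ?w x \<partial>lborel)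
      + ?c\<^sup>2 * (\<integral>x. ?w x * ?w x \<partial>lborel)"
    unfolding eq using i1 i2 i3 by simp
  also have "(\<integral>x. ?Q x * ?w x \<partial>lborel) = ?c"
    using coef_proj[of j k] by (simp add: coef_def mult.commute)
  finally show ?thesis by (simp add: orth_scaled power2_eq_square)
qed

end

section \<open>Wavelet coefficients of truncated powers\<close>

text \<open>Truncated powers \<open>x\<^sub>+\<^sup>m\<close>, with \<open>x\<^sub>+\<^sup>0\<close> the indicator of the positive axis (so \<open>0\<^sub>+\<^sup>0 = 0\<close>).\<close>

definition tpow :: "nat \<Rightarrow> real \<Rightarrow> real" where
  "tpow m x = (if 0 < x then x ^ m else 0)"

lemma tpow_meas [measurable]: "tpow m \<in> borel_measurable borel"
  unfolding tpow_def[abs_def] by measurable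

context compact_wavelet
begin

lemma psi_times_integrable:
  fixes f :: "real \<Rightarrow> real"
  assumes [measurable]: "f \<in> borel_measurable borel" and b: "\<And>x. x \<in> {0..real S} \<Longrightarrow> \<bar>f x\<bar> \<le> C" and "0 \<le> C"
  shows "integrable lborel (\<lambda>x. \<psi> x * f x)"
proof (rule bounded_support_integrable[where C="A * C" and a=0 and b="real S"])
  show "\<bar>\<psi> x * f x\<bar> \<le> A * C" for x
    using vanish[of x] b[of x] bound[of x] A_nonneg assms(3)
    by (cases "x \<in> {0..real S}") (auto simp: abs_mult intro!: mult_mono)
qed (use vanish in auto)

lemma psi_power_integrable: "integrable lborel (\<lambda>x. \<psi> x * (x + c) ^ i)"
proof (rule psi_times_integrable[where C="(real S + \<bar>c\<bar>) ^ i"])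
  fix x assume "x \<in> {0..real S}"
  then show "\<bar>(x + c) ^ i\<bar> \<le> (real S + \<bar>c\<bar>) ^ i"
    unfolding power_abs by (intro power_mono) auto
qed auto

lemma shifted_moments:
  assumes "i \<le> d"
  shows "(\<integral>x. \<psi> x * (x + c) ^ i \<partial>lborel) = 0"
proof -
  have "(\<integral>x. \<psi> x * (x + c) ^ i \<partial>lborel)
    = (\<integral>x. (\<Sum>k\<le>i. (of_nat (i choose k) * c ^ (i - k)) * (\<psi> x * (x + 0) ^ k)) \<partial>lborel)"
    by (simp add: binomial_ring sum_distrib_left mult_ac)
  also have "\<dots> = (\<Sum>k\<le>i. (\<integral>x. (of_nat (i choose k) * c ^ (i - k)) * (\<psi> x * (x + 0) ^ k) \<partial>lborel))"
    by (rule Bochner_Integration.integral_sum) (intro integrable_mult_right psi_power_integrable)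
  also have "\<dots> = (\<Sum>k\<le>i. 0)"
  proof (rule sum.cong[OF refl])
    fix k assume "k \<in> {..i}"
    then have "(\<integral>x. \<psi> x * (x + 0) ^ k \<partial>lborel) = 0"
      using moments[of k] assms by (simp add: mult.commute)
    then show "(\<integral>x. (of_nat (i choose k) * c ^ (i - k)) * (\<psi> x * (x + 0) ^ k) \<partial>lborel) = 0"
      by (simp only: integral_mult_right_zero)
  qed
  finally show ?thesis by simp
qed

text \<open>The coefficient of a truncated power against the unscaled wavelet; \<open>b\<close> is
  the position of the break relative to the left end of the support.\<close>

definition jump_coef :: "nat \<Rightarrow> real \<Rightarrow> real" where
  "jump_coef m b = (\<integral>u. \<psi> u * tpow m (u - b) \<partial>lborel)"

lemma coef_substitution:
  fixes G :: "real \<Rightarrow> real"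
  shows "(\<integral>x. wavelet \<psi> j k x * G x \<partial>lborel)
    = 2 powr (- real j / 2) * (\<integral>u. \<psi> u * G ((u + k) / 2 ^ j) \<partial>lborel)"
proof -
  have "(\<integral>u. \<psi> u * G ((u + k) / 2 ^ j) \<partial>lborel)
    = \<bar>2 ^ j\<bar> *\<^sub>R (\<integral>x. \<psi> (- k + 2 ^ j * x) * G ((- k + 2 ^ j * x + k) / 2 ^ j) \<partial>lborel)"
    by (rule lborel_integral_real_affine) auto
  also have "\<dots> = 2 ^ j * (\<integral>x. \<psi> (2 ^ j * x - k) * G x \<partial>lborel)"
    by simp
  also have "2 powr (- real j / 2) * \<dots> = 2 powr (real j / 2) * (\<integral>x. \<psi> (2 ^ j * x - k) * G x \<partial>lborel)"
  proof -
    have "2 powr (- real j / 2) * 2 ^ j = 2 powr (- real j / 2) * 2 powr (real j)"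
      by (simp add: powr_realpow)
    also have "\<dots> = 2 powr (real j / 2)" by (simp add: powr_add[symmetric])
    finally show ?thesis by (simp add: mult.assoc[symmetric])
  qed
  also have "\<dots> = (\<integral>x. wavelet \<psi> j k x * G x \<partial>lborel)"
    by (simp add: wavelet_def mult.assoc)
  finally show ?thesis ..
qed

lemma coef_polynomial:
  assumes "i \<le> d"
  shows "(\<integral>x. wavelet \<psi> j k x * (x - b) ^ i \<partial>lborel) = 0"
proof -
  have "(\<integral>u. \<psi> u * ((u + k) / 2 ^ j - b) ^ i \<partial>lborel)
     = (\<integral>u. (1 / 2 ^ j) ^ i * (\<psi> u * (u + (k - 2 ^ j * b)) ^ i) \<partial>lborel)"
  proof (intro Bochner_Integration.integral_cong refl)
    fix u :: real
    have "(u + k) / 2 ^ j - b = (1 / 2 ^ j) * (u + (k - 2 ^ j * b))" by (simp add: field_simps)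
    then show "\<psi> u * ((u + k) / 2 ^ j - b) ^ i = (1 / 2 ^ j) ^ i * (\<psi> u * (u + (k - 2 ^ j * b)) ^ i)"
      by (simp only: power_mult_distrib mult_ac)
  qed
  then show ?thesis unfolding coef_substitution using shifted_moments[OF assms] by simp
qed

lemma coef_tpow:
  "(\<integral>x. wavelet \<psi> j k x * tpow m (x - a) \<partial>lborel)
    = 2 powr (- real j / 2) * (1 / 2 ^ (j * m)) * jump_coef m (2 ^ j * a - k)"
proof -
  have "tpow m ((u + k) / 2 ^ j - a) = (1 / 2 ^ j) ^ m * tpow m (u - (2 ^ j * a - k))" for u :: real
  proof -
    have "(u + k) / 2 ^ j - a = (u - (2 ^ j * a - k)) * (1 / 2 ^ j)" by (simp add: field_simps)
    moreover have "0 < x * (1 / 2 ^ j) \<longleftrightarrow> 0 < x" for x :: real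
      by (simp add: zero_less_divide_iff)
    ultimately show ?thesis unfolding tpow_def by (simp only: power_mult_distrib) simp
  qed
  then have "(\<integral>u. \<psi> u * tpow m ((u + k) / 2 ^ j - a) \<partial>lborel)
      = (\<integral>u. (1 / 2 ^ j) ^ m * (\<psi> u * tpow m (u - (2 ^ j * a - k))) \<partial>lborel)"
    by (simp add: mult_ac)
  then show ?thesis unfolding coef_substitution jump_coef_def
    by (simp add: power_mult[symmetric] power_one_over)
qed

lemma jump_coef_upper:
  assumes "0 \<le> b"
  shows "\<bar>jump_coef m b\<bar> \<le> A * (real S + 1) ^ (m + 1)"
proof -
  have le: "\<bar>\<psi> u * tpow m (u - b)\<bar> \<le> A * (real S + 1) ^ m * indicator {0..real S} u" for u
  proof (cases "u \<in> {0..real S}")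
    case True
    have "\<bar>tpow m (u - b)\<bar> \<le> (real S + 1) ^ m"
      using True assms by (auto simp: tpow_def intro!: power_mono)
    then show ?thesis using True bound[of u] A_nonneg by (auto simp: abs_mult intro!: mult_mono)
  qed (use vanish in auto)
  have i: "integrable lborel (\<lambda>u. A * (real S + 1) ^ m * indicator {0..real S} u)"
    by (intro integrable_mult_right integrable_real_indicator) (auto simp: emeasure_lborel_Icc_eq)
  have "\<bar>jump_coef m b\<bar> \<le> (\<integral>u. \<bar>\<psi> u * tpow m (u - b)\<bar> \<partial>lborel)"
    unfolding jump_coef_def by (rule integral_abs_bound)
  also have "\<dots> \<le> (\<integral>u. A * (real S + 1) ^ m * indicator {0..real S} u \<partial>lborel)"
    by (rule integral_mono[OF Bochner_Integration.integrable_bound[OF i] i])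
       (use order_trans[OF le abs_ge_self] le in \<open>auto intro!: AE_I2\<close>)
  also have "\<dots> = A * (real S + 1) ^ m * S" by simp
  also have "\<dots> \<le> A * (real S + 1) ^ m * (real S + 1)" using A_nonneg by (intro mult_left_mono) auto
  finally show ?thesis by (simp add: mult_ac)
qed

text \<open>
  Vanishing moments turn the integral over \<open>u > b\<close> into one over \<open>u < b\<close>, where \<open>\<psi>\<close> has
  constant sign.
\<close>

lemma jump_coef_lower:
  assumes \<delta>: "0 < \<delta>" "\<delta> < 1" and nz: "\<And>x. x \<in> {0<..1 + \<delta>} \<Longrightarrow> \<psi> x \<noteq> 0"
  obtains c where "0 < c" "\<And>m b. m \<le> d \<Longrightarrow> b \<in> {\<delta>..1 + \<delta>} \<Longrightarrow> c \<le> \<bar>jump_coef m b\<bar>"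
proof -
  have sgn: "0 \<le> \<psi> x * \<psi> y" if xy: "x \<in> {0<..1 + \<delta>}" "y \<in> {0<..1 + \<delta>}" for x y
  proof (rule ccontr)
    assume "\<not> 0 \<le> \<psi> x * \<psi> y"
    then have "\<psi> x < 0 \<and> 0 < \<psi> y \<or> 0 < \<psi> x \<and> \<psi> y < 0" by (auto simp: zero_le_mult_iff not_le)
    moreover have "connected (\<psi> ` {0<..1 + \<delta>})"
      by (rule connected_continuous_image[OF continuous_on_subset[OF cont]]) auto
    ultimately have "0 \<in> \<psi> ` {0<..1 + \<delta>}"
      using xy connected_contains_Icc[of "\<psi> ` {0<..1 + \<delta>}" "\<psi> x" "\<psi> y"]
        connected_contains_Icc[of "\<psi> ` {0<..1 + \<delta>}" "\<psi> y" "\<psi> x"] by force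
    then show False using nz by auto
  qed
  obtain s where s: "\<bar>s\<bar> = 1" "\<And>x. x \<in> {0<..1 + \<delta>} \<Longrightarrow> s * \<psi> x = \<bar>\<psi> x\<bar>"
  proof
    show "\<bar>sgn (\<psi> 1)\<bar> = 1" using nz[of 1] \<delta> by (simp add: abs_sgn_eq)
    show "sgn (\<psi> 1) * \<psi> x = \<bar>\<psi> x\<bar>" if "x \<in> {0<..1 + \<delta>}" for x
      using sgn[of 1 x] that \<delta> nz[of 1] by (auto simp: sgn_if abs_if zero_le_mult_iff)
  qed
  have "continuous_on {\<delta>/4..\<delta>/2} (\<lambda>x. \<bar>\<psi> x\<bar>)"
    by (intro continuous_intros continuous_on_subset[OF cont]) auto
  then obtain x0 where x0: "x0 \<in> {\<delta>/4..\<delta>/2}" "\<And>x. x \<in> {\<delta>/4..\<delta>/2} \<Longrightarrow> \<bar>\<psi> x0\<bar> \<le> \<bar>\<psi> x\<bar>"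
    using continuous_attains_inf[of "{\<delta>/4..\<delta>/2}" "\<lambda>x. \<bar>\<psi> x\<bar>"] \<delta> by auto
  have p0: "0 < \<bar>\<psi> x0\<bar>" using nz[of x0] x0(1) \<delta> by auto
  show ?thesis
  proof
    \<comment> \<open>On \<open>{\<delta>/4..\<delta>/2}\<close> the factor
      \<open>\<bar>\<psi> u\<bar>\<close> is at least its minimum there and \<open>b - u\<close> is
      at least \<open>\<delta>/2\<close>; the interval has length \<open>\<delta>/4\<close>. The
      exponent \<open>d\<close> is the worst case of \<open>m \<le> d\<close> because
      \<open>\<delta>/2 < 1\<close>.\<close>
    show "0 < \<bar>\<psi> x0\<bar> * (\<delta>/2) ^ d * (\<delta>/4)" using p0 \<delta> by simp
    fix m b assume m: "m \<le> d" and b: "b \<in> {\<delta>..1 + \<delta>}"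
    let ?r = "\<lambda>u. \<psi> u * (tpow m (u - b) - (u - b) ^ m)"
    have i1: "integrable lborel (\<lambda>u. \<psi> u * tpow m (u - b))"
    proof (rule psi_times_integrable[where C="(real S + \<bar>b\<bar>) ^ m"])
      show "\<bar>tpow m (x - b)\<bar> \<le> (real S + \<bar>b\<bar>) ^ m" if "x \<in> {0..real S}" for x
        using that by (auto simp: tpow_def intro!: power_mono)
    qed auto
    have i2: "integrable lborel (\<lambda>u. \<psi> u * (u - b) ^ m)"
      using psi_power_integrable[of "-b" m] by simp
    have i3: "integrable lborel ?r" using i1 i2 by (simp add: right_diff_distrib)
    have "(\<integral>u. ?r u \<partial>lborel) = jump_coef m b - (\<integral>u. \<psi> u * (u - b) ^ m \<partial>lborel)"
      using i1 i2 by (simp add: right_diff_distrib jump_coef_def)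
    then have J: "jump_coef m b = (\<integral>u. ?r u \<partial>lborel)"
      using shifted_moments[OF m, of "-b"] by simp
    have "\<bar>\<psi> x0\<bar> * (\<delta>/2) ^ d * (\<delta>/4) = (\<integral>u. \<bar>\<psi> x0\<bar> * (\<delta>/2) ^ d * indicator {\<delta>/4..\<delta>/2} u \<partial>lborel)"
      using \<delta> by simp
    \<comment> \<open>For \<open>0 < u \<le> b\<close> the bracket in \<open>?r\<close> is
      \<open>- ((u - b) ^ m)\<close>; the factor \<open>- s * (-1) ^ m\<close> turns the integrand
      into \<open>\<bar>\<psi> u\<bar> * (b - u) ^ m\<close>. Elsewhere the integrand
      vanishes.\<close>
    also have "\<dots> \<le> (\<integral>u. (- s * (-1) ^ m) * ?r u \<partial>lborel)"
    proof (rule integral_mono)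
      show "integrable lborel (\<lambda>u. \<bar>\<psi> x0\<bar> * (\<delta>/2) ^ d * indicator {\<delta>/4..\<delta>/2} u)"
        by (intro integrable_mult_right integrable_real_indicator) (auto simp: emeasure_lborel_Icc_eq)
      show "integrable lborel (\<lambda>u. (- s * (-1) ^ m) * ?r u)" using i3 by (rule integrable_mult_right)
      fix u
      show "\<bar>\<psi> x0\<bar> * (\<delta>/2) ^ d * indicator {\<delta>/4..\<delta>/2} u \<le> (- s * (-1) ^ m) * ?r u"
      proof (cases "0 < u \<and> u \<le> b")
        case True
        then have u: "u \<in> {0<..1 + \<delta>}" using b by auto
        have "(u - b) ^ m = (-1) ^ m * (b - u) ^ m"
          by (simp add: power_mult_distrib[symmetric])
        then have "(- s * (-1) ^ m) * ?r u = (s * \<psi> u) * (b - u) ^ m"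
          using True by (simp add: tpow_def mult_ac)
        also have "\<dots> = \<bar>\<psi> u\<bar> * (b - u) ^ m" using s(2)[OF u] by simp
        finally have eq: "(- s * (-1) ^ m) * ?r u = \<bar>\<psi> u\<bar> * (b - u) ^ m" .
        show ?thesis
        proof (cases "u \<in> {\<delta>/4..\<delta>/2}")
          case ui: True
          have "(\<delta>/2) ^ d \<le> (\<delta>/2) ^ m" using \<delta> m by (intro power_decreasing) auto
          also have "\<dots> \<le> (b - u) ^ m" using ui b \<delta> by (intro power_mono) auto
          finally show ?thesis unfolding eq using ui x0(2)[OF ui] \<delta> by (auto intro!: mult_mono)
        next
          case False
          then show ?thesis unfolding eq using True by auto
        qed
      next
        case False
        then have "?r u = 0"
        proof (cases "u < 0")
          case True
          then show ?thesis using vanish[of u] by simp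
        next
          case F: False
          show ?thesis
          proof (cases "u = 0")
            case True
            \<comment> \<open>The bracket need not vanish at \<open>u = 0\<close>, but continuity
              and the vanishing of \<open>\<psi>\<close> on the negative axis settle this
              point.\<close>
            have "\<psi> 0 = 0"
            proof (rule ccontr)
              assume "\<psi> 0 \<noteq> 0"
              have "(\<psi> \<longlongrightarrow> \<psi> 0) (at_left 0)"
                using cont by (auto simp: continuous_on_eq_continuous_within isCont_def
                    intro: tendsto_within_subset filterlim_at_split[THEN iffD1, THEN conjunct1])
              moreover have "eventually (\<lambda>x. \<psi> x = 0) (at_left 0)"
                using vanish by (simp add: eventually_at_filter)
              ultimately have "((\<lambda>x. 0) \<longlongrightarrow> \<psi> 0) (at_left (0::real))"
                by (rule Lim_transform_eventually)
              then have "\<psi> 0 = 0" by (simp add: tendsto_const_iff)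
              then show False using \<open>\<psi> 0 \<noteq> 0\<close> by simp
            qed
            then show ?thesis using True by simp
          qed (use False F in \<open>auto simp: tpow_def\<close>)
        qed
        moreover have "u \<notin> {\<delta>/4..\<delta>/2}" using False \<delta> b by auto
        ultimately show ?thesis by (simp only: mult_zero_right) simp
      qed
    qed
    also have "\<dots> = (- s * (-1) ^ m) * jump_coef m b" unfolding J by simp
    also have "\<dots> \<le> \<bar>(- s * (-1) ^ m) * jump_coef m b\<bar>" by simp
    also have "\<dots> = \<bar>jump_coef m b\<bar>" using s(1) by (simp add: abs_mult power_abs)
    finally show "\<bar>\<psi> x0\<bar> * (\<delta>/2) ^ d * (\<delta>/4) \<le> \<bar>jump_coef m b\<bar>" .
  qed
qed

text \<open>Vanishing moments remove the polynomial because \<open>m \<le> d\<close>, scaling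
  evaluates the truncated power, and the error is integrated against a wavelet of height at most
  \<open>2 powr (j / 2) * A\<close> on an interval of length \<open>S / 2 ^ j\<close>. The expansion
  may fail at \<open>b\<close> and at the two ends, a null set.\<close>

lemma coef_approx:
  fixes q :: "nat \<Rightarrow> real"
  assumes [measurable]: "g \<in> borel_measurable borel" and gb: "\<And>x. \<bar>g x\<bar> \<le> C" and m: "m \<le> d" and E: "0 \<le> E"
    and ap: "\<And>y. y \<in> {real_of_int k / 2 ^ j<..<(real_of_int k + real S) / 2 ^ j} \<Longrightarrow> y \<noteq> b \<Longrightarrow>
        \<bar>g y - (\<Sum>i\<le>m. q i * (y - b) ^ i) - J * tpow m (y - b)\<bar> \<le> E"
  shows "\<bar>coef j g k - J * (2 powr (- real j / 2) * (1 / 2 ^ (j * m)) * jump_coef m (2 ^ j * b - k))\<bar>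
    \<le> 2 powr (- real j / 2) * (A * (real S * E))"
proof -
  let ?w = "wavelet \<psi> j k"
  let ?p = "\<lambda>y. (\<Sum>i\<le>m. q i * (y - b) ^ i)"
  let ?I = "{real_of_int k / 2 ^ j..(real_of_int k + real S) / 2 ^ j}"
  have wi: "integrable lborel (\<lambda>y. ?w y * f y)"
    if [measurable]: "f \<in> borel_measurable borel" and b: "\<And>y. y \<in> ?I \<Longrightarrow> \<bar>f y\<bar> \<le> D" "0 \<le> D" for f :: "real \<Rightarrow> real" and D
  proof -
    have "\<bar>?w y * f y\<bar> \<le> (2 powr (real j / 2) * A) * D" for y
      using wavelet_bound[of j k y] b wavelet_support[where x=y and k=k and j=j] A_nonneg
      by (cases "y \<in> ?I") (auto simp: abs_mult intro!: mult_mono)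
    then show ?thesis
      using wavelet_support[where k=k and j=j]
      by (intro bounded_support_integrable[where C="(2 powr (real j / 2) * A) * D"
           and a="real_of_int k / 2 ^ j" and b="(real_of_int k + real S) / 2 ^ j"]) auto
  qed
  define L where "L = \<bar>real_of_int k / 2 ^ j\<bar> + \<bar>(real_of_int k + real S) / 2 ^ j\<bar> + \<bar>b\<bar>"
  have "\<bar>y - b\<bar> \<le> \<bar>l\<bar> + \<bar>u\<bar> + \<bar>b\<bar>" if "l \<le> y" "y \<le> u" for l u y :: real
    using that by linarith
  then have L: "\<bar>y - b\<bar> \<le> L" if "y \<in> ?I" for y using that unfolding L_def atLeastAtMost_iff by blast
  have "0 \<le> L" unfolding L_def by auto
  have ig: "integrable lborel (\<lambda>y. ?w y * g y)" by (rule wavelet_times_integrable[OF _ gb]) simp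
  have ip: "integrable lborel (\<lambda>y. ?w y * (y - b) ^ i)" for i
    using L power_mono[OF L abs_ge_zero, of _ i] \<open>0 \<le> L\<close>
    by (intro wi[where D="L ^ i"]) (auto simp: power_abs)
  have it: "integrable lborel (\<lambda>y. ?w y * tpow m (y - b))"
  proof (rule wi[where D="L ^ m"])
    show "\<bar>tpow m (y - b)\<bar> \<le> L ^ m" if "y \<in> ?I" for y
      using L[OF that] \<open>0 \<le> L\<close> by (auto simp: tpow_def intro!: power_mono)
  qed (use \<open>0 \<le> L\<close> in auto)
  have "(\<integral>y. ?w y * ?p y \<partial>lborel) = (\<integral>y. (\<Sum>i\<le>m. q i * (?w y * (y - b) ^ i)) \<partial>lborel)"
    by (simp add: sum_distrib_left mult_ac)
  also have "\<dots> = (\<Sum>i\<le>m. (\<integral>y. q i * (?w y * (y - b) ^ i) \<partial>lborel))"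
    using ip by (intro Bochner_Integration.integral_sum integrable_mult_right) auto
  also have "\<dots> = 0" using m by (intro sum.neutral) (auto simp: coef_polynomial)
  finally have p0: "(\<integral>y. ?w y * ?p y \<partial>lborel) = 0" .
  have ipp: "integrable lborel (\<lambda>y. ?w y * ?p y)"
  proof -
    have "integrable lborel (\<lambda>y. (\<Sum>i\<le>m. q i * (?w y * (y - b) ^ i)))"
      using ip by (intro Bochner_Integration.integrable_sum integrable_mult_right) auto
    then show ?thesis by (simp add: sum_distrib_left mult_ac)
  qed
  define R where "R = (\<lambda>y. g y - ?p y - J * tpow m (y - b))"
  have eqR: "?w y * R y = ?w y * g y - ?w y * ?p y - J * (?w y * tpow m (y - b))" for y
    by (simp add: R_def algebra_simps)
  have iR: "integrable lborel (\<lambda>y. ?w y * R y)"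
    unfolding eqR using ig ipp it by auto
  have "(\<integral>y. ?w y * R y \<partial>lborel) = coef j g k - J * (2 powr (- real j / 2) * (1 / 2 ^ (j * m)) * jump_coef m (2 ^ j * b - k))"
    unfolding eqR using ig ipp it p0 by (simp add: coef_def coef_tpow)
  moreover have "\<bar>\<integral>y. ?w y * R y \<partial>lborel\<bar> \<le> (\<integral>y. 2 powr (real j / 2) * A * E * indicator ?I y \<partial>lborel)"
  proof (rule order_trans[OF integral_abs_bound integral_mono_AE])
    show "integrable lborel (\<lambda>y. \<bar>?w y * R y\<bar>)" using iR by (rule integrable_abs)
    show "integrable lborel (\<lambda>y. 2 powr (real j / 2) * A * E * indicator ?I y)"
      by (intro integrable_mult_right integrable_real_indicator) (auto simp: emeasure_lborel_Icc_eq)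
    have "AE y in lborel. y \<noteq> b \<and> y \<noteq> real_of_int k / 2 ^ j \<and> y \<noteq> (real_of_int k + real S) / 2 ^ j"
      by (intro AE_conjI AE_lborel_singleton)
    then show "AE y in lborel. \<bar>?w y * R y\<bar> \<le> 2 powr (real j / 2) * A * E * indicator ?I y"
    proof eventually_elim
      case (elim y)
      show ?case
      proof (cases "y \<in> ?I")
        case True
        then have "y \<in> {real_of_int k / 2 ^ j<..<(real_of_int k + real S) / 2 ^ j}" using elim by auto
        then have "\<bar>R y\<bar> \<le> E" using ap elim unfolding R_def by blast
        then show ?thesis using True wavelet_bound[of j k y] A_nonneg by (auto simp: abs_mult intro!: mult_mono)
      qed (use wavelet_support[where x=y and k=k and j=j] in auto)
    qed
  qed
  moreover have "(\<integral>y. 2 powr (real j / 2) * A * E * indicator ?I y \<partial>lborel) = 2 powr (- real j / 2) * (A * (real S * E))"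
  proof -
    have "(\<integral>y. 2 powr (real j / 2) * A * E * indicator ?I y \<partial>lborel) = 2 powr (real j / 2) * A * E * (real S / 2 ^ j)"
      by (simp add: divide_right_mono diff_divide_distrib[symmetric])
    also have "\<dots> = (2 powr (real j / 2) / 2 powr (real j)) * (A * (real S * E))"
      by (simp add: powr_realpow mult_ac)
    also have "2 powr (real j / 2) / 2 powr (real j) = (2::real) powr (- real j / 2)"
      by (simp add: powr_diff[symmetric])
    finally show ?thesis .
  qed
  ultimately show ?thesis by (simp only:)
qed

end

section \<open>Taylor expansions of piecewise-smooth functions\<close>

lemma C_k_on_deriv_iterate:
  fixes D :: "nat \<Rightarrow> real \<Rightarrow> real"
  assumes D: "\<And>i x. i < k \<Longrightarrow> x \<in> I \<Longrightarrow> (D i has_real_derivative D (Suc i) x) (at x within I)"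
    and U: "open U" "U \<subseteq> I" and f: "\<And>x. x \<in> U \<Longrightarrow> f x = D 0 x"
  shows "i \<le> k \<Longrightarrow> x \<in> U \<Longrightarrow> (deriv ^^ i) f x = D i x"
proof (induction i arbitrary: x)
  case (Suc i)
  have "(D i has_real_derivative D (Suc i) x) (at x within I)" using D Suc.prems U by auto
  then have "(D i has_real_derivative D (Suc i) x) (at x within U)"
    by (rule has_field_derivative_subset) (use U in auto)
  then have "(D i has_real_derivative D (Suc i) x) (at x)"
    using at_within_open[OF Suc.prems(2) U(1)] by simp
  then have "((deriv ^^ i) f has_real_derivative D (Suc i) x) (at x)"
    by (rule has_field_derivative_transform_within_open[OF _ U(1) Suc.prems(2)])
       (use Suc.IH Suc.prems in auto)
  then show ?case by (simp add: DERIV_imp_deriv)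
qed (use f in auto)

text \<open>Lets \<open>left_deriv_lim\<close> and \<open>right_deriv_lim\<close>, which are limits
  of iterated \<open>deriv\<close>, be computed at an end point from the one-sided derivatives
  \<open>D i\<close> of the extension.\<close>

lemma C_k_on_tendsto_deriv:
  fixes D :: "nat \<Rightarrow> real \<Rightarrow> real"
  assumes D: "\<And>i x. i < k \<Longrightarrow> x \<in> I \<Longrightarrow> (D i has_real_derivative D (Suc i) x) (at x within I)"
    and c: "continuous_on I (D k)"
    and U: "open U" "U \<subseteq> I" and f: "\<And>x. x \<in> U \<Longrightarrow> f x = D 0 x" and i: "i \<le> k" and b: "b \<in> I"
  shows "((deriv ^^ i) f \<longlongrightarrow> D i b) (at b within U)"
proof -
  have "continuous (at b within I) (D i)"
  proof (cases "i = k")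
    case True
    then show ?thesis using c b continuous_on_eq_continuous_within by blast
  next
    case False
    then show ?thesis using D[of i b] i b DERIV_continuous by auto
  qed
  then have "(D i \<longlongrightarrow> D i b) (at b within U)"
    using U by (auto simp: continuous_within intro: tendsto_within_subset)
  moreover have "eventually (\<lambda>x. D i x = (deriv ^^ i) f x) (at b within U)"
    using C_k_on_deriv_iterate[OF D U f i] by (simp add: eventually_at_filter)
  ultimately show ?thesis by (rule Lim_transform_eventually)
qed

lemma C_k_on_UNIV_isCont_deriv:
  assumes "C_k_on k UNIV f" "i \<le> k"
  shows "isCont ((deriv ^^ i) f) x"
proof -
  obtain D where D0: "\<forall>x\<in>UNIV. D 0 x = f x"
    "\<forall>i<k. \<forall>x\<in>UNIV. (D i has_real_derivative D (Suc i) x) (at x within UNIV)" "continuous_on UNIV (D k)"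
    using assms(1) unfolding C_k_on_def by blast
  have D: "f x = D 0 x" "i < k \<Longrightarrow> (D i has_real_derivative D (Suc i) x) (at x within UNIV)" "continuous_on UNIV (D k)" for i x
    using D0 by (metis UNIV_I)+
  have "((deriv ^^ i) f \<longlongrightarrow> D i x) (at x within UNIV)"
    by (rule C_k_on_tendsto_deriv[where D=D and k=k and I=UNIV]) (use D assms(2) in simp_all)
  moreover have "(deriv ^^ i) f x = D i x"
    by (rule C_k_on_deriv_iterate[where D=D and k=k and I=UNIV and U=UNIV]) (use D assms(2) in simp_all)
  ultimately show ?thesis by (simp add: isCont_def)
qed

lemma taylor_piece:
  fixes D :: "nat \<Rightarrow> real \<Rightarrow> real"
  assumes D: "\<And>i x. i < m + 1 \<Longrightarrow> x \<in> I \<Longrightarrow> (D i has_real_derivative D (Suc i) x) (at x within I)"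
    and c: "continuous_on I (D (m + 1))" and T: "T \<subseteq> I" "convex T" "compact T"
  obtains M where "0 \<le> M"
    "\<And>b y. b \<in> T \<Longrightarrow> y \<in> T \<Longrightarrow> \<bar>D 0 y - (\<Sum>i\<le>m. D i b / fact i * (y - b) ^ i)\<bar> \<le> M * \<bar>y - b\<bar> ^ (m + 1)"
    "\<And>y. y \<in> T \<Longrightarrow> \<bar>D 0 y\<bar> \<le> M"
proof -
  have "continuous_on T (D (m + 1))" using c T continuous_on_subset by blast
  then have "bounded (D (m + 1) ` T)" using T compact_continuous_image compact_imp_bounded by blast
  then obtain B where B: "0 < B" "\<And>x. x \<in> T \<Longrightarrow> norm (D (m + 1) x) \<le> B"
    unfolding bounded_pos by auto
  have "continuous_on I (D 0)"
    using D[of 0] by (auto simp: continuous_on_eq_continuous_within intro: DERIV_continuous)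
  then have "bounded (D 0 ` T)" using T continuous_on_subset compact_continuous_image compact_imp_bounded by meson
  then obtain B' where B': "0 < B'" "\<And>x. x \<in> T \<Longrightarrow> norm (D 0 x) \<le> B'"
    unfolding bounded_pos by auto
  show ?thesis
  proof
    show "0 \<le> B + B'" using B B' by simp
    show "\<bar>D 0 y\<bar> \<le> B + B'" if "y \<in> T" for y using B'(2)[OF that] B by simp
    fix b y assume bT: "b \<in> T" "y \<in> T"
    have "norm (D 0 y - (\<Sum>i\<le>m. D i b * (y - b) ^ i / fact i)) \<le> B * norm (y - b) ^ Suc m / fact m"
    proof (rule field_Taylor[OF T(2) _ _ bT])
      show "(D i has_real_derivative D (Suc i) x) (at x within T)" if "x \<in> T" "i \<le> m" for i x
        using D[of i x] that T by (auto intro: has_field_derivative_subset)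
    qed (use B in auto)
    also have "\<dots> \<le> B * norm (y - b) ^ Suc m / 1"
      using B by (intro divide_left_mono) (auto simp: fact_ge_1)
    also have "\<dots> \<le> (B + B') * \<bar>y - b\<bar> ^ (m + 1)"
      using B' by (auto simp: intro!: mult_right_mono)
    finally show "\<bar>D 0 y - (\<Sum>i\<le>m. D i b / fact i * (y - b) ^ i)\<bar> \<le> (B + B') * \<bar>y - b\<bar> ^ (m + 1)"
      by simp
  qed
qed

text \<open>The same \<open>q\<close> carries the Taylor bound and the limits of the derivatives at
  \<open>b\<close>. Allowing \<open>b\<close> at an end point makes it possible to compare the
  expansions on the two sides of a defect point.\<close>

definition gap_expansion :: "(real \<Rightarrow> real) \<Rightarrow> nat \<Rightarrow> real \<Rightarrow> real \<Rightarrow> real \<Rightarrow> bool" where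
  "gap_expansion f m M \<alpha> \<beta> \<longleftrightarrow>
    (\<forall>y\<in>{\<alpha><..<\<beta>}. \<bar>f y\<bar> \<le> M) \<and>
    (\<forall>b\<in>{\<alpha>..\<beta>}. \<exists>q. (\<forall>y\<in>{\<alpha><..<\<beta>}. \<bar>f y - (\<Sum>i\<le>m. q i * (y - b) ^ i)\<bar> \<le> M * (\<beta> - \<alpha>) ^ (m + 1)) \<and>
      (\<forall>i\<le>m. ((deriv ^^ i) f \<longlongrightarrow> fact i * q i) (at b within {\<alpha><..<\<beta>})))"

lemma gap_expansionE:
  assumes "gap_expansion f m M \<alpha> \<beta>" "b \<in> {\<alpha>..\<beta>}"
  obtains q where
    "\<And>y. y \<in> {\<alpha><..<\<beta>} \<Longrightarrow> \<bar>f y - (\<Sum>i\<le>m. q i * (y - b) ^ i)\<bar> \<le> M * (\<beta> - \<alpha>) ^ (m + 1)"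
    "\<And>i. i \<le> m \<Longrightarrow> ((deriv ^^ i) f \<longlongrightarrow> fact i * q i) (at b within {\<alpha><..<\<beta>})"
proof -
  have "\<exists>q. (\<forall>y\<in>{\<alpha><..<\<beta>}. \<bar>f y - (\<Sum>i\<le>m. q i * (y - b) ^ i)\<bar> \<le> M * (\<beta> - \<alpha>) ^ (m + 1)) \<and>
      (\<forall>i\<le>m. ((deriv ^^ i) f \<longlongrightarrow> fact i * q i) (at b within {\<alpha><..<\<beta>}))"
    using conjunct2[OF assms(1)[unfolded gap_expansion_def]] assms(2) by (rule bspec)
  then obtain q where q: "\<forall>y\<in>{\<alpha><..<\<beta>}. \<bar>f y - (\<Sum>i\<le>m. q i * (y - b) ^ i)\<bar> \<le> M * (\<beta> - \<alpha>) ^ (m + 1)"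
      "\<forall>i\<le>m. ((deriv ^^ i) f \<longlongrightarrow> fact i * q i) (at b within {\<alpha><..<\<beta>})" by (elim exE conjE)
  show ?thesis by (rule that[of q]) (use q in \<open>simp_all only: Ball_def\<close>)
qed

text \<open>The outer pieces are unbounded, so the Taylor constant is taken on the compact part in
  \<open>[-3, 3]\<close>, which contains the supports of all relevant wavelets at fine
  levels.\<close>

lemma gap_expansion_piece:
  assumes ext: "extends_C_k_on (m + 1) I f" and I: "closed I" "convex I"
  obtains M where "0 \<le> M" "\<And>\<alpha> \<beta>. -3 \<le> \<alpha> \<Longrightarrow> \<alpha> < \<beta> \<Longrightarrow> \<beta> \<le> 3 \<Longrightarrow> {\<alpha>..\<beta>} \<subseteq> I \<Longrightarrow> gap_expansion f m M \<alpha> \<beta>"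
proof -
  obtain g where g: "C_k_on (m + 1) I g" "\<And>x. x \<in> interior I \<Longrightarrow> g x = f x"
    using ext unfolding extends_C_k_on_def by auto
  then obtain D where D: "\<And>x. x \<in> I \<Longrightarrow> D 0 x = g x"
    "\<And>i x. i < m + 1 \<Longrightarrow> x \<in> I \<Longrightarrow> (D i has_real_derivative D (Suc i) x) (at x within I)"
    "continuous_on I (D (m + 1))"
    unfolding C_k_on_def by blast
  have T: "I \<inter> {-3..3} \<subseteq> I" "convex (I \<inter> {-3..3})" "compact (I \<inter> {-3..3})"
    using I by (auto intro: convex_Int closed_Int_compact)
  obtain M where M: "0 \<le> M"
    "\<And>b y. b \<in> I \<inter> {-3..3} \<Longrightarrow> y \<in> I \<inter> {-3..3} \<Longrightarrow> \<bar>D 0 y - (\<Sum>i\<le>m. D i b / fact i * (y - b) ^ i)\<bar> \<le> M * \<bar>y - b\<bar> ^ (m + 1)"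
    "\<And>y. y \<in> I \<inter> {-3..3} \<Longrightarrow> \<bar>D 0 y\<bar> \<le> M"
    using taylor_piece[OF D(2,3) T] by blast
  show ?thesis
  proof
    show "0 \<le> M" by fact
    fix \<alpha> \<beta> :: real assume ab: "-3 \<le> \<alpha>" "\<alpha> < \<beta>" "\<beta> \<le> 3" "{\<alpha>..\<beta>} \<subseteq> I"
    have sub: "{\<alpha><..<\<beta>} \<subseteq> interior I" using ab(4) by (intro interior_maximal) auto
    have f: "f y = D 0 y" if "y \<in> {\<alpha><..<\<beta>}" for y
      using that sub g(2)[of y] D(1)[of y] interior_subset[of I] by (metis subsetD)
    have in_T: "y \<in> I \<inter> {-3..3}" if "y \<in> {\<alpha>..\<beta>}" for y using that ab by auto
    show "gap_expansion f m M \<alpha> \<beta>"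
      unfolding gap_expansion_def
    proof (intro conjI ballI)
      show "\<bar>f y\<bar> \<le> M" if "y \<in> {\<alpha><..<\<beta>}" for y using f[OF that] M(3)[OF in_T, of y] that by auto
      fix b assume b: "b \<in> {\<alpha>..\<beta>}"
      show "\<exists>q. (\<forall>y\<in>{\<alpha><..<\<beta>}. \<bar>f y - (\<Sum>i\<le>m. q i * (y - b) ^ i)\<bar> \<le> M * (\<beta> - \<alpha>) ^ (m + 1)) \<and>
          (\<forall>i\<le>m. ((deriv ^^ i) f \<longlongrightarrow> fact i * q i) (at b within {\<alpha><..<\<beta>}))"
      proof (intro exI conjI ballI allI impI)
        fix y assume y: "y \<in> {\<alpha><..<\<beta>}"
        have "\<bar>D 0 y - (\<Sum>i\<le>m. D i b / fact i * (y - b) ^ i)\<bar> \<le> M * \<bar>y - b\<bar> ^ (m + 1)"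
          by (rule M(2)) (use in_T b y in auto)
        also have "\<dots> \<le> M * (\<beta> - \<alpha>) ^ (m + 1)"
          using b y M(1) by (intro mult_left_mono power_mono) auto
        finally show "\<bar>f y - (\<Sum>i\<le>m. D i b / fact i * (y - b) ^ i)\<bar> \<le> M * (\<beta> - \<alpha>) ^ (m + 1)"
          using f[OF y] by simp
      next
        fix i assume i: "i \<le> m"
        have "((deriv ^^ i) f \<longlongrightarrow> D i b) (at b within {\<alpha><..<\<beta>})"
          by (rule C_k_on_tendsto_deriv[OF D(2,3)]) (use i b ab f in auto)
        then show "((deriv ^^ i) f \<longlongrightarrow> fact i * (D i b / fact i)) (at b within {\<alpha><..<\<beta>})" by simp
      qed
    qed
  qed
qed

lemma gap_expansion_mono:
  assumes "gap_expansion f m M \<alpha> \<beta>" "M \<le> M'" "\<alpha> \<le> \<beta>"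
  shows "gap_expansion f m M' \<alpha> \<beta>"
proof -
  have "M * (\<beta> - \<alpha>) ^ (m + 1) \<le> M' * (\<beta> - \<alpha>) ^ (m + 1)"
    using assms by (intro mult_right_mono) auto
  then show ?thesis using assms(1,2) unfolding gap_expansion_def by (meson order_trans)
qed

text \<open>An open interval without defect points lies in one of finitely many pieces, and the sum
  of their constants serves all of them.\<close>

lemma piecewise_smooth_gap_expansion:
  assumes f: "piecewise_smooth f m as"
  obtains M where "0 \<le> M"
    "\<And>\<alpha> \<beta>. -3 \<le> \<alpha> \<Longrightarrow> \<alpha> < \<beta> \<Longrightarrow> \<beta> \<le> 3 \<Longrightarrow> {\<alpha><..<\<beta>} \<inter> set as = {} \<Longrightarrow> gap_expansion f m M \<alpha> \<beta>"
proof -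
  define pieces where "pieces = {{..hd as}, {last as..}} \<union> (\<lambda>i. {as ! i..as ! (i + 1)}) ` {i. i + 1 < length as}"
  have fin: "finite pieces" unfolding pieces_def by (auto intro!: finite_imageI intro: finite_subset[of _ "{..length as}"])
  have "\<forall>I\<in>pieces. \<exists>M\<ge>0. \<forall>\<alpha> \<beta>. -3 \<le> \<alpha> \<longrightarrow> \<alpha> < \<beta> \<longrightarrow> \<beta> \<le> 3 \<longrightarrow> {\<alpha>..\<beta>} \<subseteq> I \<longrightarrow> gap_expansion f m M \<alpha> \<beta>"
  proof
    fix I assume "I \<in> pieces"
    then have "extends_C_k_on (m + 1) I f" "closed I" "convex I"
      using f unfolding pieces_def piecewise_smooth_def by auto
    then show "\<exists>M\<ge>0. \<forall>\<alpha> \<beta>. -3 \<le> \<alpha> \<longrightarrow> \<alpha> < \<beta> \<longrightarrow> \<beta> \<le> 3 \<longrightarrow> {\<alpha>..\<beta>} \<subseteq> I \<longrightarrow> gap_expansion f m M \<alpha> \<beta>"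
      by (metis gap_expansion_piece)
  qed
  then obtain M where M: "\<And>I. I \<in> pieces \<Longrightarrow> 0 \<le> M I"
    "\<And>I \<alpha> \<beta>. I \<in> pieces \<Longrightarrow> -3 \<le> \<alpha> \<Longrightarrow> \<alpha> < \<beta> \<Longrightarrow> \<beta> \<le> 3 \<Longrightarrow> {\<alpha>..\<beta>} \<subseteq> I \<Longrightarrow> gap_expansion f m (M I) \<alpha> \<beta>"
    using bchoice[of pieces] by metis
  show ?thesis
  proof
    show "0 \<le> sum M pieces" using M(1) by (rule sum_nonneg)
    fix \<alpha> \<beta> :: real assume ab: "-3 \<le> \<alpha>" "\<alpha> < \<beta>" "\<beta> \<le> 3" "{\<alpha><..<\<beta>} \<inter> set as = {}"
    have ne: "as \<noteq> []" using f unfolding piecewise_smooth_def by auto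
    have out: "a \<le> \<alpha> \<or> \<beta> \<le> a" if "a \<in> set as" for a using ab(4) that by force
    have "\<exists>I\<in>pieces. {\<alpha>..\<beta>} \<subseteq> I"
    proof (cases "as ! 0 \<le> \<alpha>")
      case False
      then have "\<beta> \<le> hd as" using out[of "hd as"] ne by (auto simp: hd_conv_nth)
      then show ?thesis unfolding pieces_def by auto
    next
      case True
      define i where "i = Max {i. i < length as \<and> as ! i \<le> \<alpha>}"
      have fi: "finite {i. i < length as \<and> as ! i \<le> \<alpha>}" by auto
      have "i \<in> {i. i < length as \<and> as ! i \<le> \<alpha>}"
        unfolding i_def using True ne by (intro Max_in fi) auto
      then have i: "i < length as" "as ! i \<le> \<alpha>" by auto
      show ?thesis
      proof (cases "i + 1 < length as")
        case True
        have "\<not> as ! (i + 1) \<le> \<alpha>"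
        proof
          assume "as ! (i + 1) \<le> \<alpha>"
          then have "i + 1 \<in> {i. i < length as \<and> as ! i \<le> \<alpha>}" using True by simp
          from Max_ge[OF fi this] show False unfolding i_def[symmetric] by simp
        qed
        then have "\<beta> \<le> as ! (i + 1)" using out[of "as ! (i + 1)"] True by auto
        then have "{\<alpha>..\<beta>} \<subseteq> {as ! i..as ! (i + 1)}" using i by auto
        then show ?thesis using True unfolding pieces_def by blast
      next
        case False
        then have "i = length as - 1" using i by simp
        then have "last as \<le> \<alpha>" using i ne by (simp add: last_conv_nth)
        then show ?thesis unfolding pieces_def by auto
      qed
    qed
    then obtain I where I: "I \<in> pieces" "{\<alpha>..\<beta>} \<subseteq> I" by blast
    have "M I \<le> sum M pieces" using I(1) M(1) fin by (intro member_le_sum) auto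
    then show "gap_expansion f m (sum M pieces) \<alpha> \<beta>"
      by (rule gap_expansion_mono[OF M(2)[OF I(1) ab(1-3) I(2)] _ less_imp_le[OF ab(2)]])
  qed
qed

lemma at_within_Ioo_left: "\<alpha> < (a::real) \<Longrightarrow> at a within {\<alpha><..<a} = at_left a"
  by (rule at_within_nhd[of _ "{\<alpha><..}"]) auto

lemma at_within_Ioo_right: "(a::real) < \<beta> \<Longrightarrow> at a within {a<..<\<beta>} = at_right a"
  by (rule at_within_nhd[of _ "{..<\<beta>}"]) auto

text \<open>Below order \<open>m\<close> the left and right Taylor coefficients at \<open>a\<close>
  agree, since the derivatives of those orders are continuous; at order \<open>m\<close> they differ
  by the jump divided by \<open>fact m\<close>. The right polynomial is therefore the left one plus
  a multiple of the truncated power.\<close>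

lemma piecewise_smooth_jump_expansion:
  assumes f: "piecewise_smooth f m as" and M: "0 \<le> M"
    and L: "gap_expansion f m M \<alpha> a" and R: "gap_expansion f m M a \<beta>" and ab: "\<alpha> < a" "a < \<beta>"
  obtains q where "\<And>y. y \<in> {\<alpha><..<\<beta>} \<Longrightarrow> y \<noteq> a \<Longrightarrow>
    \<bar>f y - (\<Sum>i\<le>m. q i * (y - a) ^ i) - (right_deriv_lim m f a - left_deriv_lim m f a) / fact m * tpow m (y - a)\<bar>
      \<le> M * (\<beta> - \<alpha>) ^ (m + 1)"
proof -
  obtain p where p: "\<And>y. y \<in> {\<alpha><..<a} \<Longrightarrow> \<bar>f y - (\<Sum>i\<le>m. p i * (y - a) ^ i)\<bar> \<le> M * (a - \<alpha>) ^ (m + 1)"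
      "\<And>i. i \<le> m \<Longrightarrow> ((deriv ^^ i) f \<longlongrightarrow> fact i * p i) (at_left a)"
  proof (rule gap_expansionE[OF L])
    show "a \<in> {\<alpha>..a}" using ab by simp
  qed (rule that, unfold at_within_Ioo_left[OF ab(1)])
  obtain q where q: "\<And>y. y \<in> {a<..<\<beta>} \<Longrightarrow> \<bar>f y - (\<Sum>i\<le>m. q i * (y - a) ^ i)\<bar> \<le> M * (\<beta> - a) ^ (m + 1)"
      "\<And>i. i \<le> m \<Longrightarrow> ((deriv ^^ i) f \<longlongrightarrow> fact i * q i) (at_right a)"
  proof (rule gap_expansionE[OF R])
    show "a \<in> {a..\<beta>}" using ab by simp
  qed (rule that, unfold at_within_Ioo_right[OF ab(2)])
  let ?J = "right_deriv_lim m f a - left_deriv_lim m f a"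
  have J: "q m = p m + ?J / fact m"
  proof -
    have "left_deriv_lim m f a = fact m * p m"
      unfolding left_deriv_lim_def using p(2)[of m] by (intro tendsto_Lim) auto
    moreover have "right_deriv_lim m f a = fact m * q m"
      unfolding right_deriv_lim_def using q(2)[of m] by (intro tendsto_Lim) auto
    ultimately show ?thesis by (simp add: field_simps)
  qed
  have eq: "q i = p i" if "i < m" for i
  proof -
    have "isCont ((deriv ^^ i) f) a"
      using f that unfolding piecewise_smooth_def by (intro C_k_on_UNIV_isCont_deriv[of "m - 1"]) auto
    then have "((deriv ^^ i) f \<longlongrightarrow> (deriv ^^ i) f a) (at_left a)" "((deriv ^^ i) f \<longlongrightarrow> (deriv ^^ i) f a) (at_right a)"
      by (auto simp: isCont_def filterlim_at_split)
    then have "fact i * p i = (deriv ^^ i) f a" "fact i * q i = (deriv ^^ i) f a"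
      using tendsto_unique[OF _ p(2)[of i]] tendsto_unique[OF _ q(2)[of i]] that by auto
    then have "fact i * p i = fact i * q i" by simp
    then show ?thesis by simp
  qed
  have le: "(a - \<alpha>) ^ (m + 1) \<le> (\<beta> - \<alpha>) ^ (m + 1)" "(\<beta> - a) ^ (m + 1) \<le> (\<beta> - \<alpha>) ^ (m + 1)"
    using ab by (intro power_mono; simp)+
  show ?thesis
  proof
    fix y assume y: "y \<in> {\<alpha><..<\<beta>}" "y \<noteq> a"
    show "\<bar>f y - (\<Sum>i\<le>m. p i * (y - a) ^ i) - ?J / fact m * tpow m (y - a)\<bar> \<le> M * (\<beta> - \<alpha>) ^ (m + 1)"
    proof (cases "y < a")
      case True
      then have "\<bar>f y - (\<Sum>i\<le>m. p i * (y - a) ^ i) - ?J / fact m * tpow m (y - a)\<bar> \<le> M * (a - \<alpha>) ^ (m + 1)"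
        using p(1)[of y] y by (auto simp: tpow_def)
      also have "\<dots> \<le> M * (\<beta> - \<alpha>) ^ (m + 1)" using le M by (intro mult_left_mono) auto
      finally show ?thesis .
    next
      case False
      have "(\<Sum>i\<le>m. q i * (y - a) ^ i) = (\<Sum>i<m. q i * (y - a) ^ i) + q m * (y - a) ^ m"
        by (simp add: lessThan_Suc_atMost[symmetric])
      also have "(\<Sum>i<m. q i * (y - a) ^ i) = (\<Sum>i<m. p i * (y - a) ^ i)"
        using eq by (intro sum.cong) auto
      also have "\<dots> + q m * (y - a) ^ m = (\<Sum>i\<le>m. p i * (y - a) ^ i) + ?J / fact m * (y - a) ^ m"
        unfolding J by (simp add: lessThan_Suc_atMost[symmetric] distrib_right)
      finally have "\<bar>f y - (\<Sum>i\<le>m. p i * (y - a) ^ i) - ?J / fact m * tpow m (y - a)\<bar> \<le> M * (\<beta> - a) ^ (m + 1)"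
        using q(1)[of y] y False by (auto simp: tpow_def diff_diff_eq)
      also have "\<dots> \<le> M * (\<beta> - \<alpha>) ^ (m + 1)" using le M by (intro mult_left_mono) auto
      finally show ?thesis .
    qed
  qed
qed

text \<open>Identifies the \<open>m\<close> of the theorem with the index that membership in the
  class provides.\<close>

lemma has_index_unique:
  assumes "has_index f m" "has_index f m'"
  shows "m = m'"
proof -
  have "\<not> m < m'" if hm: "has_index f m" "has_index f m'" for m m'
  proof
    assume less: "m < m'"
    obtain as as' where f: "piecewise_smooth f m as" "piecewise_smooth f m' as'"
      using hm unfolding has_index_def by blast
    have ck: "C_k_on (m' - 1) UNIV f" using f(2) less unfolding piecewise_smooth_def by auto
    have "left_deriv_lim m f a = right_deriv_lim m f a" for a
    proof -
      have "isCont ((deriv ^^ m) f) a" using less by (intro C_k_on_UNIV_isCont_deriv[OF ck]) auto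
      then have "((deriv ^^ m) f \<longlongrightarrow> (deriv ^^ m) f a) (at_left a)" "((deriv ^^ m) f \<longlongrightarrow> (deriv ^^ m) f a) (at_right a)"
        by (auto simp: isCont_def filterlim_at_split)
      then show ?thesis unfolding left_deriv_lim_def right_deriv_lim_def
        by (simp add: tendsto_Lim)
    qed
    then show False using f(1) unfolding piecewise_smooth_def by auto
  qed
  then show ?thesis using assms by (metis linorder_neqE_nat)
qed

lemma jump_outside_support:
  assumes "\<And>x. x \<in> U \<Longrightarrow> f x = 0" "open U" "a \<in> U"
  shows "left_deriv_lim m f a = right_deriv_lim m f a"
proof -
  have "(deriv ^^ i) f x = 0" if "x \<in> U" for i x
    using that
  proof (induction i arbitrary: x)
    case (Suc i)
    have "((\<lambda>_. 0) has_real_derivative 0) (at x)" by simp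
    then have "((deriv ^^ i) f has_real_derivative 0) (at x)"
      by (rule has_field_derivative_transform_within_open[OF _ assms(2) Suc.prems]) (use Suc.IH in auto)
    then show ?case by (simp add: DERIV_imp_deriv)
  qed (use assms in auto)
  then have ev: "eventually (\<lambda>x. 0 = (deriv ^^ m) f x) (nhds a)"
    unfolding eventually_nhds using assms by (intro exI[of _ U]) auto
  have "((deriv ^^ m) f \<longlongrightarrow> 0) (at_left a)" "((deriv ^^ m) f \<longlongrightarrow> 0) (at_right a)"
    by (rule Lim_transform_eventually[OF tendsto_const], use ev in \<open>simp add: eventually_at_filter eventually_mono\<close>)+
  then show ?thesis unfolding left_deriv_lim_def right_deriv_lim_def
    by (simp add: tendsto_Lim)
qed

text \<open>A point of \<open>[-1, 1]\<close> other than a defect point has a neighbourhood free of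
  defect points, on which \<open>gap_expansion\<close> bounds \<open>f\<close> by \<open>M\<close>.
  The finitely many values at the defect points are added separately.\<close>

lemma piecewise_smooth_bounded:
  assumes f: "piecewise_smooth f m as" and z: "\<And>x. x \<notin> {-1..1} \<Longrightarrow> f x = 0"
  obtains C where "\<And>x. \<bar>f x\<bar> \<le> C"
proof -
  obtain M where M: "0 \<le> M"
    "\<And>\<alpha> \<beta>. -3 \<le> \<alpha> \<Longrightarrow> \<alpha> < \<beta> \<Longrightarrow> \<beta> \<le> 3 \<Longrightarrow> {\<alpha><..<\<beta>} \<inter> set as = {} \<Longrightarrow> gap_expansion f m M \<alpha> \<beta>"
    using piecewise_smooth_gap_expansion[OF f] by blast
  have "\<bar>f x\<bar> \<le> M + (\<Sum>a\<in>set as. \<bar>f a\<bar>)" for x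
  proof (cases "x \<in> set as")
    case True
    then have "\<bar>f x\<bar> \<le> (\<Sum>a\<in>set as. \<bar>f a\<bar>)" by (intro member_le_sum) auto
    then show ?thesis using M(1) by linarith
  next
    case False
    have nn: "0 \<le> (\<Sum>a\<in>set as. \<bar>f a\<bar>)" by (intro sum_nonneg) auto
    show ?thesis
    proof (cases "x \<in> {-1..1}")
      case True
      have "open (- set as)" by (intro open_Compl finite_imp_closed) auto
      then obtain e where e: "0 < e" "ball x e \<subseteq> - set as"
        using False open_contains_ball by (metis ComplI)
      let ?e = "min e 1"
      have "{x - ?e<..<x + ?e} \<subseteq> ball x e" by (auto simp: dist_real_def)
      then have "gap_expansion f m M (x - ?e) (x + ?e)"
        using e True by (intro M(2)) auto
      then have "\<bar>f x\<bar> \<le> M" using e unfolding gap_expansion_def by auto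
      then show ?thesis using nn by linarith
    qed (use z M nn in auto)
  qed
  then show ?thesis by (rule that)
qed

section \<open>The enriching density\<close>

lemma C_k_on_SucI:
  assumes "\<And>x. (f has_real_derivative f' x) (at x)" "C_k_on k UNIV f'"
  shows "C_k_on (Suc k) UNIV f"
proof -
  obtain D where D: "\<forall>x\<in>UNIV. D 0 x = f' x"
      "\<forall>i<k. \<forall>x\<in>UNIV. (D i has_real_derivative D (Suc i) x) (at x within UNIV)" "continuous_on UNIV (D k)"
    using assms(2) unfolding C_k_on_def by blast
  have D0: "D 0 = f'" using D(1) by auto
  show ?thesis
    unfolding C_k_on_def
  proof (intro exI[of _ "\<lambda>i. case i of 0 \<Rightarrow> f | Suc i \<Rightarrow> D i"] conjI allI impI ballI)
    fix i x assume "i < Suc k"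
    then show "((case i of 0 \<Rightarrow> f | Suc i \<Rightarrow> D i) has_real_derivative (case Suc i of 0 \<Rightarrow> f | Suc i \<Rightarrow> D i) x) (at x within UNIV)"
      using D(2) assms(1)[of x] D0 by (cases i) auto
  qed (use D in auto)
qed

lemma C_k_on_add:
  assumes "C_k_on k I f" "C_k_on k I g"
  shows "C_k_on k I (\<lambda>x. f x + g x)"
proof -
  obtain D E where D: "\<forall>x\<in>I. D 0 x = f x"
      "\<forall>i<k. \<forall>x\<in>I. (D i has_real_derivative D (Suc i) x) (at x within I)" "continuous_on I (D k)"
    and E: "\<forall>x\<in>I. E 0 x = g x"
      "\<forall>i<k. \<forall>x\<in>I. (E i has_real_derivative E (Suc i) x) (at x within I)" "continuous_on I (E k)"
    using assms unfolding C_k_on_def by blast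
  show ?thesis
    unfolding C_k_on_def
  proof (intro exI[of _ "\<lambda>i x. D i x + E i x"] conjI allI impI ballI)
    show "((\<lambda>x. D i x + E i x) has_real_derivative D (Suc i) x + E (Suc i) x) (at x within I)"
      if "i < k" "x \<in> I" for i x
      using D(2) E(2) that by (intro DERIV_add) auto
    show "continuous_on I (\<lambda>x. D k x + E k x)" using D(3) E(3) by (rule continuous_on_add)
  qed (use D(1) E(1) in auto)
qed

lemma tpow_has_derivative:
  "(tpow (Suc (Suc n)) has_real_derivative real (Suc (Suc n)) * tpow (Suc n) x) (at x)"
proof -
  consider "x < 0" | "x = 0" | "0 < x" by linarith
  then show ?thesis
  proof cases
    case 1
    have "((\<lambda>_. 0) has_real_derivative 0) (at x)" by simp
    then have "(tpow (Suc (Suc n)) has_real_derivative 0) (at x)"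
      by (rule has_field_derivative_transform_within_open[where S="{..<0}"]) (use 1 in \<open>auto simp: tpow_def\<close>)
    then show ?thesis using 1 by (simp add: tpow_def)
  next
    case 3
    have "((\<lambda>x. x ^ Suc (Suc n)) has_real_derivative real (Suc (Suc n)) * x ^ Suc n) (at x)"
      using DERIV_pow[of "Suc (Suc n)" x] by simp
    then have "(tpow (Suc (Suc n)) has_real_derivative real (Suc (Suc n)) * x ^ Suc n) (at x)"
      by (rule has_field_derivative_transform_within_open[where S="{0<..}"]) (use 3 in \<open>auto simp: tpow_def\<close>)
    then show ?thesis using 3 by (simp add: tpow_def)
  next
    case 2
    have "((\<lambda>h. tpow (Suc (Suc n)) h / h) \<longlongrightarrow> 0) (at 0)"
    proof (rule Lim_null_comparison)
      have "norm (tpow (Suc (Suc n)) h / h) \<le> \<bar>h\<bar> ^ Suc n" for h :: real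
      proof (cases "0 < h")
        case False
        then have "tpow (Suc (Suc n)) h / h = 0" by (simp add: tpow_def)
        then show ?thesis by (simp only: norm_zero zero_le_power abs_ge_zero)
      qed (simp add: tpow_def)
      then show "eventually (\<lambda>h. norm (tpow (Suc (Suc n)) h / h) \<le> \<bar>h\<bar> ^ Suc n) (at (0::real))"
        by (intro always_eventually allI)
      show "((\<lambda>h::real. \<bar>h\<bar> ^ Suc n) \<longlongrightarrow> 0) (at 0)"
        by (rule tendsto_eq_intros refl | simp)+
    qed
    then show ?thesis unfolding 2 by (simp add: DERIV_def tpow_def)
  qed
qed

lemma tpow_le: "y \<le> c \<Longrightarrow> 0 \<le> c \<Longrightarrow> tpow m y \<le> c ^ m"
  unfolding tpow_def by (auto intro: power_mono)

lemma tpow_ge: "0 < c \<Longrightarrow> c \<le> y \<Longrightarrow> c ^ m \<le> tpow m y"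
  unfolding tpow_def by (auto intro: power_mono)

text \<open>Differentiation turns such a product into a sum of two of the same form, with exponents
  \<open>n\<close> and \<open>n - 1\<close>; the polynomial factor is there for the sake of this
  induction.\<close>

lemma C_k_on_poly_tpow:
  "k < n \<Longrightarrow> C_k_on k UNIV (\<lambda>x. poly p x * tpow n (9/4 - x\<^sup>2))"
proof (induction k arbitrary: n p)
  case 0
  have tc: "continuous_on UNIV (tpow n)"
  proof (cases "n = 1")
    case True
    have "tpow n = (\<lambda>x. max 0 x)" using True by (auto simp: tpow_def max_def)
    then show ?thesis by (simp add: continuous_intros)
  next
    case False
    then obtain j where "n = Suc (Suc j)" using 0 by (metis One_nat_def not0_implies_Suc less_nat_zero_code)
    then show ?thesis
      using tpow_has_derivative[THEN DERIV_isCont] by (auto intro: continuous_at_imp_continuous_on)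
  qed
  have "continuous_on UNIV (\<lambda>x. tpow n (9/4 - x\<^sup>2))"
    by (rule continuous_on_compose2[OF tc]) (auto intro!: continuous_intros)
  then have "continuous_on UNIV (\<lambda>x. poly p x * tpow n (9/4 - x\<^sup>2))" by (intro continuous_intros)
  then show ?case unfolding C_k_on_def by (intro exI[of _ "\<lambda>_. \<lambda>x. poly p x * tpow n (9/4 - x\<^sup>2)"]) auto
next
  case (Suc k)
  then have "n = Suc (Suc (n - 2))" by simp
  then obtain j where n: "n = Suc (Suc j)" by blast
  let ?f' = "\<lambda>x. poly (pderiv p) x * tpow n (9/4 - x\<^sup>2) + poly (p * [:0, - 2 * real n:]) x * tpow (Suc j) (9/4 - x\<^sup>2)"
  show ?case
  proof (rule C_k_on_SucI)
    show "C_k_on k UNIV ?f'" using Suc n by (intro C_k_on_add Suc.IH) auto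
    fix x
    have 1: "((\<lambda>x. 9/4 - x\<^sup>2) has_real_derivative - 2 * x) (at x)"
      by (auto intro!: derivative_eq_intros)
    have "((\<lambda>x. tpow n (9/4 - x\<^sup>2)) has_real_derivative real n * tpow (Suc j) (9/4 - x\<^sup>2) * (- 2 * x)) (at x)"
      unfolding n by (rule DERIV_chain2[OF tpow_has_derivative 1])
    from DERIV_mult[OF poly_DERIV[of p x] this]
    show "((\<lambda>x. poly p x * tpow n (9/4 - x\<^sup>2)) has_real_derivative ?f' x) (at x)"
      by (rule DERIV_cong) (simp add: algebra_simps)
  qed
qed

definition xi_const :: "nat \<Rightarrow> real" where
  "xi_const \<tau> = fact (2 * \<tau> + 3) / (fact (\<tau> + 1))\<^sup>2 * (1 / 3 ^ (2 * \<tau> + 3))"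

lemma xi_const_pos: "0 < xi_const \<tau>"
  unfolding xi_const_def by simp

lemma xi_eq_tpow: "xi \<tau> x = xi_const \<tau> * tpow (\<tau> + 1) (9/4 - x\<^sup>2)"
proof -
  have eq: "9/4 - x\<^sup>2 = (3/2 - x) * (3/2 + x)" by (simp add: power2_eq_square algebra_simps)
  have "0 < 9/4 - x\<^sup>2 \<longleftrightarrow> x \<in> {-3/2<..<3/2}" unfolding eq by (auto simp: zero_less_mult_iff)
  then show ?thesis
    unfolding xi_def xi_const_def[symmetric] tpow_def eq power_mult_distrib
    by (auto simp: indicator_def)
qed

lemma xi_C_k_on: "k \<le> \<tau> \<Longrightarrow> C_k_on k UNIV (xi \<tau>)"
  using C_k_on_poly_tpow[of k "\<tau> + 1" "[:xi_const \<tau>:]"] by (simp add: xi_eq_tpow[abs_def])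

lemma xi_meas [measurable]: "xi \<tau> \<in> borel_measurable borel"
  unfolding xi_eq_tpow[abs_def] by measurable

lemma xi_nonneg: "0 \<le> xi \<tau> x"
  unfolding xi_eq_tpow using xi_const_pos[of \<tau>] by (auto simp: tpow_def)

lemma xi_support: "x \<notin> {-3/2..3/2} \<Longrightarrow> xi \<tau> x = 0"
  by (simp add: xi_def)

lemma xi_le: "xi \<tau> x \<le> xi_const \<tau> * (9/4) ^ (\<tau> + 1)"
  unfolding xi_eq_tpow by (intro mult_left_mono tpow_le less_imp_le[OF xi_const_pos]) simp_all

text \<open>The interval is \<open>[-1, 1]\<close> widened by 1/4, the room needed by a wavelet
  whose support, of length at most 1/4, contains a defect point.\<close>

lemma xi_ge:
  assumes "x \<in> {-5/4..5/4}"
  shows "xi_const \<tau> * (11/16) ^ (\<tau> + 1) \<le> xi \<tau> x"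
proof -
  have "x\<^sup>2 \<le> (5/4)\<^sup>2" using assms by (intro power2_le_iff_abs_le[THEN iffD2]) auto
  then have "11/16 \<le> 9/4 - x\<^sup>2" by (simp add: power2_eq_square)
  then show ?thesis
    unfolding xi_eq_tpow by (intro mult_left_mono tpow_ge less_imp_le[OF xi_const_pos]) simp_all
qed

text \<open>The substitution \<open>x = - 3/2 + 3 * t\<close> turns the product of powers into
  \<open>(9 * (t * (1 - t))) ^ n\<close> with \<open>n = \<tau> + 1\<close>, and the Beta integral
  of \<open>(t * (1 - t)) ^ n\<close> is \<open>(fact n)\<^sup>2 / fact (2 * n + 1)\<close>.\<close>

lemma xi_integral: "has_bochner_integral lborel (xi \<tau>) 1"
proof -
  define n where "n = \<tau> + 1"
  let ?b = "\<lambda>t::real. t ^ n * (1 - t) ^ n"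
  have "((\<lambda>t. t powr (real (n + 1) - 1) * (1 - t) powr (real (n + 1) - 1)) has_integral Beta (real (n + 1)) (real (n + 1))) {0..1}"
    by (rule has_integral_Beta_real) auto
  moreover have "Beta (real (n + 1)) (real (n + 1)) = (fact n)\<^sup>2 / fact (2 * n + 1)"
  proof -
    have "Beta (real (n + 1)) (real (n + 1)) = Gamma (1 + real n) * Gamma (1 + real n) / Gamma (1 + real (2 * n + 1))"
      by (simp add: Beta_def add_ac)
    then show ?thesis by (simp only: Gamma_fact power2_eq_square)
  qed
  ultimately have "((\<lambda>t. t powr (real (n + 1) - 1) * (1 - t) powr (real (n + 1) - 1)) has_integral (fact n)\<^sup>2 / fact (2 * n + 1)) {0..1}"
    by simp
  then have hi: "(?b has_integral (fact n)\<^sup>2 / fact (2 * n + 1)) {0..1}"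
    by (rule has_integral_spike_eq[of "{0,1}", THEN iffD1, rotated -1]) (auto simp: powr_realpow)
  have si: "set_integrable lborel {0..1} ?b"
    by (rule borel_integrable_atLeastAtMost') (auto intro!: continuous_intros)
  then have "(LINT t:{0..1}|lborel. ?b t) = (fact n)\<^sup>2 / fact (2 * n + 1)"
    using set_borel_integral_eq_integral(2)[OF si] hi by (simp add: integral_unique)
  then have hb: "has_bochner_integral lborel (\<lambda>t. indicator {0..1} t * ?b t) ((fact n)\<^sup>2 / fact (2 * n + 1))"
    using si by (simp add: has_bochner_integral_iff set_integrable_def set_lebesgue_integral_def)
  have eq: "xi \<tau> (- 3/2 + 3 * t) = xi_const \<tau> * 9 ^ n * (indicator {0..1} t * ?b t)" for t
  proof -
    have i: "indicator {-3/2..3/2} (- 3/2 + 3 * t) = (indicator {0..1} t :: real)"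
      by (auto simp: indicator_def)
    have P: "(3/2 - (- 3/2 + 3 * t)) ^ n * (3/2 + (- 3/2 + 3 * t)) ^ n = (9 * (t * (1 - t))) ^ n"
    proof -
      have "(3/2 - (- 3/2 + 3 * t)) * (3/2 + (- 3/2 + 3 * t)) = 9 * (t * (1 - t))"
        by (simp add: algebra_simps)
      then show ?thesis by (simp only: power_mult_distrib[symmetric])
    qed
    have "xi \<tau> (- 3/2 + 3 * t) = xi_const \<tau> * ((3/2 - (- 3/2 + 3 * t)) ^ n * (3/2 + (- 3/2 + 3 * t)) ^ n)
        * indicator {-3/2..3/2} (- 3/2 + 3 * t)"
      unfolding xi_def xi_const_def n_def by (simp only: mult.assoc)
    then show ?thesis unfolding P i by (simp add: power_mult_distrib)
  qed
  have "has_bochner_integral lborel (\<lambda>t. xi \<tau> (- 3/2 + 3 * t)) (xi_const \<tau> * 9 ^ n * ((fact n)\<^sup>2 / fact (2 * n + 1)))"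
    unfolding eq using hb by (rule has_bochner_integral_mult_right)
  moreover have "xi_const \<tau> * 9 ^ n * ((fact n)\<^sup>2 / fact (2 * n + 1)) = 1 /\<^sub>R \<bar>3\<bar>"
  proof -
    have e: "2 * \<tau> + 3 = 2 * n + 1" "\<tau> + 1 = n" by (auto simp: n_def)
    have "(3::real) ^ (2 * n + 1) = 3 * 9 ^ n" by (simp add: power_mult)
    moreover have "F / G * (1 / (3 * T)) * T * (G / F) = 1 / 3" if "F \<noteq> 0" "G \<noteq> 0" "T \<noteq> 0" for F G T :: real
      using that by (simp add: field_simps)
    ultimately have "xi_const \<tau> * 9 ^ n * ((fact n)\<^sup>2 / fact (2 * n + 1)) = 1 / 3"
      unfolding xi_const_def e by (metis fact_nonzero power_not_zero zero_neq_numeral)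
    then show ?thesis by (simp only:) simp
  qed
  ultimately have "has_bochner_integral lborel (\<lambda>t. xi \<tau> (- 3/2 + 3 * t)) (1 /\<^sub>R \<bar>3\<bar>)" by (simp only:)
  then show ?thesis
    using lborel_has_bochner_integral_real_affine_iff[of 3 "xi \<tau>" 1 "- 3/2"] by simp
qed

lemma inverse_power2_eventually_le:
  assumes "0 < \<eta>"
  obtains N :: nat where "\<And>j. j \<ge> N \<Longrightarrow> 1 / 2 ^ j \<le> (\<eta>::real)"
proof -
  obtain N where N: "(1/2) ^ N < \<eta>" using real_arch_pow_inv[of \<eta> "1/2"] assms by auto
  show ?thesis
  proof
    fix j assume "j \<ge> N"
    then have "(1/2::real) ^ j \<le> (1/2) ^ N" by (intro power_decreasing) auto
    then show "1 / 2 ^ j \<le> \<eta>" using N by (simp add: power_one_over)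
  qed
qed

section \<open>Enriched densities and their local expansions\<close>

lemma enriched_meas [measurable]:
  "f \<in> borel_measurable borel \<Longrightarrow> enriched p (xi \<tau>) f \<in> borel_measurable borel"
  unfolding enriched_def[abs_def] by (intro borel_measurable_add borel_measurable_times measurable_const xi_meas) auto

lemma enriched_prob_density:
  assumes "prob_density f" "0 < p" "p < 1"
  shows "prob_density (enriched p (xi \<tau>) f)"
proof -
  have "has_bochner_integral lborel (\<lambda>x. (1 - p) * f x + p * xi \<tau> x) ((1 - p) * 1 + p * 1)"
    using assms(1) unfolding prob_density_def
    by (intro has_bochner_integral_add has_bochner_integral_mult_right xi_integral) auto
  then show ?thesis
    using assms xi_nonneg[of \<tau>] unfolding prob_density_def by (auto simp: enriched_def[abs_def])
qed

text \<open>At fine levels an interval carrying a wavelet contains at most one defect point; the two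
  clauses are the two cases. In the first the centre \<open>\<alpha>\<close> is as good as any
  other, since the wavelet annihilates the polynomial.\<close>

definition local_expansions :: "(real \<Rightarrow> real) \<Rightarrow> nat \<Rightarrow> real set \<Rightarrow> (real \<Rightarrow> real) \<Rightarrow> real \<Rightarrow> bool" where
  "local_expansions g m D J M \<longleftrightarrow> 0 \<le> M \<and>
    (\<forall>\<alpha> \<beta>. -3 \<le> \<alpha> \<longrightarrow> \<alpha> < \<beta> \<longrightarrow> \<beta> \<le> 3 \<longrightarrow> {\<alpha><..<\<beta>} \<inter> D = {} \<longrightarrow>
      (\<exists>q. \<forall>y\<in>{\<alpha><..<\<beta>}. \<bar>g y - (\<Sum>i\<le>m. q i * (y - \<alpha>) ^ i)\<bar> \<le> M * (\<beta> - \<alpha>) ^ (m + 1))) \<and>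
    (\<forall>a \<alpha> \<beta>. a \<in> D \<longrightarrow> -3 \<le> \<alpha> \<longrightarrow> \<alpha> < a \<longrightarrow> a < \<beta> \<longrightarrow> \<beta> \<le> 3 \<longrightarrow> {\<alpha><..<\<beta>} \<inter> D = {a} \<longrightarrow>
      (\<exists>q. \<forall>y\<in>{\<alpha><..<\<beta>}. y \<noteq> a \<longrightarrow>
        \<bar>g y - (\<Sum>i\<le>m. q i * (y - a) ^ i) - J a * tpow m (y - a)\<bar> \<le> M * (\<beta> - \<alpha>) ^ (m + 1)))"

text \<open>\<open>xi (d + 2)\<close> has a Taylor expansion of order \<open>m\<close> at every
  point, so it changes the polynomial and the constant but adds no jump; the jumps of
  \<open>f\<close> are only scaled by \<open>1 - p\<close>.\<close>

lemma enriched_local_expansions: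
  assumes m: "m \<le> d" and f: "piecewise_smooth f m as"
  shows "\<exists>M. local_expansions (enriched p (xi (d + 2)) f) m (set as)
    (\<lambda>a. (1 - p) * ((right_deriv_lim m f a - left_deriv_lim m f a) / fact m)) M"
proof -
  let ?g = "enriched p (xi (d + 2)) f"
  obtain M where M: "0 \<le> M"
    "\<And>\<alpha> \<beta>. -3 \<le> \<alpha> \<Longrightarrow> \<alpha> < \<beta> \<Longrightarrow> \<beta> \<le> 3 \<Longrightarrow> {\<alpha><..<\<beta>} \<inter> set as = {} \<Longrightarrow> gap_expansion f m M \<alpha> \<beta>"
    using piecewise_smooth_gap_expansion[OF f] by blast
  have "C_k_on (m + 1) UNIV (xi (d + 2))" by (rule xi_C_k_on) (use m in simp)
  then obtain D where D: "\<forall>x\<in>UNIV. D 0 x = xi (d + 2) x"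
      "\<forall>i<m+1. \<forall>x\<in>UNIV. (D i has_real_derivative D (Suc i) x) (at x within UNIV)" "continuous_on UNIV (D (m + 1))"
    unfolding C_k_on_def by blast
  have D': "(D i has_real_derivative D (Suc i) x) (at x within UNIV)" if "i < m + 1" for i x
    using D(2) that by blast
  have "\<exists>L\<ge>0. \<forall>b\<in>{-3..3}. \<forall>y\<in>{-3..3}. \<bar>D 0 y - (\<Sum>i\<le>m. D i b / fact i * (y - b) ^ i)\<bar> \<le> L * \<bar>y - b\<bar> ^ (m + 1)"
    by (rule taylor_piece[OF D' D(3), of "{-3..3}"]) auto
  then obtain L where L: "0 \<le> L"
    "\<And>b y. b \<in> {-3..3} \<Longrightarrow> y \<in> {-3..3} \<Longrightarrow> \<bar>D 0 y - (\<Sum>i\<le>m. D i b / fact i * (y - b) ^ i)\<bar> \<le> L * \<bar>y - b\<bar> ^ (m + 1)"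
    by blast
  have xi: "\<bar>xi (d + 2) y - (\<Sum>i\<le>m. D i b / fact i * (y - b) ^ i)\<bar> \<le> L * (\<beta> - \<alpha>) ^ (m + 1)"
    if "b \<in> {\<alpha>..\<beta>}" "y \<in> {\<alpha><..<\<beta>}" "-3 \<le> \<alpha>" "\<beta> \<le> 3" for b y \<alpha> \<beta>
  proof -
    have "\<bar>D 0 y - (\<Sum>i\<le>m. D i b / fact i * (y - b) ^ i)\<bar> \<le> L * \<bar>y - b\<bar> ^ (m + 1)"
      by (rule L(2)) (use that in auto)
    also have "\<dots> \<le> L * (\<beta> - \<alpha>) ^ (m + 1)"
      using that L(1) by (intro mult_left_mono power_mono) auto
    finally show ?thesis using bspec[OF D(1) UNIV_I, of y] by (simp only:)
  qed
  let ?K = "\<bar>1 - p\<bar> * M + \<bar>p\<bar> * L"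
  have comb: "\<bar>?g y - (\<Sum>i\<le>m. ((1 - p) * q i + p * (D i b / fact i)) * (y - b) ^ i) - (1 - p) * J * t\<bar> \<le> ?K * E"
    if "\<bar>f y - (\<Sum>i\<le>m. q i * (y - b) ^ i) - J * t\<bar> \<le> M * E"
      "\<bar>xi (d + 2) y - (\<Sum>i\<le>m. D i b / fact i * (y - b) ^ i)\<bar> \<le> L * E" for y q b J t E
  proof -
    define U where "U = (\<Sum>i\<le>m. q i * (y - b) ^ i)"
    define V where "V = (\<Sum>i\<le>m. D i b / fact i * (y - b) ^ i)"
    have "(\<Sum>i\<le>m. ((1 - p) * q i + p * (D i b / fact i)) * (y - b) ^ i) = (1 - p) * U + p * V"
      unfolding U_def V_def by (simp only: sum_distrib_left sum.distrib[symmetric] distrib_right mult.assoc)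
    then have "?g y - (\<Sum>i\<le>m. ((1 - p) * q i + p * (D i b / fact i)) * (y - b) ^ i) - (1 - p) * J * t
        = (1 - p) * (f y - U - J * t) + p * (xi (d + 2) y - V)"
      by (simp add: enriched_def algebra_simps)
    moreover have "\<bar>(1 - p) * (f y - U - J * t) + p * (xi (d + 2) y - V)\<bar>
        \<le> \<bar>1 - p\<bar> * \<bar>f y - U - J * t\<bar> + \<bar>p\<bar> * \<bar>xi (d + 2) y - V\<bar>"
      by (rule order_trans[OF abs_triangle_ineq]) (simp add: abs_mult)
    moreover have "\<bar>1 - p\<bar> * \<bar>f y - U - J * t\<bar> + \<bar>p\<bar> * \<bar>xi (d + 2) y - V\<bar> \<le> \<bar>1 - p\<bar> * (M * E) + \<bar>p\<bar> * (L * E)"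
      using that unfolding U_def V_def by (intro add_mono mult_left_mono) auto
    moreover have "\<bar>1 - p\<bar> * (M * E) + \<bar>p\<bar> * (L * E) = ?K * E" by (simp only: distrib_right mult.assoc)
    ultimately show ?thesis by (simp only:)
  qed
  show ?thesis
    unfolding local_expansions_def
  proof (intro exI[of _ ?K] conjI allI impI)
    show "0 \<le> ?K" using M L by simp
  next
    fix \<alpha> \<beta> :: real assume ab: "-3 \<le> \<alpha>" "\<alpha> < \<beta>" "\<beta> \<le> 3" "{\<alpha><..<\<beta>} \<inter> set as = {}"
    obtain q where q: "\<And>y. y \<in> {\<alpha><..<\<beta>} \<Longrightarrow> \<bar>f y - (\<Sum>i\<le>m. q i * (y - \<alpha>) ^ i)\<bar> \<le> M * (\<beta> - \<alpha>) ^ (m + 1)"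
      by (rule gap_expansionE[OF M(2)[OF ab], of \<alpha>]) (use ab in auto)
    show "\<exists>q. \<forall>y\<in>{\<alpha><..<\<beta>}. \<bar>?g y - (\<Sum>i\<le>m. q i * (y - \<alpha>) ^ i)\<bar> \<le> ?K * (\<beta> - \<alpha>) ^ (m + 1)"
    proof (intro exI ballI)
      fix y assume y: "y \<in> {\<alpha><..<\<beta>}"
      show "\<bar>?g y - (\<Sum>i\<le>m. ((1 - p) * q i + p * (D i \<alpha> / fact i)) * (y - \<alpha>) ^ i)\<bar> \<le> ?K * (\<beta> - \<alpha>) ^ (m + 1)"
        using comb[of y q \<alpha> 0 0] q[OF y] xi[of \<alpha> \<alpha> \<beta> y] ab y by simp
    qed
  next
    fix a \<alpha> \<beta> :: real assume ab: "a \<in> set as" "-3 \<le> \<alpha>" "\<alpha> < a" "a < \<beta>" "\<beta> \<le> 3" "{\<alpha><..<\<beta>} \<inter> set as = {a}"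
    have e: "{\<alpha><..<a} \<inter> set as = {}" "{a<..<\<beta>} \<inter> set as = {}" using ab by fastforce+
    let ?J = "(right_deriv_lim m f a - left_deriv_lim m f a) / fact m"
    obtain q where q: "\<And>y. y \<in> {\<alpha><..<\<beta>} \<Longrightarrow> y \<noteq> a \<Longrightarrow>
      \<bar>f y - (\<Sum>i\<le>m. q i * (y - a) ^ i) - ?J * tpow m (y - a)\<bar> \<le> M * (\<beta> - \<alpha>) ^ (m + 1)"
      by (rule piecewise_smooth_jump_expansion[OF f M(1) M(2)[OF ab(2,3) _ e(1)] M(2)[OF _ ab(4,5) e(2)] ab(3,4)])
         (use ab in auto)
    show "\<exists>q. \<forall>y\<in>{\<alpha><..<\<beta>}. y \<noteq> a \<longrightarrow> \<bar>?g y - (\<Sum>i\<le>m. q i * (y - a) ^ i) - (1 - p) * ?J * tpow m (y - a)\<bar> \<le> ?K * (\<beta> - \<alpha>) ^ (m + 1)"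
    proof (intro exI ballI impI)
      fix y assume y: "y \<in> {\<alpha><..<\<beta>}" "y \<noteq> a"
      show "\<bar>?g y - (\<Sum>i\<le>m. ((1 - p) * q i + p * (D i a / fact i)) * (y - a) ^ i) - (1 - p) * ?J * tpow m (y - a)\<bar> \<le> ?K * (\<beta> - \<alpha>) ^ (m + 1)"
        using ab y by (intro comb q xi) auto
    qed
  qed
qed

section \<open>Projections of an enriched density\<close>

locale S_density = compact_wavelet +
  fixes \<Delta>\<^sub>1 \<Delta>\<^sub>2 p \<delta> c\<^sub>0 :: real and f g :: "real \<Rightarrow> real" and m :: nat and as :: "real list"
  assumes pw: "piecewise_smooth f m as" and m_le: "m \<le> d" and dens: "prob_density f"
    and f_supp: "\<And>x. x \<notin> {-1..1} \<Longrightarrow> f x = 0"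
    and jumps: "\<And>a. a \<in> set as \<Longrightarrow> \<Delta>\<^sub>1 \<le> \<bar>left_deriv_lim m f a - right_deriv_lim m f a\<bar> \<and>
                        \<bar>left_deriv_lim m f a - right_deriv_lim m f a\<bar> \<le> \<Delta>\<^sub>2"
    and \<Delta>_pos: "0 < \<Delta>\<^sub>1" and p: "0 < p" "p < 1"
    and \<delta>: "0 < \<delta>" "\<delta> < 1" and nz: "\<And>x. x \<in> {0<..1 + \<delta>} \<Longrightarrow> \<psi> x \<noteq> 0"
    and c\<^sub>0: "0 < c\<^sub>0" "\<And>b. b \<in> {\<delta>..1 + \<delta>} \<Longrightarrow> c\<^sub>0 \<le> \<bar>jump_coef m b\<bar>"
    and g_def: "g = enriched p (xi (d + 2)) f"
begin

lemma g_prob_density: "prob_density g"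
  unfolding g_def by (rule enriched_prob_density[OF dens p])

lemma g_nonneg: "0 \<le> g x" and g_borel: "g \<in> borel_measurable borel"
  and g_integral: "has_bochner_integral lborel g 1"
  using g_prob_density unfolding prob_density_def by auto

lemma g_ge: "x \<in> {-5/4..5/4} \<Longrightarrow> p * (xi_const (d + 2) * (11/16) ^ (d + 3)) \<le> g x"
proof -
  assume "x \<in> {-5/4..5/4}"
  then have "p * (xi_const (d + 2) * (11/16) ^ (d + 2 + 1)) \<le> p * xi (d + 2) x"
    using xi_ge[of x "d + 2"] p by (intro mult_left_mono) auto
  moreover have "0 \<le> (1 - p) * f x" using dens p unfolding prob_density_def by auto
  moreover have "d + 2 + 1 = d + 3" by simp
  ultimately show ?thesis unfolding g_def enriched_def by (simp only:)
qed

lemma g_bounded: "\<exists>C. \<forall>x. \<bar>g x\<bar> \<le> C"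
proof -
  obtain C where C: "\<And>x. \<bar>f x\<bar> \<le> C" using piecewise_smooth_bounded[OF pw f_supp] by blast
  have "\<bar>g x\<bar> \<le> (1 - p) * C + p * (xi_const (d + 2) * (9/4) ^ (d + 2 + 1))" for x
  proof -
    have "\<bar>g x\<bar> \<le> \<bar>(1 - p) * f x\<bar> + \<bar>p * xi (d + 2) x\<bar>"
      unfolding g_def enriched_def by (rule abs_triangle_ineq)
    also have "\<dots> = (1 - p) * \<bar>f x\<bar> + p * xi (d + 2) x"
      using p xi_nonneg[of "d + 2" x] by (simp add: abs_mult)
    also have "\<dots> \<le> (1 - p) * C + p * (xi_const (d + 2) * (9/4) ^ (d + 2 + 1))"
      using p C xi_le[of "d + 2" x] by (intro add_mono mult_left_mono) auto
    finally show ?thesis .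
  qed
  then show ?thesis by blast
qed

lemma g_support: "x \<notin> {-2..2} \<Longrightarrow> g x = 0"
  using f_supp[of x] xi_support[of x "d + 2"] by (auto simp: g_def enriched_def)

text \<open>A bound of the density depends on \<open>f\<close> and is not controlled on the class,
  so it may enter only terms that the choice of \<open>N\<close> absorbs.\<close>

definition Bg where "Bg = (SOME C. \<forall>x. \<bar>g x\<bar> \<le> C)"

lemma g_le_Bg: "\<bar>g x\<bar> \<le> Bg"
  using someI_ex[OF g_bounded] unfolding Bg_def by blast

sublocale G: compact_wavelet_function \<psi> S d A g Bg
  by unfold_locales (use g_borel g_le_Bg g_support in auto)

text \<open>\<open>U\<close>, \<open>e\<^sub>0\<close> and \<open>x\<^sub>0\<close> depend only on
  the class, the wavelet and \<open>p\<close>. In \<open>U\<close> the factor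
  \<open>(real S + 1) * A\<close> comes from the active translates, the summand with
  \<open>\<Delta>\<^sub>2\<close> from the largest jump and the 1 from the remainder;
  \<open>e\<^sub>0\<close> is half a lower bound of the main term at a defect point, and
  \<open>x\<^sub>0\<close> is the bound of \<open>g_ge\<close>.\<close>

definition U where "U = (real S + 1) * A * (\<Delta>\<^sub>2 * (A * (real S + 1) ^ (d + 1)) + 1)"
definition e\<^sub>0 where "e\<^sub>0 = (1 - p) * \<Delta>\<^sub>1 * c\<^sub>0 / (2 * fact d)"
definition x\<^sub>0 where "x\<^sub>0 = p * (xi_const (d + 2) * (11/16) ^ (d + 3))"

lemma x0_pos: "0 < x\<^sub>0"
  unfolding x\<^sub>0_def using p xi_const_pos by simp

lemma e0_pos: "0 < e\<^sub>0"
  unfolding e\<^sub>0_def using p \<Delta>_pos c\<^sub>0 by simp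

lemma A_pos: "0 < A"
proof -
  have "0 < \<bar>\<psi> 1\<bar>" using nz[of 1] \<delta> by simp
  then show ?thesis using bound[of 1] by linarith
qed

lemma \<delta>_less_S: "1 + \<delta> < real S"
proof -
  have "1 + \<delta> \<le> real S" using nz[of "1 + \<delta>"] vanish[of "1 + \<delta>"] \<delta> by force
  moreover have "1 + \<delta> \<noteq> real S"
  proof
    assume "1 + \<delta> = real S"
    then have "real 1 < real S" "real S < real 2" using \<delta> by auto
    then have "1 < S" "S < 2" unfolding of_nat_less_iff by auto
    then show False by simp
  qed
  ultimately show ?thesis by simp
qed

definition jump_size :: "real \<Rightarrow> real" where
  "jump_size a = (1 - p) * ((right_deriv_lim m f a - left_deriv_lim m f a) / fact m)"

text \<open>\<open>K\<close> and \<open>\<rho>\<close> depend on \<open>f\<close>; both are paid for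
  by taking \<open>j\<close> large. The role of \<open>\<rho>\<close> is to separate the defect
  points, so that an open support interval of length at most \<open>\<rho>\<close> meets only
  one.\<close>

definition coef_estimates :: "real \<Rightarrow> real \<Rightarrow> bool" where
  "coef_estimates K \<rho> \<longleftrightarrow> 0 \<le> K \<and> 0 < \<rho> \<and>
    (\<forall>j k. k \<in> relevant j \<longrightarrow> real S / 2 ^ j \<le> 1/4 \<longrightarrow>
       {real_of_int k / 2 ^ j<..<(real_of_int k + real S) / 2 ^ j} \<inter> set as = {} \<longrightarrow>
       \<bar>coef j g k\<bar> \<le> 2 powr (- real j / 2) * (K * (1 / 2 ^ j) ^ (m + 1))) \<and>
    (\<forall>j k a. a \<in> set as \<longrightarrow> k \<in> relevant j \<longrightarrow> real S / 2 ^ j \<le> 1/4 \<longrightarrow> real S / 2 ^ j \<le> \<rho> \<longrightarrow>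
       a \<in> {real_of_int k / 2 ^ j<..<(real_of_int k + real S) / 2 ^ j} \<longrightarrow>
       \<bar>coef j g k - jump_size a
          * (2 powr (- real j / 2) * (1 / 2 ^ (j * m)) * jump_coef m (2 ^ j * a - k))\<bar>
       \<le> 2 powr (- real j / 2) * (K * (1 / 2 ^ j) ^ (m + 1)))"

lemma coef_estimates_exist: "\<exists>K \<rho>. coef_estimates K \<rho>"
proof -
  obtain M where "local_expansions g m (set as) jump_size M"
    using enriched_local_expansions[OF m_le pw, of p] unfolding g_def jump_size_def[abs_def] by (elim exE)
  note M = this[unfolded local_expansions_def, THEN conjunct1]
    this[unfolded local_expansions_def, THEN conjunct2, THEN conjunct1, rule_format]
    this[unfolded local_expansions_def, THEN conjunct2, THEN conjunct2, rule_format]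
  have "\<exists>\<rho>>0. \<forall>a\<in>set as. \<forall>b\<in>set as. a \<noteq> b \<longrightarrow> \<rho> \<le> \<bar>a - b\<bar>"
  proof (intro exI conjI ballI impI)
    \<comment> \<open>The 1 keeps the set nonempty when there is a single defect point.\<close>
    let ?D = "insert 1 ((\<lambda>(a, b). \<bar>a - b\<bar>) ` (set as \<times> set as - Id))"
    have fin: "finite ?D" by simp
    show "0 < Min ?D" by (subst Min_gr_iff[OF fin]) auto
    show "Min ?D \<le> \<bar>a - b\<bar>" if "a \<in> set as" "b \<in> set as" "a \<noteq> b" for a b
      using that by (intro Min_le fin) (auto intro!: image_eqI[of _ _ "(a, b)"])
  qed
  then obtain \<rho> where \<rho>: "0 < \<rho>" "\<And>a b. a \<in> set as \<Longrightarrow> b \<in> set as \<Longrightarrow> a \<noteq> b \<Longrightarrow> \<rho> \<le> \<bar>a - b\<bar>" by blast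
  have S_pos: "0 < real S" using \<delta>_less_S \<delta> by linarith
  let ?K = "A * (real S * (M * real S ^ (m + 1)))"
  have Keq: "2 powr (- real j / 2) * (A * (real S * (M * (real S / 2 ^ j) ^ (m + 1))))
      = 2 powr (- real j / 2) * (?K * (1 / 2 ^ j) ^ (m + 1))" for j
    by (simp add: power_divide)
  have range: "-3 \<le> real_of_int k / 2 ^ j" "(real_of_int k + real S) / 2 ^ j \<le> 3"
    "real_of_int k / 2 ^ j < (real_of_int k + real S) / 2 ^ j"
    "(real_of_int k + real S) / 2 ^ j - real_of_int k / 2 ^ j = real S / 2 ^ j"
    if "k \<in> relevant j" "real S / 2 ^ j \<le> 1/4" for k j
  proof -
    have "- (2 * 2 ^ j + int S) \<le> k" "k \<le> 2 * 2 ^ j + int S" using that(1) unfolding relevant_def by auto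
    then have "real_of_int (- (2 * 2 ^ j + int S)) \<le> real_of_int k" "real_of_int k \<le> real_of_int (2 * 2 ^ j + int S)"
      unfolding of_int_le_iff .
    then have k: "- (2 * 2 ^ j + real S) \<le> real_of_int k" "real_of_int k \<le> 2 * 2 ^ j + real S" by simp_all
    have s: "real S * 4 \<le> 2 ^ j" using that(2) by (simp add: field_simps)
    have "-3 * 2 ^ j \<le> real_of_int k" using k(1) s by linarith
    then show "-3 \<le> real_of_int k / 2 ^ j" by (simp add: field_simps)
    have "real_of_int k + real S \<le> 3 * 2 ^ j" using k(2) s by linarith
    then show "(real_of_int k + real S) / 2 ^ j \<le> 3" by (simp add: field_simps)
    show "real_of_int k / 2 ^ j < (real_of_int k + real S) / 2 ^ j"
      using S_pos by (intro divide_strict_right_mono) auto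
    show "(real_of_int k + real S) / 2 ^ j - real_of_int k / 2 ^ j = real S / 2 ^ j"
      by (simp add: diff_divide_distrib[symmetric])
  qed
  show ?thesis
    unfolding coef_estimates_def
  proof (rule exI[of _ ?K], rule exI[of _ \<rho>], intro conjI allI impI)
    show "0 \<le> ?K" using M A_pos by simp
    show "0 < \<rho>" by fact
  next
    fix j k assume k: "k \<in> relevant j" "real S / 2 ^ j \<le> 1/4"
      and e: "{real_of_int k / 2 ^ j<..<(real_of_int k + real S) / 2 ^ j} \<inter> set as = {}"
    note r = range[OF k]
    obtain q where q: "\<forall>y\<in>{real_of_int k / 2 ^ j<..<(real_of_int k + real S) / 2 ^ j}.
       \<bar>g y - (\<Sum>i\<le>m. q i * (y - real_of_int k / 2 ^ j) ^ i)\<bar> \<le> M * (real S / 2 ^ j) ^ (m + 1)"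
      using M(2)[OF r(1,3,2) e] unfolding r(4) by blast
    have "\<bar>coef j g k - 0 * (2 powr (- real j / 2) * (1 / 2 ^ (j * m)) * jump_coef m (2 ^ j * (real_of_int k / 2 ^ j) - k))\<bar>
        \<le> 2 powr (- real j / 2) * (A * (real S * (M * (real S / 2 ^ j) ^ (m + 1))))"
      by (rule coef_approx[OF g_borel g_le_Bg m_le]) (use q M(1) in auto)
    then show "\<bar>coef j g k\<bar> \<le> 2 powr (- real j / 2) * (?K * (1 / 2 ^ j) ^ (m + 1))"
      unfolding Keq by simp
  next
    fix j k a assume a: "a \<in> set as" and k: "k \<in> relevant j" "real S / 2 ^ j \<le> 1/4" and s: "real S / 2 ^ j \<le> \<rho>"
      and aI: "a \<in> {real_of_int k / 2 ^ j<..<(real_of_int k + real S) / 2 ^ j}"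
    let ?J = "jump_size a"
    note r = range[OF k]
    have e: "{real_of_int k / 2 ^ j<..<(real_of_int k + real S) / 2 ^ j} \<inter> set as = {a}"
    proof -
      have "b = a" if "b \<in> set as" "b \<in> {real_of_int k / 2 ^ j<..<(real_of_int k + real S) / 2 ^ j}" for b
      proof (rule ccontr)
        assume "b \<noteq> a"
        then have "\<rho> \<le> \<bar>b - a\<bar>" using \<rho>(2)[OF that(1) a] by simp
        moreover have "\<bar>b - a\<bar> < real S / 2 ^ j" using that(2) aI r(4) by auto
        ultimately show False using s by linarith
      qed
      then show ?thesis using a aI by blast
    qed
    have aI': "real_of_int k / 2 ^ j < a" "a < (real_of_int k + real S) / 2 ^ j" using aI by auto
    obtain q where q: "\<forall>y\<in>{real_of_int k / 2 ^ j<..<(real_of_int k + real S) / 2 ^ j}. y \<noteq> a \<longrightarrow>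
       \<bar>g y - (\<Sum>i\<le>m. q i * (y - a) ^ i) - ?J * tpow m (y - a)\<bar> \<le> M * (real S / 2 ^ j) ^ (m + 1)"
      using M(3)[OF a r(1) aI' r(2) e] unfolding r(4) by blast
    have "\<bar>coef j g k - ?J * (2 powr (- real j / 2) * (1 / 2 ^ (j * m)) * jump_coef m (2 ^ j * a - k))\<bar>
        \<le> 2 powr (- real j / 2) * (A * (real S * (M * (real S / 2 ^ j) ^ (m + 1))))"
      by (rule coef_approx[OF g_borel g_le_Bg m_le]) (use q M(1) in auto)
    then show "\<bar>coef j g k - ?J * (2 powr (- real j / 2) * (1 / 2 ^ (j * m)) * jump_coef m (2 ^ j * a - k))\<bar>
        \<le> 2 powr (- real j / 2) * (?K * (1 / 2 ^ j) ^ (m + 1))"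
      unfolding Keq .
  qed
qed

lemma defect_in_support:
  assumes "a \<in> set as"
  shows "a \<in> {-1..1}"
proof (rule ccontr)
  assume "a \<notin> {-1..1}"
  then have "left_deriv_lim m f a = right_deriv_lim m f a"
    by (intro jump_outside_support[of "- {-1..1}"]) (use f_supp in auto)
  then show False using jumps[OF assms] \<Delta>_pos by simp
qed

text \<open>The lower bound comes from one coefficient at one defect point. The last clause holds
  because the squared norm is itself of order \<open>(1 / 2 ^ j) ^ (2 * m + 1)\<close>, so that its
  square is of smaller order than the integral it is compared with.\<close>

theorem projection_asymptotics:
  "\<exists>N. \<forall>j\<ge>N. (\<forall>x. \<bar>wavelet_proj \<psi> j g x\<bar> \<le> U * (1 / 2 ^ j) ^ m) \<and>
    x\<^sub>0 * e\<^sub>0\<^sup>2 * (1 / 2 ^ j) ^ (2 * m + 1) \<le> (\<integral>x. (wavelet_proj \<psi> j g x)\<^sup>2 * g x \<partial>lborel) \<and>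
    (\<integral>x. (wavelet_proj \<psi> j g x)\<^sup>2 \<partial>lborel)\<^sup>2 \<le> (\<integral>x. (wavelet_proj \<psi> j g x)\<^sup>2 * g x \<partial>lborel) / 2"
proof -
  obtain K \<rho> where "coef_estimates K \<rho>"
    using coef_estimates_exist by (elim exE)
  note K = this[unfolded coef_estimates_def, THEN conjunct1]
    this[unfolded coef_estimates_def, THEN conjunct2, THEN conjunct1]
    this[unfolded coef_estimates_def, THEN conjunct2, THEN conjunct2, THEN conjunct1, rule_format]
    this[unfolded coef_estimates_def, THEN conjunct2, THEN conjunct2, THEN conjunct2, rule_format]
  have S_pos: "0 < real S" using \<delta>_less_S \<delta> by linarith
  have as_ne: "as \<noteq> []" using pw unfolding piecewise_smooth_def by auto
  have \<Delta>2: "0 < \<Delta>\<^sub>2" using jumps[of "hd as"] as_ne \<Delta>_pos by (smt (verit) hd_in_set)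
  define V where "V = (real S + 1) * A * K"
  \<comment> \<open>The term with \<open>U\<close> collects the neighbourhoods of radius
    \<open>S / 2 ^ j\<close> of the defect points, where the projection is of order
    \<open>(1 / 2 ^ j) ^ m\<close>; the term with \<open>V\<close> collects the rest of
    \<open>[-3, 3]\<close>, of length at most 6, where it gains a factor
    \<open>1 / 2 ^ j\<close>.\<close>
  define L where "L = card (set as) * U\<^sup>2 * 2 * S + 6 * V\<^sup>2"
  have U_pos: "0 \<le> U" and V_nn: "0 \<le> V" and L_nn: "0 \<le> L"
    using A_pos \<Delta>2 K(1) by (auto simp: U_def V_def L_def)
  \<comment> \<open>One threshold for each estimate in \<open>est\<close>; \<open>K + 1\<close> and
    \<open>2 * L\<^sup>2 + 1\<close> avoid division by 0.\<close>
  define \<eta> where "\<eta> = Min {1 / (4 * real S), \<rho> / real S, 1 / (K + 1), e\<^sub>0 / (K + 1), x\<^sub>0 * e\<^sub>0\<^sup>2 / (2 * L\<^sup>2 + 1)}"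
  have "0 < \<eta>" unfolding \<eta>_def using S_pos K e0_pos x0_pos
    by (subst Min_gr_iff) (auto intro!: divide_pos_pos add_nonneg_pos)
  then obtain N where N: "\<And>j. j \<ge> N \<Longrightarrow> 1 / 2 ^ j \<le> \<eta>" by (rule inverse_power2_eventually_le) blast
  have est: "real S / 2 ^ j \<le> 1/4" "real S / 2 ^ j \<le> \<rho>" "K * (1 / 2 ^ j) \<le> 1" "K * (1 / 2 ^ j) \<le> e\<^sub>0"
    "L\<^sup>2 * (1 / 2 ^ j) \<le> x\<^sub>0 * e\<^sub>0\<^sup>2 / 2" if "j \<ge> N" for j
  proof -
    define h where "h = 1 / (2::real) ^ j"
    have h: "0 < h" "h \<le> 1 / (4 * real S)" "h \<le> \<rho> / real S" "h \<le> 1 / (K + 1)" "h \<le> e\<^sub>0 / (K + 1)"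
      "h \<le> x\<^sub>0 * e\<^sub>0\<^sup>2 / (2 * L\<^sup>2 + 1)"
      using N[OF that] unfolding h_def[symmetric] \<eta>_def by (auto simp: h_def)
    have "real S / 2 ^ j = real S * h" by (simp add: h_def)
    moreover have "real S * h \<le> 1/4" "real S * h \<le> \<rho>" using h(2,3) S_pos by (simp_all add: field_simps)
    ultimately show "real S / 2 ^ j \<le> 1/4" "real S / 2 ^ j \<le> \<rho>" by (simp_all only:)
    have pos: "0 < K + 1" "0 < 2 * L\<^sup>2 + 1" using K(1) by (simp_all add: add_nonneg_pos)
    have "h * (K + 1) \<le> 1" "h * (K + 1) \<le> e\<^sub>0" "h * (2 * L\<^sup>2 + 1) \<le> x\<^sub>0 * e\<^sub>0\<^sup>2"
      using h(4-6) unfolding pos_le_divide_eq[OF pos(1)] pos_le_divide_eq[OF pos(2)] .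
    then show "K * (1 / 2 ^ j) \<le> 1" "K * (1 / 2 ^ j) \<le> e\<^sub>0" "L\<^sup>2 * (1 / 2 ^ j) \<le> x\<^sub>0 * e\<^sub>0\<^sup>2 / 2"
      unfolding h_def[symmetric] using h(1) by (auto simp: algebra_simps)
  qed
  have half: "2 powr (real j / 2) * (2 powr (- real j / 2) * x) = x" for j x
    by (simp add: powr_minus)
  have upper: "\<bar>wavelet_proj \<psi> j g x\<bar> \<le> U * (1 / 2 ^ j) ^ m" if j: "j \<ge> N" for j x
  proof -
    define h where "h = 1 / (2::real) ^ j"
    have h: "0 < h" "h \<le> 1" unfolding h_def by auto
    let ?W = "\<Delta>\<^sub>2 * (A * (real S + 1) ^ (d + 1))"
    have W: "0 \<le> ?W" using \<Delta>2 A_pos by simp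
    have Kh: "K * h ^ (m + 1) \<le> h ^ m"
      using mult_right_mono[OF est(3)[OF j], of "h ^ m"] h unfolding h_def[symmetric] by (simp add: mult_ac)
    have "\<bar>coef j g k\<bar> \<le> 2 powr (- real j / 2) * ((?W + 1) * h ^ m)" if k: "k \<in> relevant j" for k
    proof (cases "{real_of_int k / 2 ^ j<..<(real_of_int k + real S) / 2 ^ j} \<inter> set as = {}")
      case True
      have "\<bar>coef j g k\<bar> \<le> 2 powr (- real j / 2) * (K * h ^ (m + 1))"
        unfolding h_def by (rule K(3)[OF k est(1)[OF j] True])
      also have "\<dots> \<le> 2 powr (- real j / 2) * ((?W + 1) * h ^ m)"
        using Kh W h by (intro mult_left_mono) (auto simp: distrib_right add_increasing)
      finally show ?thesis .
    next
      case False
      then obtain a where a: "a \<in> set as" "a \<in> {real_of_int k / 2 ^ j<..<(real_of_int k + real S) / 2 ^ j}" by blast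
      let ?J = "jump_size a"
      let ?b = "2 ^ j * a - real_of_int k"
      have "0 \<le> ?b" using a(2) by (simp add: field_simps)
      then have jc: "\<bar>jump_coef m ?b\<bar> \<le> A * (real S + 1) ^ (d + 1)"
      proof -
        have "A * (real S + 1) ^ (m + 1) \<le> A * (real S + 1) ^ (d + 1)"
          using A_pos m_le by (intro mult_left_mono power_increasing) auto
        then show ?thesis using jump_coef_upper[OF \<open>0 \<le> ?b\<close>, of m] by linarith
      qed
      have "\<bar>?J\<bar> = (1 - p) * (\<bar>left_deriv_lim m f a - right_deriv_lim m f a\<bar> / fact m)"
        using p by (simp add: jump_size_def abs_mult abs_minus_commute)
      also have "\<dots> \<le> 1 * (\<Delta>\<^sub>2 / 1)"
        using p jumps[OF a(1)] \<Delta>2 by (intro mult_mono frac_le) (auto simp: fact_ge_1)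
      finally have J: "\<bar>?J\<bar> \<le> \<Delta>\<^sub>2" by simp
      have main: "\<bar>?J * (2 powr (- real j / 2) * (1 / 2 ^ (j * m)) * jump_coef m ?b)\<bar> \<le> 2 powr (- real j / 2) * (?W * h ^ m)"
      proof -
        have "\<bar>?J * (2 powr (- real j / 2) * (1 / 2 ^ (j * m)) * jump_coef m ?b)\<bar>
            = 2 powr (- real j / 2) * ((\<bar>?J\<bar> * \<bar>jump_coef m ?b\<bar>) * h ^ m)"
          by (simp add: abs_mult h_def power_mult power_one_over)
        also have "\<dots> \<le> 2 powr (- real j / 2) * (?W * h ^ m)"
          using J jc \<Delta>2 h by (intro mult_left_mono mult_right_mono mult_mono) auto
        finally show ?thesis .
      qed
      have "\<bar>coef j g k - ?J * (2 powr (- real j / 2) * (1 / 2 ^ (j * m)) * jump_coef m ?b)\<bar>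
          \<le> 2 powr (- real j / 2) * (K * h ^ (m + 1))"
        unfolding h_def by (rule K(4)[OF a(1) k est(1)[OF j] est(2)[OF j] a(2)])
      also have "\<dots> \<le> 2 powr (- real j / 2) * h ^ m" using Kh by (intro mult_left_mono) auto
      finally have "\<bar>coef j g k\<bar> \<le> 2 powr (- real j / 2) * (?W * h ^ m) + 2 powr (- real j / 2) * h ^ m"
        using main by linarith
      then show ?thesis by (simp add: algebra_simps)
    qed
    then have "\<bar>wavelet_proj \<psi> j g x\<bar> \<le> (real S + 1) * A * (2 powr (real j / 2) * (2 powr (- real j / 2) * ((?W + 1) * h ^ m)))"
      using W h by (intro G.proj_bound) auto
    then show ?thesis unfolding half U_def h_def by (simp add: mult_ac)
  qed
  have far: "\<bar>wavelet_proj \<psi> j g x\<bar> \<le> V * (1 / 2 ^ j) ^ (m + 1)"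
    if j: "j \<ge> N" and x: "\<And>a. a \<in> set as \<Longrightarrow> real S / 2 ^ j < \<bar>x - a\<bar>" for j x
  proof -
    have "\<bar>coef j g k\<bar> \<le> 2 powr (- real j / 2) * (K * (1 / 2 ^ j) ^ (m + 1))"
      if k: "k \<in> relevant j" "wavelet \<psi> j k x \<noteq> 0" for k
    proof (rule K(3)[OF k(1) est(1)[OF j]])
      have xI: "x \<in> {real_of_int k / 2 ^ j..(real_of_int k + real S) / 2 ^ j}"
        using wavelet_support[where x=x and k=k and j=j] k(2) by blast
      have "(real_of_int k + real S) / 2 ^ j = real_of_int k / 2 ^ j + real S / 2 ^ j"
        by (rule add_divide_distrib)
      then have "\<bar>x - a\<bar> \<le> real S / 2 ^ j" if "a \<in> {real_of_int k / 2 ^ j<..<(real_of_int k + real S) / 2 ^ j}" for a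
        using xI that by auto
      then show "{real_of_int k / 2 ^ j<..<(real_of_int k + real S) / 2 ^ j} \<inter> set as = {}"
        using x by fastforce
    qed
    then have "\<bar>wavelet_proj \<psi> j g x\<bar> \<le> (real S + 1) * A * (2 powr (real j / 2) * (2 powr (- real j / 2) * (K * (1 / 2 ^ j) ^ (m + 1))))"
      using K(1) by (intro G.proj_bound) auto
    then show ?thesis unfolding half V_def by (simp add: mult_ac)
  qed
  have lower: "x\<^sub>0 * e\<^sub>0\<^sup>2 * (1 / 2 ^ j) ^ (2 * m + 1) \<le> (\<integral>x. (wavelet_proj \<psi> j g x)\<^sup>2 * g x \<partial>lborel)" if j: "j \<ge> N" for j
  proof -
    define h where "h = 1 / (2::real) ^ j"
    have h: "0 < h" "h \<le> 1" unfolding h_def by auto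
    define a where "a = hd as"
    have a: "a \<in> set as" using as_ne by (simp add: a_def)
    note a1 = defect_in_support[OF a]
    \<comment> \<open>Any defect point would do as \<open>a\<close>. This \<open>k\<close> places
      the break at \<open>b \<in> {\<delta>..1 + \<delta>}\<close> inside the wavelet, where
      \<open>c\<^sub>0\<close> keeps the jump coefficient away from 0.\<close>
    define k where "k = \<lfloor>2 ^ j * a - \<delta>\<rfloor>"
    define b where "b = 2 ^ j * a - real_of_int k"
    have b: "b \<in> {\<delta>..1 + \<delta>}" unfolding b_def k_def by (simp; linarith)
    have "wavelet \<psi> j k a \<noteq> 0" using nz[of b] b \<delta> by (simp add: wavelet_def b_def)
    then have k: "k \<in> relevant j" by (rule relevantI) (use a1 in auto)
    have bS: "0 < b" "b < real S" using b \<delta> \<delta>_less_S by auto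
    then have aI: "a \<in> {real_of_int k / 2 ^ j<..<(real_of_int k + real S) / 2 ^ j}"
      by (simp add: b_def field_simps)
    let ?J = "jump_size a"
    let ?P = "2 powr (- real j / 2)"
    have J: "(1 - p) * (\<Delta>\<^sub>1 / fact d) \<le> \<bar>?J\<bar>"
    proof -
      have "\<bar>?J\<bar> = (1 - p) * (\<bar>left_deriv_lim m f a - right_deriv_lim m f a\<bar> / fact m)"
        using p by (simp add: jump_size_def abs_mult abs_minus_commute)
      moreover have "\<Delta>\<^sub>1 / fact d \<le> \<bar>left_deriv_lim m f a - right_deriv_lim m f a\<bar> / fact m"
        using jumps[OF a] \<Delta>_pos m_le by (intro frac_le fact_mono) auto
      ultimately show ?thesis using p by (simp only:) (intro mult_left_mono, auto)
    qed
    have "(1 - p) * (\<Delta>\<^sub>1 / fact d) * c\<^sub>0 \<le> \<bar>?J\<bar> * \<bar>jump_coef m b\<bar>"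
      using J c\<^sub>0(2)[OF b] c\<^sub>0(1) by (intro mult_mono) auto
    moreover have "(1 - p) * (\<Delta>\<^sub>1 / fact d) * c\<^sub>0 = 2 * e\<^sub>0" by (simp add: e\<^sub>0_def)
    ultimately have Jb: "2 * e\<^sub>0 \<le> \<bar>?J\<bar> * \<bar>jump_coef m b\<bar>" by simp
    have m1: "?P * (2 * e\<^sub>0 * h ^ m) \<le> \<bar>?J * (?P * (1 / 2 ^ (j * m)) * jump_coef m b)\<bar>"
    proof -
      have "\<bar>?J * (?P * (1 / 2 ^ (j * m)) * jump_coef m b)\<bar> = ?P * ((\<bar>?J\<bar> * \<bar>jump_coef m b\<bar>) * h ^ m)"
        by (simp add: abs_mult h_def power_mult power_one_over)
      then show ?thesis using Jb h by (simp only:) (intro mult_left_mono mult_right_mono, auto)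
    qed
    \<comment> \<open>At this level the remainder is at most half of the guaranteed main term
      \<open>2 * e\<^sub>0 * h ^ m\<close>.\<close>
    have "\<bar>coef j g k - ?J * (?P * (1 / 2 ^ (j * m)) * jump_coef m b)\<bar> \<le> ?P * (K * h ^ (m + 1))"
      unfolding h_def b_def by (rule K(4)[OF a k est(1)[OF j] est(2)[OF j] aI])
    also have "\<dots> \<le> ?P * (e\<^sub>0 * h ^ m)"
    proof -
      have "K * h * h ^ m \<le> e\<^sub>0 * h ^ m" using est(4)[OF j] h unfolding h_def[symmetric] by (intro mult_right_mono) auto
      then show ?thesis by (intro mult_left_mono) (auto simp: mult_ac)
    qed
    finally have m2: "\<bar>coef j g k - ?J * (?P * (1 / 2 ^ (j * m)) * jump_coef m b)\<bar> \<le> ?P * (e\<^sub>0 * h ^ m)" .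
    have tri: "v - w \<le> \<bar>x\<bar>" if "v \<le> \<bar>y\<bar>" "\<bar>x - y\<bar> \<le> w" for v w x y :: real
      using that by linarith
    have "?P * (2 * e\<^sub>0 * h ^ m) - ?P * (e\<^sub>0 * h ^ m) \<le> \<bar>coef j g k\<bar>" by (rule tri[OF m1 m2])
    then have "?P * (e\<^sub>0 * h ^ m) \<le> \<bar>coef j g k\<bar>" by (simp add: algebra_simps)
    then have "(?P * (e\<^sub>0 * h ^ m))\<^sup>2 \<le> (coef j g k)\<^sup>2"
      using e0_pos h by (subst power2_abs[symmetric, of "coef j g k"], intro power_mono) auto
    moreover have "(?P * (e\<^sub>0 * h ^ m))\<^sup>2 = e\<^sub>0\<^sup>2 * h ^ (2 * m + 1)"
    proof -
      have "?P\<^sup>2 = 2 powr (- real j / 2 + - real j / 2)" by (simp only: powr_add power2_eq_square)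
      also have "\<dots> = 2 powr (- real j)" by simp
      also have "\<dots> = h" by (simp add: powr_minus powr_realpow h_def divide_inverse)
      finally have "?P\<^sup>2 = h" .
      moreover have "h ^ (2 * m + 1) = h * (h ^ m)\<^sup>2" by (simp add: power_even_eq)
      ultimately show ?thesis by (simp only: power_mult_distrib mult_ac)
    qed
    ultimately have c2: "e\<^sub>0\<^sup>2 * h ^ (2 * m + 1) \<le> (coef j g k)\<^sup>2" by simp
    let ?I = "{real_of_int k / 2 ^ j..(real_of_int k + real S) / 2 ^ j}"
    have I: "?I \<subseteq> {-5/4..5/4}"
    proof -
      have "(real_of_int k + real S) / 2 ^ j = real_of_int k / 2 ^ j + real S / 2 ^ j"
        by (rule add_divide_distrib)
      moreover have "{x..y} \<subseteq> {-5/4..5/4}" if "y = x + s" "s \<le> 1/4" "x < a" "a < y" for x y s :: real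
        using that a1 by auto
      ultimately show ?thesis using aI est(1)[OF j] by (simp only: greaterThanLessThan_iff)
    qed
    have iQg: "integrable lborel (\<lambda>x. (wavelet_proj \<psi> j g x)\<^sup>2 * g x)"
    proof -
      obtain E where E: "\<And>x. \<bar>wavelet_proj \<psi> j g x\<bar> \<le> E" using G.proj_bounded by blast
      have "\<bar>wavelet_proj \<psi> j g x * g x\<bar> \<le> E * Bg" for x
        unfolding abs_mult using E g_le_Bg order_trans[OF abs_ge_zero E] by (intro mult_mono) auto
      then have "integrable lborel (\<lambda>x. wavelet_proj \<psi> j g x * (wavelet_proj \<psi> j g x * g x))"
        by (intro G.proj_integrable[where D="E * Bg"]) auto
      then show ?thesis by (simp add: power2_eq_square mult.assoc)
    qed
    have "x\<^sub>0 * (e\<^sub>0\<^sup>2 * h ^ (2 * m + 1)) \<le> x\<^sub>0 * (\<integral>x. (wavelet_proj \<psi> j g x)\<^sup>2 * indicator ?I x \<partial>lborel)"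
      using c2 G.coef_square_le_local[of j k] x0_pos by (intro mult_left_mono) auto
    also have "\<dots> = (\<integral>x. x\<^sub>0 * ((wavelet_proj \<psi> j g x)\<^sup>2 * indicator ?I x) \<partial>lborel)" by simp
    also have "\<dots> \<le> (\<integral>x. (wavelet_proj \<psi> j g x)\<^sup>2 * g x \<partial>lborel)"
    proof (rule integral_mono[OF _ iQg])
      show "integrable lborel (\<lambda>x. x\<^sub>0 * ((wavelet_proj \<psi> j g x)\<^sup>2 * indicator ?I x))"
        by (intro integrable_mult_right integrable_real_mult_indicator G.proj_square_integrable) simp
      fix x
      show "x\<^sub>0 * ((wavelet_proj \<psi> j g x)\<^sup>2 * indicator ?I x) \<le> (wavelet_proj \<psi> j g x)\<^sup>2 * g x"
      proof (cases "x \<in> ?I")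
        case True
        then have "x\<^sub>0 \<le> g x" using g_ge[of x] I unfolding x\<^sub>0_def by blast
        then have "(wavelet_proj \<psi> j g x)\<^sup>2 * x\<^sub>0 \<le> (wavelet_proj \<psi> j g x)\<^sup>2 * g x" by (intro mult_left_mono) auto
        then show ?thesis using True by (simp add: mult_ac)
      qed (use g_nonneg in auto)
    qed
    finally show ?thesis unfolding h_def by (simp add: mult.assoc)
  qed
  have theta: "(\<integral>x. (wavelet_proj \<psi> j g x)\<^sup>2 \<partial>lborel) \<le> L * (1 / 2 ^ j) ^ (2 * m + 1)" if j: "j \<ge> N" for j
  proof -
    define h where "h = 1 / (2::real) ^ j"
    have h: "0 < h" "h \<le> 1" unfolding h_def by auto
    have Sh: "real S / 2 ^ j = real S * h" by (simp add: h_def)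
    let ?B = "\<lambda>a. {a - real S * h..a + real S * h}"
    let ?F = "\<lambda>x. (\<Sum>a\<in>set as. (U * h ^ m)\<^sup>2 * indicator (?B a) x) + (V * h ^ (m + 1))\<^sup>2 * indicator {-3..3} x :: real"
    have iB: "integrable lborel (\<lambda>x. c * indicator {l..u} x :: real)" for c l u :: real
      by (intro integrable_mult_right integrable_real_indicator) (auto simp: emeasure_lborel_Icc_eq)
    have iF: "integrable lborel ?F"
      by (intro Bochner_Integration.integrable_add Bochner_Integration.integrable_sum iB)
    have "(\<integral>x. (wavelet_proj \<psi> j g x)\<^sup>2 \<partial>lborel) \<le> (\<integral>x. ?F x \<partial>lborel)"
    proof (rule integral_mono[OF G.proj_square_integrable iF])
      fix x
      have s0: "0 \<le> (\<Sum>a\<in>set as. (U * h ^ m)\<^sup>2 * indicator (?B a) x :: real)" by (intro sum_nonneg) auto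
      show "(wavelet_proj \<psi> j g x)\<^sup>2 \<le> ?F x"
      proof (cases "\<exists>a\<in>set as. x \<in> ?B a")
        case True
        then obtain a where a: "a \<in> set as" "x \<in> ?B a" by blast
        have "(wavelet_proj \<psi> j g x)\<^sup>2 \<le> (U * h ^ m)\<^sup>2"
          using upper[OF j, of x] h U_pos unfolding h_def[symmetric] by (simp add: abs_le_square_iff[symmetric] abs_mult)
        also have "\<dots> = (U * h ^ m)\<^sup>2 * indicator (?B a) x" using a by simp
        also have "\<dots> \<le> (\<Sum>a\<in>set as. (U * h ^ m)\<^sup>2 * indicator (?B a) x)"
          using a by (intro member_le_sum) auto
        also have "\<dots> \<le> ?F x" by simp
        finally show ?thesis .
      next
        case False
        show ?thesis
        proof (cases "x \<in> {-3..3}")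
          case True
          have "real S / 2 ^ j < \<bar>x - a\<bar>" if "a \<in> set as" for a
            using False that unfolding Sh by force
          from far[OF j this] have "(wavelet_proj \<psi> j g x)\<^sup>2 \<le> (V * h ^ (m + 1))\<^sup>2"
            using h V_nn unfolding h_def[symmetric] by (simp add: abs_le_square_iff[symmetric] abs_mult)
          then show ?thesis using s0 True by (simp only: indicator_simps)
        next
          case F: False
          have "wavelet_proj \<psi> j g x = 0"
            by (rule G.proj_support) (use F est(1)[OF j] in \<open>unfold atLeastAtMost_iff, linarith\<close>)
          moreover have "0 \<le> ?F x" using s0 by (intro add_nonneg_nonneg) auto
          ultimately show ?thesis by (simp only:) simp
        qed
      qed
    qed
    also have "\<dots> = (\<Sum>a\<in>set as. (U * h ^ m)\<^sup>2 * (2 * (real S * h))) + (V * h ^ (m + 1))\<^sup>2 * 6"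
    proof -
      have "(\<integral>x. ?F x \<partial>lborel) = (\<integral>x. (\<Sum>a\<in>set as. (U * h ^ m)\<^sup>2 * indicator (?B a) x) \<partial>lborel)
        + (\<integral>x. (V * h ^ (m + 1))\<^sup>2 * indicator {-3..3::real} x \<partial>lborel)"
        by (intro Bochner_Integration.integral_add Bochner_Integration.integrable_sum iB)
      also have "(\<integral>x. (\<Sum>a\<in>set as. (U * h ^ m)\<^sup>2 * indicator (?B a) x) \<partial>lborel)
        = (\<Sum>a\<in>set as. (\<integral>x. (U * h ^ m)\<^sup>2 * indicator (?B a) x \<partial>lborel))"
        by (rule Bochner_Integration.integral_sum) (rule iB)
      also have "\<dots> = (\<Sum>a\<in>set as. (U * h ^ m)\<^sup>2 * (2 * (real S * h)))"
      proof (rule sum.cong[OF refl])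
        fix a :: real
        have "a - real S * h \<le> a + real S * h" using h by simp
        then show "(\<integral>x. (U * h ^ m)\<^sup>2 * indicator (?B a) x \<partial>lborel) = (U * h ^ m)\<^sup>2 * (2 * (real S * h))"
          by simp
      qed
      finally show ?thesis by simp
    qed
    also have "\<dots> = card (set as) * U\<^sup>2 * 2 * S * h ^ (2 * m + 1) + 6 * V\<^sup>2 * (h ^ (2 * m + 1) * h)"
    proof -
      have hh: "h ^ m * h ^ m = h ^ (m * 2)" by (simp only: mult_2_right power_add)
      have "(U * h ^ m)\<^sup>2 = U\<^sup>2 * h ^ (2 * m)" "(V * h ^ (m + 1))\<^sup>2 = V\<^sup>2 * (h ^ (2 * m + 1) * h)"
        by (simp_all add: power_mult_distrib power2_eq_square hh mult_ac)
      then show ?thesis by (simp add: mult_ac)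
    qed
    also have "\<dots> \<le> card (set as) * U\<^sup>2 * 2 * S * h ^ (2 * m + 1) + 6 * V\<^sup>2 * (h ^ (2 * m + 1) * 1)"
      using h by (intro add_left_mono mult_left_mono) auto
    also have "\<dots> = L * h ^ (2 * m + 1)" by (simp add: L_def algebra_simps)
    finally show ?thesis unfolding h_def .
  qed
  show ?thesis
  proof (intro exI[of _ N] allI impI conjI)
    fix j assume j: "j \<ge> N"
    show "\<bar>wavelet_proj \<psi> j g x\<bar> \<le> U * (1 / 2 ^ j) ^ m" for x using upper[OF j] .
    show "x\<^sub>0 * e\<^sub>0\<^sup>2 * (1 / 2 ^ j) ^ (2 * m + 1) \<le> (\<integral>x. (wavelet_proj \<psi> j g x)\<^sup>2 * g x \<partial>lborel)"
      using lower[OF j] .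
    define h where "h = 1 / (2::real) ^ j"
    have h: "0 < h" "h \<le> 1" unfolding h_def by auto
    have "(\<integral>x. (wavelet_proj \<psi> j g x)\<^sup>2 \<partial>lborel)\<^sup>2 \<le> (L * h ^ (2 * m + 1))\<^sup>2"
      unfolding h_def by (intro power_mono theta j) simp
    also have "\<dots> = (L\<^sup>2 * h ^ (2 * m + 1)) * h ^ (2 * m + 1)" by (simp add: power2_eq_square)
    also have "\<dots> \<le> (L\<^sup>2 * h) * h ^ (2 * m + 1)"
      using h power_decreasing[of 1 "2 * m + 1" h] by (intro mult_right_mono mult_left_mono) auto
    also have "\<dots> \<le> (x\<^sub>0 * e\<^sub>0\<^sup>2 / 2) * h ^ (2 * m + 1)"
      using est(5)[OF j] h unfolding h_def[symmetric] by (intro mult_right_mono) auto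
    also have "\<dots> = (x\<^sub>0 * e\<^sub>0\<^sup>2 * h ^ (2 * m + 1)) / 2" by simp
    also have "\<dots> \<le> (\<integral>x. (wavelet_proj \<psi> j g x)\<^sup>2 * g x \<partial>lborel) / 2"
      using lower[OF j] unfolding h_def[symmetric] by (intro divide_right_mono) auto
    finally show "(\<integral>x. (wavelet_proj \<psi> j g x)\<^sup>2 \<partial>lborel)\<^sup>2 \<le> (\<integral>x. (wavelet_proj \<psi> j g x)\<^sup>2 * g x \<partial>lborel) / 2" .
  qed
qed

end

section \<open>The normalized statistic\<close>

lemma sum_pairs_swap:
  fixes F :: "nat \<Rightarrow> nat \<Rightarrow> real"
  shows "(\<Sum>i=1..n-1. \<Sum>l=i+1..n. F i l) = (\<Sum>i\<in>{1..n}. \<Sum>l\<in>{1..<i}. F l i)"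
proof -
  have "(\<Sum>i=1..n-1. \<Sum>l=i+1..n. F i l) = (\<Sum>i\<in>{1..n}. \<Sum>l\<in>{1..n}. if i < l then F i l else 0)"
    by (intro sum.mono_neutral_cong_left ballI sum.neutral) (auto intro!: sum.mono_neutral_cong_left)
  also have "\<dots> = (\<Sum>l\<in>{1..n}. \<Sum>i\<in>{1..n}. if i < l then F i l else 0)"
    by (rule sum.swap)
  also have "\<dots> = (\<Sum>l\<in>{1..n}. \<Sum>i\<in>{1..<l}. F i l)"
    by (intro sum.cong refl sum.mono_neutral_cong_right) auto
  finally show ?thesis .
qed

lemma sum_lower_pairs:
  fixes q :: "nat \<Rightarrow> real"
  assumes "n \<ge> 1"
  shows "(\<Sum>i\<in>{1..n}. \<Sum>l\<in>{1..<i}. q l + q i) = (real n - 1) * (\<Sum>i\<in>{1..n}. q i)"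
  using assms
proof (induction n rule: dec_induct)
  case (step n)
  have "{1..<Suc n} = {1..n}" by auto
  then show ?case using step.IH by (simp add: sum.distrib algebra_simps)
qed simp

locale S_sample = S_density +
  fixes j n :: nat
  assumes n2: "n \<ge> 2"
    and Qb: "\<And>x. \<bar>wavelet_proj \<psi> j g x\<bar> \<le> U * (1 / 2 ^ j) ^ m"
    and var_pos: "(\<integral>x. (wavelet_proj \<psi> j g x)\<^sup>2 \<partial>lborel)\<^sup>2 < (\<integral>x. (wavelet_proj \<psi> j g x)\<^sup>2 * g x \<partial>lborel)"
begin

abbreviation M where "M \<equiv> density lborel (\<lambda>x. ennreal (g x))"
abbreviation Q where "Q \<equiv> wavelet_proj \<psi> j g"
abbreviation G\<^sub>j where "G\<^sub>j \<equiv> wavelet_kernel \<psi> j"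

definition \<theta> where "\<theta> = (\<integral>x. (Q x)\<^sup>2 \<partial>lborel)"
definition \<sigma> where "\<sigma> = sigma_tilde \<psi> j g"

lemma integral_M:
  fixes u :: "real \<Rightarrow> real"
  assumes "u \<in> borel_measurable borel"
  shows "(\<integral>x. u x \<partial>M) = (\<integral>x. u x * g x \<partial>lborel)"
  using integral_real_density[of g lborel u] assms g_borel g_nonneg by (simp add: mult.commute)

lemma prob_M: "prob_space M"
proof
  have "emeasure M (space M) = (\<integral>\<^sup>+x. ennreal (g x) \<partial>lborel)"
    using g_borel by (simp add: emeasure_density)
  also have "\<dots> = ennreal 1"
    using g_integral g_nonneg by (subst nn_integral_eq_integral) (auto simp: has_bochner_integral_iff)
  finally show "emeasure M (space M) = 1" by simp
qed

sublocale M: prob_space M by (rule prob_M)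

lemma M_integrable:
  fixes u :: "real \<Rightarrow> real"
  assumes "u \<in> borel_measurable borel" "\<And>x. \<bar>u x\<bar> \<le> D"
  shows "integrable M u"
  using assms by (intro M.integrable_const_bound[where B=D]) auto

lemma U_nonneg: "0 \<le> U"
proof -
  have "0 \<le> \<bar>Q 0\<bar>" by simp
  also have "\<dots> \<le> U * (1 / 2 ^ j) ^ m" by (rule Qb)
  finally have "0 \<le> U * (1 / 2 ^ j) ^ m" .
  moreover have "0 < (1 / 2 ^ j :: real) ^ m" by simp
  ultimately show ?thesis by (metis zero_le_mult_iff not_le)
qed

lemma Q_le_U: "\<bar>Q x\<bar> \<le> U"
proof -
  have "U * (1 / 2 ^ j) ^ m \<le> U * 1" using U_nonneg by (intro mult_left_mono power_le_one) auto
  then show ?thesis using Qb[of x] by simp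
qed

lemma theta_eq: "\<theta> = (\<integral>x. Q x \<partial>M)"
  unfolding \<theta>_def G.proj_square_integral by (subst integral_M) auto

lemma theta_bound: "\<bar>\<theta>\<bar> \<le> U * (1 / 2 ^ j) ^ m"
proof -
  have "\<bar>\<theta>\<bar> \<le> (\<integral>x. \<bar>Q x\<bar> \<partial>M)" unfolding theta_eq by (rule integral_abs_bound)
  also have "\<dots> \<le> (\<integral>x. U * (1 / 2 ^ j) ^ m \<partial>M)"
    by (intro integral_mono integrable_abs M_integrable[OF G.proj_meas Qb] Qb) simp
  finally show ?thesis by (simp add: M.prob_space[simplified])
qed

lemma theta_le_U: "\<bar>\<theta>\<bar> \<le> U"
proof -
  have "U * (1 / 2 ^ j) ^ m \<le> U * 1" using U_nonneg by (intro mult_left_mono power_le_one) auto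
  then show ?thesis using theta_bound by simp
qed

lemma sigma_square: "\<sigma>\<^sup>2 = (\<integral>x. (Q x)\<^sup>2 \<partial>M) - \<theta>\<^sup>2"
  using var_pos unfolding \<sigma>_def sigma_tilde_def \<theta>_def by (subst integral_M) auto

lemma sigma_pos: "0 < \<sigma>"
  using var_pos unfolding \<sigma>_def sigma_tilde_def by simp

lemma Q_meas [measurable]: "Q \<in> borel_measurable borel"
  by (rule G.proj_meas)

lemma Q_integrable: "integrable M Q" "integrable M (\<lambda>x. (Q x)\<^sup>2)"
proof -
  show "integrable M Q" by (rule M_integrable[OF Q_meas Q_le_U])
  show "integrable M (\<lambda>x. (Q x)\<^sup>2)"
    using power_mono[OF Q_le_U abs_ge_zero, of _ 2] by (intro M_integrable[where D="U\<^sup>2"]) auto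
qed

section \<open>Hoeffding decomposition of the statistic\<close>

definition q where "q x = Q x - \<theta>"

lemma q_meas [measurable]: "q \<in> borel_measurable borel"
  unfolding q_def[abs_def] by measurable

lemma q_bound: "\<bar>q x\<bar> \<le> 2 * (U * (1 / 2 ^ j) ^ m)" "\<bar>q x\<bar> \<le> 2 * U"
  using Qb[of x] theta_bound Q_le_U[of x] theta_le_U unfolding q_def by linarith+

lemma q_mean: "(\<integral>x. q x \<partial>M) = 0"
  unfolding q_def using Q_integrable by (simp add: theta_eq M.prob_space[simplified])

lemma q_var: "(\<integral>x. (q x)\<^sup>2 \<partial>M) = \<sigma>\<^sup>2"
proof -
  have "(\<integral>x. (q x)\<^sup>2 \<partial>M) = (\<integral>x. (Q x)\<^sup>2 - 2 * \<theta> * Q x + \<theta>\<^sup>2 \<partial>M)"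
    by (simp add: q_def power2_eq_square algebra_simps)
  also have "\<dots> = (\<integral>x. (Q x)\<^sup>2 \<partial>M) - 2 * \<theta> * \<theta> + \<theta>\<^sup>2"
    using Q_integrable by (simp add: theta_eq[symmetric] M.prob_space[simplified])
  finally show ?thesis unfolding sigma_square by (simp add: power2_eq_square)
qed

lemma sigma_square_le: "\<sigma>\<^sup>2 \<le> U\<^sup>2"
proof -
  have "(\<integral>x. (Q x)\<^sup>2 \<partial>M) \<le> (\<integral>x. U\<^sup>2 \<partial>M)"
    using Q_integrable power_mono[OF Q_le_U abs_ge_zero, of _ 2] by (intro integral_mono) auto
  then have "(\<integral>x. (Q x)\<^sup>2 \<partial>M) \<le> U\<^sup>2" by (simp add: M.prob_space[simplified])
  then show ?thesis unfolding sigma_square using zero_le_power2[of \<theta>] by linarith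
qed

lemma kernel_M_integral: "(\<integral>y. G\<^sub>j x y \<partial>M) = Q x"
proof -
  have [measurable]: "(\<lambda>y. G\<^sub>j x y) \<in> borel_measurable borel"
    using measurable_compose[OF measurable_Pair1' kernel_meas[of j], of x] by simp
  show ?thesis by (subst integral_M) (auto simp: wavelet_proj_def)
qed

text \<open>The kernel minus its two conditional means, with the overall mean restored;
  \<open>Q\<close> is the conditional mean because the observations have density
  \<open>g\<close>.\<close>

definition h\<^sub>2 where "h\<^sub>2 x y = G\<^sub>j x y - Q x - Q y + \<theta>"

lemma kernel_meas1 [measurable]: "(\<lambda>y. G\<^sub>j x y) \<in> borel_measurable borel"
  using measurable_compose[OF measurable_Pair1' kernel_meas[of j], of x] by simp

lemma kernel_M_integrable: "integrable M (\<lambda>y. G\<^sub>j x y)"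
  by (rule M_integrable[OF kernel_meas1 kernel_bound])

lemma h2_degenerate: "(\<integral>y. h\<^sub>2 x y \<partial>M) = 0"
  unfolding h\<^sub>2_def using Q_integrable(1) kernel_M_integrable[of x]
  by (simp add: kernel_M_integral theta_eq[symmetric] M.prob_space[simplified])

text \<open>\<open>L_stat\<close> minus \<open>\<theta>\<close> is \<open>2 / n\<close> times the
  sum of \<open>q\<close> plus \<open>2 / (n * (n - 1))\<close> times the sum of
  \<open>h\<^sub>2\<close> over pairs; multiplying by \<open>sqrt n / (2 * \<sigma>)\<close> gives
  the normalizations of \<open>\<xi>\<close> and \<open>h\<close>.\<close>

definition \<xi> where "\<xi> x = q x / (sqrt n * \<sigma>)"
definition h where "h x y = h\<^sub>2 x y / (\<sigma> * sqrt n * (real n - 1))"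

lemma h2_meas [measurable]: "(\<lambda>(x, y). h\<^sub>2 x y) \<in> borel_measurable (borel \<Otimes>\<^sub>M borel)"
  unfolding h\<^sub>2_def case_prod_beta' using kernel_meas[of j] by (simp add: case_prod_beta')

definition B\<^sub>2 where "B\<^sub>2 = (real S + 1) * A\<^sup>2 * 2 ^ j + 3 * U"

lemma h2_bound: "\<bar>h\<^sub>2 x y\<bar> \<le> B\<^sub>2"
  using kernel_bound[of j x y] Q_le_U[of x] Q_le_U[of y] theta_le_U unfolding h\<^sub>2_def B\<^sub>2_def by linarith

definition B where "B = 2 * U / (sqrt n * \<sigma>) + B\<^sub>2 / (\<sigma> * sqrt n * (real n - 1))"

sublocale T: degenerate_ustat M "{1..n}" n \<xi> h B
proof
  have n1: "1 < real n" using n2 by simp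
  have B2: "0 \<le> B\<^sub>2" using order_trans[OF abs_ge_zero h2_bound] .
  show "{1..n} = {1..n}" ..
  show "1 \<le> n" using n2 by simp
  show "\<xi> \<in> borel_measurable M" unfolding \<xi>_def[abs_def] by simp
  have "sets (M \<Otimes>\<^sub>M M) = sets (borel \<Otimes>\<^sub>M borel :: (real \<times> real) measure)"
    by (intro sets_pair_measure_cong) auto
  moreover have "(\<lambda>(x, y). h x y) \<in> borel_measurable (borel \<Otimes>\<^sub>M borel)"
    unfolding h_def case_prod_beta' using h2_meas by (simp add: case_prod_beta')
  ultimately show "(\<lambda>(x, y). h x y) \<in> borel_measurable (M \<Otimes>\<^sub>M M)"
    using measurable_cong_sets by blast
  have "0 \<le> B\<^sub>2 / (\<sigma> * sqrt n * (real n - 1))" "0 \<le> 2 * U / (sqrt n * \<sigma>)" using B2 sigma_pos n1 U_nonneg by simp_all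
  then show "\<bar>\<xi> x\<bar> \<le> B" "\<bar>h x y\<bar> \<le> B" for x y
  proof -
    have "\<bar>\<xi> x\<bar> \<le> 2 * U / (sqrt n * \<sigma>)"
      unfolding \<xi>_def abs_divide using q_bound(2)[of x] sigma_pos n1 by (simp add: divide_right_mono)
    then show "\<bar>\<xi> x\<bar> \<le> B" unfolding B_def using \<open>0 \<le> B\<^sub>2 / _\<close> by linarith
    have "\<bar>h x y\<bar> \<le> B\<^sub>2 / (\<sigma> * sqrt n * (real n - 1))"
      unfolding h_def abs_divide using h2_bound[of x y] sigma_pos n1 by (simp add: divide_right_mono abs_mult)
    then show "\<bar>h x y\<bar> \<le> B" unfolding B_def using \<open>0 \<le> 2 * U / _\<close> by linarith
  qed
  show "h x y = h y x" for x y unfolding h_def h\<^sub>2_def by (simp add: kernel_sym)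
  show "(\<integral>x. \<xi> x \<partial>M) = 0" unfolding \<xi>_def by (simp add: q_mean)
  have "(\<integral>x. (\<xi> x)\<^sup>2 \<partial>M) = (\<integral>x. (q x)\<^sup>2 \<partial>M) / (sqrt n * \<sigma>)\<^sup>2"
    unfolding \<xi>_def power_divide by simp
  then show "(\<integral>x. (\<xi> x)\<^sup>2 \<partial>M) = 1 / real n"
    unfolding q_var using sigma_pos by (simp add: power_mult_distrib)
  show "(\<integral>y. h x y \<partial>M) = 0" for x unfolding h_def by (simp add: h2_degenerate)
qed

lemma ustat_eq_L_stat:
  "T.ustat \<xi> h n X = sqrt (real n) / (2 * \<sigma>) * (L_stat \<psi> n j X - (l2_norm Q)\<^sup>2)"
proof -
  have l2: "(l2_norm Q)\<^sup>2 = \<theta>" unfolding l2_norm_def \<theta>_def by simp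
  define N where "N = real n"
  have N: "1 < N" unfolding N_def using n2 by simp
  define GG where "GG = (\<Sum>i\<in>{1..n}. \<Sum>l\<in>{1..<i}. G\<^sub>j (X l) (X i))"
  define QQ where "QQ = (\<Sum>i\<in>{1..n}. Q (X i))"
  have pairs: "(\<Sum>i\<in>{1..n}. \<Sum>l\<in>{1..<i}. \<theta>) = (N - 1) * (N * \<theta> / 2)"
    using sum_lower_pairs[of n "\<lambda>_. \<theta> / 2"] n2 by (simp add: N_def)
  have QQ: "(\<Sum>i\<in>{1..n}. \<Sum>l\<in>{1..<i}. Q (X l) + Q (X i)) = (N - 1) * QQ"
    using sum_lower_pairs[of n "\<lambda>i. Q (X i)"] n2 by (simp add: QQ_def N_def)
  have "(\<Sum>i\<in>{1..n}. \<Sum>l\<in>{1..<i}. h\<^sub>2 (X l) (X i))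
      = (\<Sum>i\<in>{1..n}. \<Sum>l\<in>{1..<i}. G\<^sub>j (X l) (X i) - (Q (X l) + Q (X i)) + \<theta>)"
    unfolding h\<^sub>2_def by (simp add: algebra_simps)
  also have "\<dots> = GG - (N - 1) * QQ + (N - 1) * (N * \<theta> / 2)"
    unfolding GG_def QQ[symmetric] pairs[symmetric] by (simp only: sum.distrib sum_subtractf)
  finally have H2: "(\<Sum>i\<in>{1..n}. \<Sum>l\<in>{1..<i}. h\<^sub>2 (X l) (X i)) = GG - (N - 1) * QQ + (N - 1) * (N * \<theta> / 2)" .
  have "T.ustat \<xi> h n X = (\<Sum>i\<in>{1..n}. \<xi> (X i)) + (\<Sum>i\<in>{1..n}. \<Sum>l\<in>{1..<i}. h (X l) (X i))"
    unfolding T.ustat_def T.ustat_incr_def by (rule sum.distrib)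
  also have "(\<Sum>i\<in>{1..n}. \<Sum>l\<in>{1..<i}. h (X l) (X i)) = (\<Sum>i\<in>{1..n}. \<Sum>l\<in>{1..<i}. h\<^sub>2 (X l) (X i)) / (\<sigma> * sqrt N * (N - 1))"
    unfolding h_def N_def by (simp only: sum_divide_distrib)
  also have "(\<Sum>i\<in>{1..n}. \<xi> (X i)) = (QQ - N * \<theta>) / (sqrt N * \<sigma>)"
    unfolding \<xi>_def q_def QQ_def N_def by (simp add: sum_divide_distrib[symmetric] sum_subtractf)
  also have "(QQ - N * \<theta>) / (sqrt N * \<sigma>) + (\<Sum>i\<in>{1..n}. \<Sum>l\<in>{1..<i}. h\<^sub>2 (X l) (X i)) / (\<sigma> * sqrt N * (N - 1))
      = (GG - N * (N - 1) * \<theta> / 2) / (\<sigma> * sqrt N * (N - 1))"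
    unfolding H2 using N sigma_pos by (simp add: field_simps)
  also have "\<dots> = sqrt N / (2 * \<sigma>) * (2 / (N * (N - 1)) * GG - \<theta>)"
  proof -
    define r where "r = sqrt N"
    have "0 < r" "N = r * r" using N by (auto simp: r_def)
    then show ?thesis unfolding r_def[symmetric] using N sigma_pos
      by (simp add: field_simps)
  qed
  also have "2 / (N * (N - 1)) * GG = L_stat \<psi> n j X"
    unfolding L_stat_def GG_def N_def sum_pairs_swap ..
  finally show ?thesis by (simp add: l2 N_def)
qed

text \<open>One factor of the cube is bounded by the supremum of \<open>\<xi>\<close>, the other two
  by \<open>xi_var\<close>. Only \<open>U\<close> and \<open>\<sigma>\<close> appear, so the
  constant stays uniform over the class.\<close>

lemma beta_bound: "n * T.\<beta> \<le> 2 * U * ((1 / 2 ^ j) ^ m / (sqrt n * \<sigma>))"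
proof -
  let ?c = "2 * (U * (1 / 2 ^ j) ^ m) / (sqrt n * \<sigma>)"
  have n0: "0 < real n" using n2 by simp
  have b: "\<bar>\<xi> x\<bar> \<le> ?c" for x
    unfolding \<xi>_def abs_divide using q_bound(1)[of x] sigma_pos by (simp add: divide_right_mono)
  have xim: "\<xi> \<in> borel_measurable borel" unfolding \<xi>_def[abs_def] by measurable
  have i2: "integrable M (\<lambda>x. (\<xi> x)\<^sup>2)"
    using power_mono[OF b abs_ge_zero, of _ 2] xim by (intro M_integrable[where D="?c\<^sup>2"]) auto
  have i3: "integrable M (\<lambda>x. \<bar>\<xi> x\<bar> ^ 3)"
    using power_mono[OF b abs_ge_zero, of _ 3] xim by (intro M_integrable[where D="?c ^ 3"]) auto
  have "T.\<beta> \<le> (\<integral>x. ?c * (\<xi> x)\<^sup>2 \<partial>M)"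
    unfolding T.\<beta>_def
  proof (rule integral_mono[OF i3])
    show "\<bar>\<xi> x\<bar> ^ 3 \<le> ?c * (\<xi> x)\<^sup>2" for x
      using mult_right_mono[OF b, of "(\<xi> x)\<^sup>2" x] by (simp add: power3_eq_cube power2_eq_square abs_mult mult.assoc)
  qed (use i2 in auto)
  also have "\<dots> = ?c * (1 / n)" using T.xi_var by simp
  finally have "n * T.\<beta> \<le> n * (?c * (1 / n))" using n0 by (intro mult_left_mono) auto
  then show ?thesis using n0 by simp
qed

definition C\<^sub>2 where "C\<^sub>2 = 4 * (((real S + 1) * A\<^sup>2)\<^sup>2 * Bg * (2 * S) + 3 * U\<^sup>2)"

text \<open>The kernel has height of order \<open>2 ^ j\<close> and lives on a strip of width of
  order \<open>1 / 2 ^ j\<close>, so its square integrates to order \<open>2 ^ j\<close>; the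
  density contributes the factor \<open>Bg\<close>.\<close>

lemma kernel_second_moment: "(\<integral>x. (G\<^sub>j x y)\<^sup>2 \<partial>M) \<le> ((real S + 1) * A\<^sup>2)\<^sup>2 * Bg * (2 * S) * 2 ^ j"
proof -
  let ?a = "(real S + 1) * A\<^sup>2"
  let ?I = "{y - S / 2 ^ j..y + S / 2 ^ j}"
  have [measurable]: "(\<lambda>x. G\<^sub>j x y) \<in> borel_measurable borel"
    using kernel_meas1[of y] by (simp add: kernel_sym[of j y])
  have Bg: "0 \<le> Bg" using order_trans[OF abs_ge_zero g_le_Bg] .
  have le: "(G\<^sub>j x y)\<^sup>2 * g x \<le> (?a * 2 ^ j)\<^sup>2 * Bg * indicator ?I x" for x
  proof (cases "x \<in> ?I")
    case True
    have "(G\<^sub>j x y)\<^sup>2 \<le> (?a * 2 ^ j)\<^sup>2"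
      using power_mono[OF kernel_bound[of j x y] abs_ge_zero, of 2] by simp
    moreover have "g x \<le> Bg" using g_le_Bg[of x] by simp
    ultimately show ?thesis using True g_nonneg[of x] by (auto intro!: mult_mono)
  next
    case False
    then have "\<not> \<bar>x - y\<bar> \<le> S / 2 ^ j" by (auto simp: abs_le_iff algebra_simps)
    then have "G\<^sub>j x y = 0" using kernel_local[of j x y] by blast
    then show ?thesis using False by simp
  qed
  have iI: "integrable lborel (\<lambda>x. (?a * 2 ^ j)\<^sup>2 * Bg * indicator ?I x)"
    by (intro integrable_mult_right integrable_real_indicator) (auto simp: emeasure_lborel_Icc_eq)
  have "(\<integral>x. (G\<^sub>j x y)\<^sup>2 \<partial>M) = (\<integral>x. (G\<^sub>j x y)\<^sup>2 * g x \<partial>lborel)"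
    by (rule integral_M) measurable
  also have "\<dots> \<le> (\<integral>x. (?a * 2 ^ j)\<^sup>2 * Bg * indicator ?I x \<partial>lborel)"
  proof (rule integral_mono[OF Bochner_Integration.integrable_bound[OF iI] iI le])
    show "(\<lambda>x. (G\<^sub>j x y)\<^sup>2 * g x) \<in> borel_measurable lborel" using g_borel by measurable
    show "AE x in lborel. norm ((G\<^sub>j x y)\<^sup>2 * g x) \<le> norm ((?a * 2 ^ j)\<^sup>2 * Bg * indicator ?I x)"
      using order_trans[OF le abs_ge_self] g_nonneg by (intro AE_I2) (simp add: abs_mult)
  qed
  also have "\<dots> = (?a * 2 ^ j)\<^sup>2 * Bg * (2 * (S / 2 ^ j))" by simp
  also have "\<dots> = ?a\<^sup>2 * Bg * (2 * S) * 2 ^ j"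
    by (simp add: power_mult_distrib power2_eq_square)
  finally show ?thesis .
qed

lemma tau2_bound: "T.\<tau>2 \<le> C\<^sub>2 * 2 ^ j / (\<sigma> * sqrt n * (real n - 1))\<^sup>2"
proof -
  let ?D = "(\<sigma> * sqrt n * (real n - 1))\<^sup>2"
  let ?K = "((real S + 1) * A\<^sup>2)\<^sup>2 * Bg * (2 * S)"
  have h2m: "(\<lambda>x. h\<^sub>2 x y) \<in> borel_measurable borel" for y
    using measurable_compose[OF measurable_Pair2' h2_meas, of y] by simp
  have Gm: "(\<lambda>x. G\<^sub>j x y) \<in> borel_measurable borel" for y
    using kernel_meas1[of y] by (simp add: kernel_sym[of j y])
  have iG: "integrable M (\<lambda>x. (G\<^sub>j x y)\<^sup>2)" for y
    using power_mono[OF kernel_bound[of j _ y] abs_ge_zero, of _ 2] Gm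
    by (intro M_integrable[where D="((real S + 1) * A\<^sup>2 * 2 ^ j)\<^sup>2"]) auto
  have ih: "integrable M (\<lambda>x. (h\<^sub>2 x y)\<^sup>2)" for y
    using power_mono[OF h2_bound abs_ge_zero, of _ _ 2] h2m by (intro M_integrable[where D="B\<^sub>2\<^sup>2"]) auto
  have pt: "(h\<^sub>2 x y)\<^sup>2 \<le> 4 * ((G\<^sub>j x y)\<^sup>2 + 3 * U\<^sup>2)" for x y
  proof -
    \<comment> \<open>The Cauchy-Schwarz inequality for four terms: the difference of the two sides
      is the sum of the six squares supplied.\<close>
    have four: "(a - b - c + d)\<^sup>2 \<le> 4 * (a\<^sup>2 + b\<^sup>2 + c\<^sup>2 + d\<^sup>2)" for a b c d :: real
      using zero_le_power2[of "a + b"] zero_le_power2[of "a + c"] zero_le_power2[of "a - d"]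
        zero_le_power2[of "b - c"] zero_le_power2[of "b + d"] zero_le_power2[of "c + d"]
      by (simp add: power2_eq_square algebra_simps)
    have "(Q x)\<^sup>2 \<le> U\<^sup>2" "(Q y)\<^sup>2 \<le> U\<^sup>2" "\<theta>\<^sup>2 \<le> U\<^sup>2"
      using power_mono[OF Q_le_U abs_ge_zero, of _ 2] power_mono[OF theta_le_U abs_ge_zero, of 2] by simp_all
    then show ?thesis unfolding h\<^sub>2_def using four[of "G\<^sub>j x y" "Q x" "Q y" \<theta>] by argo
  qed
  have inner: "(\<integral>x. (h x y)\<^sup>2 \<partial>M) \<le> C\<^sub>2 * 2 ^ j / ?D" for y
  proof -
    have "(\<integral>x. (h\<^sub>2 x y)\<^sup>2 \<partial>M) \<le> (\<integral>x. 4 * ((G\<^sub>j x y)\<^sup>2 + 3 * U\<^sup>2) \<partial>M)"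
      using iG ih pt by (intro integral_mono) auto
    also have "\<dots> = 4 * ((\<integral>x. (G\<^sub>j x y)\<^sup>2 \<partial>M) + 3 * U\<^sup>2)" using iG by (simp add: M.prob_space[simplified])
    also have "\<dots> \<le> 4 * (?K * 2 ^ j + 3 * U\<^sup>2 * 2 ^ j)"
      using kernel_second_moment[of y] mult_left_mono[of 1 "2 ^ j" "3 * U\<^sup>2"] by simp
    also have "\<dots> = C\<^sub>2 * 2 ^ j" unfolding C\<^sub>2_def by (simp add: algebra_simps)
    finally have "(\<integral>x. (h\<^sub>2 x y)\<^sup>2 \<partial>M) / ?D \<le> C\<^sub>2 * 2 ^ j / ?D" by (intro divide_right_mono) auto
    then show ?thesis unfolding h_def power_divide by simp
  qed
  show ?thesis
  \<comment> \<open>Without integrability \<open>T.\<tau>2\<close> is 0 by convention, so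
    integrability of the inner integral does not have to be shown.\<close>
  proof (cases "integrable M (\<lambda>y. \<integral>x. (h x y)\<^sup>2 \<partial>M)")
    case True
    have "T.\<tau>2 \<le> (\<integral>y. C\<^sub>2 * 2 ^ j / ?D \<partial>M)"
      unfolding T.\<tau>2_def using True inner by (intro integral_mono) auto
    then show ?thesis by (simp add: M.prob_space[simplified])
  next
    case False
    have "0 \<le> C\<^sub>2 * 2 ^ j / ?D"
      by (rule order_trans[OF _ inner]) (auto intro: Bochner_Integration.integral_nonneg)
    then show ?thesis unfolding T.\<tau>2_def using False by (simp add: not_integrable_integral_eq)
  qed
qed

definition C\<^sub>\<rho> where "C\<^sub>\<rho> = sqrt (2 * (Bg\<^sup>2 + U\<^sup>2))"

text \<open>Up to scaling, \<open>\<kappa>\<close> is the projection of \<open>q * g\<close> minus a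
  constant, so Bessel's inequality bounds it through the norm of \<open>q * g\<close>, which is of
  order \<open>\<sigma>\<close>. The Cauchy-Schwarz estimate through \<open>\<tau>2\<close> would be
  larger by a factor of order \<open>2 powr (j / 2)\<close>, too much once multiplied by the
  logarithm.\<close>

lemma rho_bound: "T.\<rho> \<le> C\<^sub>\<rho> / (n * (real n - 1) * \<sigma>)"
proof -
  let ?F = "\<lambda>x. q x * g x"
  have Bg: "0 \<le> Bg" using order_trans[OF abs_ge_zero g_le_Bg] .
  have n1: "1 < real n" using n2 by simp
  interpret F: compact_wavelet_function \<psi> S d A ?F "2 * U * Bg"
  proof
    show "?F \<in> borel_measurable borel" using g_borel by measurable
    show "\<bar>q x * g x\<bar> \<le> 2 * U * Bg" for x
      unfolding abs_mult using q_bound(2)[of x] g_le_Bg[of x] U_nonneg by (intro mult_mono) auto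
  qed (use g_support in auto)
  let ?R = "wavelet_proj \<psi> j ?F"
  obtain E where E: "\<And>x. \<bar>?R x\<bar> \<le> E" using F.proj_bounded by blast
  have q2: "integrable M (\<lambda>x. (q x)\<^sup>2)"
    using power_mono[OF q_bound(2) abs_ge_zero, of _ 2] by (intro M_integrable[where D="(2 * U)\<^sup>2"]) auto
  have kap: "T.\<kappa> x = (?R x - \<sigma>\<^sup>2) / (n * (real n - 1) * \<sigma>\<^sup>2)" for x
  proof -
    have "\<xi> y * h x y = (q y * G\<^sub>j x y - Q x * q y - (q y)\<^sup>2) / (n * (real n - 1) * \<sigma>\<^sup>2)" for y
    proof -
      have "(sqrt n * \<sigma>) * (\<sigma> * sqrt n * (real n - 1)) = n * (real n - 1) * \<sigma>\<^sup>2"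
        by (simp add: power2_eq_square)
      moreover have "q y * h\<^sub>2 x y = q y * G\<^sub>j x y - Q x * q y - (q y)\<^sup>2"
        by (simp add: h\<^sub>2_def q_def power2_eq_square algebra_simps)
      ultimately show ?thesis unfolding \<xi>_def h_def times_divide_times_eq by simp
    qed
    then have "T.\<kappa> x = (\<integral>y. q y * G\<^sub>j x y - Q x * q y - (q y)\<^sup>2 \<partial>M) / (n * (real n - 1) * \<sigma>\<^sup>2)"
      unfolding T.\<kappa>_def by simp
    also have "(\<integral>y. q y * G\<^sub>j x y - Q x * q y - (q y)\<^sup>2 \<partial>M) = (\<integral>y. q y * G\<^sub>j x y \<partial>M) - \<sigma>\<^sup>2"
    proof -
      have "integrable M (\<lambda>y. q y * G\<^sub>j x y)"
        using q_bound(2) kernel_bound[of j x] U_nonneg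
        by (intro M_integrable[where D="2 * U * ((real S + 1) * A\<^sup>2 * 2 ^ j)"]) (auto simp: abs_mult intro!: mult_mono)
      moreover have "integrable M q" by (rule M_integrable[OF q_meas q_bound(2)])
      ultimately show ?thesis using q2 by (simp add: q_mean q_var)
    qed
    also have "(\<integral>y. q y * G\<^sub>j x y \<partial>M) = ?R x"
      by (subst integral_M) (auto simp: wavelet_proj_def mult_ac)
    finally show ?thesis .
  qed
  have R2: "integrable M (\<lambda>x. (?R x)\<^sup>2)"
    using power_mono[OF E abs_ge_zero, of _ 2] by (intro M_integrable[where D="E\<^sup>2"]) auto
  have "(\<integral>x. (?R x)\<^sup>2 \<partial>M) = (\<integral>x. (?R x)\<^sup>2 * g x \<partial>lborel)" by (rule integral_M) measurable
  also have "\<dots> \<le> (\<integral>x. (?R x)\<^sup>2 * Bg \<partial>lborel)"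
  proof (rule integral_mono)
    show "integrable lborel (\<lambda>x. (?R x)\<^sup>2 * g x)"
    proof (rule Bochner_Integration.integrable_bound)
      show "integrable lborel (\<lambda>x. (?R x)\<^sup>2 * Bg)" using F.proj_square_integrable by simp
      show "(\<lambda>x. (?R x)\<^sup>2 * g x) \<in> borel_measurable lborel" using g_borel by measurable
      show "AE x in lborel. norm ((?R x)\<^sup>2 * g x) \<le> norm ((?R x)\<^sup>2 * Bg)"
        using g_le_Bg Bg by (intro AE_I2) (auto simp: abs_mult intro!: mult_left_mono)
    qed
    show "(?R x)\<^sup>2 * g x \<le> (?R x)\<^sup>2 * Bg" for x
      using g_le_Bg[of x] by (intro mult_left_mono) auto
  qed (use F.proj_square_integrable in simp)
  also have "\<dots> = Bg * (\<integral>x. (?R x)\<^sup>2 \<partial>lborel)" by simp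
  also have "\<dots> \<le> Bg * (\<integral>x. (?F x)\<^sup>2 \<partial>lborel)" using F.Bessel Bg by (intro mult_left_mono) auto
  also have "\<dots> \<le> Bg * (\<integral>x. Bg * ((q x)\<^sup>2 * g x) \<partial>lborel)"
  proof (intro mult_left_mono[OF _ Bg] integral_mono F.g_square_integrable)
    have i: "integrable lborel (\<lambda>x. (q x)\<^sup>2 * g x)"
    proof (rule bounded_support_integrable[where C="(2 * U)\<^sup>2 * Bg" and a="-2" and b=2])
      show "(\<lambda>x. (q x)\<^sup>2 * g x) \<in> borel_measurable borel" using g_borel by measurable
      show "\<bar>(q x)\<^sup>2 * g x\<bar> \<le> (2 * U)\<^sup>2 * Bg" for x
        unfolding abs_mult using power_mono[OF q_bound(2) abs_ge_zero, of x 2] g_le_Bg[of x]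
        by (intro mult_mono) auto
    qed (use g_support in auto)
    show "integrable lborel (\<lambda>x. Bg * ((q x)\<^sup>2 * g x))" using i by (rule integrable_mult_right)
    show "(q x * g x)\<^sup>2 \<le> Bg * ((q x)\<^sup>2 * g x)" for x
    proof -
      have "g x * ((q x)\<^sup>2 * g x) \<le> Bg * ((q x)\<^sup>2 * g x)"
        using g_le_Bg[of x] g_nonneg[of x] by (intro mult_right_mono) auto
      then show ?thesis by (simp add: power2_eq_square mult_ac)
    qed
  qed
  also have "(\<integral>x. Bg * ((q x)\<^sup>2 * g x) \<partial>lborel) = Bg * \<sigma>\<^sup>2"
    using q_var by (simp add: integral_M)
  finally have RM: "(\<integral>x. (?R x)\<^sup>2 \<partial>M) \<le> Bg\<^sup>2 * \<sigma>\<^sup>2" by (simp add: power2_eq_square mult_ac)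
  have "(\<integral>x. (?R x - \<sigma>\<^sup>2)\<^sup>2 \<partial>M) \<le> (\<integral>x. 2 * (?R x)\<^sup>2 + 2 * (\<sigma>\<^sup>2)\<^sup>2 \<partial>M)"
  proof (rule integral_mono)
    have "\<bar>?R x - \<sigma>\<^sup>2\<bar> \<le> E + \<sigma>\<^sup>2" for x using E[of x] zero_le_power2[of \<sigma>] by linarith
    from power_mono[OF this abs_ge_zero, of _ 2]
    show "integrable M (\<lambda>x. (?R x - \<sigma>\<^sup>2)\<^sup>2)" by (intro M_integrable[where D="(E + \<sigma>\<^sup>2)\<^sup>2"]) auto
    show "(?R x - \<sigma>\<^sup>2)\<^sup>2 \<le> 2 * (?R x)\<^sup>2 + 2 * (\<sigma>\<^sup>2)\<^sup>2" for x
    proof -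
      have "(a - b)\<^sup>2 \<le> 2 * a\<^sup>2 + 2 * b\<^sup>2" for a b :: real
        using zero_le_power2[of "a + b"] by (simp add: power2_eq_square algebra_simps)
      then show ?thesis .
    qed
  qed (use R2 in auto)
  also have "\<dots> = 2 * (\<integral>x. (?R x)\<^sup>2 \<partial>M) + 2 * (\<sigma>\<^sup>2)\<^sup>2" using R2 by (simp add: M.prob_space[simplified])
  also have "\<dots> \<le> 2 * (Bg\<^sup>2 * \<sigma>\<^sup>2) + 2 * (U\<^sup>2 * \<sigma>\<^sup>2)"
    using RM sigma_square_le mult_right_mono[OF sigma_square_le, of "\<sigma>\<^sup>2"] by (simp add: power2_eq_square)
  finally have "(\<integral>x. (?R x - \<sigma>\<^sup>2)\<^sup>2 \<partial>M) \<le> 2 * (Bg\<^sup>2 + U\<^sup>2) * \<sigma>\<^sup>2" by (simp add: algebra_simps)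
  then have "(\<integral>x. (?R x - \<sigma>\<^sup>2)\<^sup>2 \<partial>M) / (n * (real n - 1) * \<sigma>\<^sup>2)\<^sup>2 \<le> 2 * (Bg\<^sup>2 + U\<^sup>2) * \<sigma>\<^sup>2 / (n * (real n - 1) * \<sigma>\<^sup>2)\<^sup>2"
    by (intro divide_right_mono) auto
  then have "T.\<rho> \<le> sqrt (2 * (Bg\<^sup>2 + U\<^sup>2) * \<sigma>\<^sup>2 / (n * (real n - 1) * \<sigma>\<^sup>2)\<^sup>2)"
    unfolding T.\<rho>_def kap power_divide by simp
  also have "\<dots> = C\<^sub>\<rho> * \<sigma> / (n * (real n - 1) * \<sigma>\<^sup>2)"
    using sigma_pos n1 unfolding C\<^sub>\<rho>_def by (simp add: real_sqrt_divide real_sqrt_mult)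
  also have "\<dots> = C\<^sub>\<rho> / (n * (real n - 1) * \<sigma>)"
    using sigma_pos by (simp add: power2_eq_square)
  finally show ?thesis .
qed

end

section \<open>Kolmogorov distance at the smoothing scale\<close>

context S_sample
begin

text \<open>
  With \<open>e = n powr (- 1 / (4 m + 6))\<close> the sample size condition becomes \<open>2\<^sup>j e\<^sup>2 \<le> \<Lambda>\<close>.
  Only the constants multiplying \<open>e\<close> to the first power are uniform in \<open>f\<close>.
\<close>

lemma Kolmogorov_bound:
  fixes e \<Lambda> c\<^sub>1 :: real
  assumes e: "0 < e" "e \<le> 1" and ne: "real n * e ^ (4 * m + 6) = 1"
    and je: "2 ^ j * e\<^sup>2 \<le> \<Lambda>" and c1: "0 < c\<^sub>1" "c\<^sub>1 * (1 / 2 ^ j) ^ (2 * m + 1) \<le> \<sigma>\<^sup>2"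
    and small: "(2 * C\<^sub>\<rho> * sqrt (\<Lambda> ^ (2 * m + 1) / c\<^sub>1) + 32 * C\<^sub>2 * \<Lambda> ^ (2 * m + 2) / c\<^sub>1) * (8 * sqrt e) \<le> 1"
  shows "\<bar>measure (sample_law n g) {X \<in> space (sample_law n g).
      sqrt n / (2 * sigma_tilde \<psi> j g) * (L_stat \<psi> n j X - (l2_norm Q)\<^sup>2) \<le> z} - Phi z\<bar>
    \<le> (33 + 128 * U * sqrt (\<Lambda> / c\<^sub>1)) * e"
proof -
  define H :: real where "H = 2 ^ j"
  have H: "0 < H" "1 \<le> H" unfolding H_def by auto
  have N: "0 < real n" "2 \<le> real n" using n2 by auto
  have \<Lambda>: "0 < \<Lambda>" using H e je unfolding H_def[symmetric] by (meson less_le_trans mult_pos_pos zero_less_power)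
  have He: "H * e\<^sup>2 \<le> \<Lambda>" using je by (simp add: H_def)
  have ninv: "1 / n = e ^ (4 * m + 6)" using ne N by (simp add: field_simps)
  have ns: "0 < real n * \<sigma>\<^sup>2" using N sigma_pos by simp
  have s2: "c\<^sub>1 / H ^ (2 * m + 1) \<le> \<sigma>\<^sup>2" using c1(2) by (simp add: H_def power_one_over)
  have inv_ns: "1 / (n * \<sigma>\<^sup>2) \<le> e ^ (4 * m + 6) * H ^ (2 * m + 1) / c\<^sub>1"
  proof -
    have "1 / (n * \<sigma>\<^sup>2) = (1 / n) * (1 / \<sigma>\<^sup>2)" by simp
    also have "\<dots> \<le> (1 / n) * (1 / (c\<^sub>1 / H ^ (2 * m + 1)))"
      using s2 c1(1) H N sigma_pos by (intro mult_left_mono divide_left_mono) auto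
    finally show ?thesis by (simp add: ninv)
  qed
  have pw: "(H * e\<^sup>2) ^ k \<le> \<Lambda> ^ k" for k using He H e by (intro power_mono) auto
  \<comment> \<open>Each of the \<open>2 * m + 1\<close> factors \<open>H\<close> is paired with an
    \<open>e\<^sup>2\<close>, which uses up all but 4 of the exponent
    \<open>4 * m + 6\<close>.\<close>
  have E1: "1 / (n * \<sigma>\<^sup>2) \<le> e ^ 4 * (\<Lambda> ^ (2 * m + 1) / c\<^sub>1)"
  proof -
    have "e ^ 4 * (H * e\<^sup>2) ^ (2 * m + 1) = (e ^ 4 * e ^ (2 * (2 * m + 1))) * H ^ (2 * m + 1)"
      by (simp only: power_mult_distrib power_mult mult_ac)
    also have "e ^ 4 * e ^ (2 * (2 * m + 1)) = e ^ (4 + 2 * (2 * m + 1))" by (rule power_add[symmetric])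
    also have "4 + 2 * (2 * m + 1) = 4 * m + 6" by simp
    finally have "e ^ (4 * m + 6) * H ^ (2 * m + 1) = e ^ 4 * (H * e\<^sup>2) ^ (2 * m + 1)" ..
    moreover have "e ^ 4 * (H * e\<^sup>2) ^ (2 * m + 1) \<le> e ^ 4 * \<Lambda> ^ (2 * m + 1)"
      using pw[of "2 * m + 1"] e by (intro mult_left_mono) auto
    ultimately have "e ^ (4 * m + 6) * H ^ (2 * m + 1) \<le> e ^ 4 * \<Lambda> ^ (2 * m + 1)" by (simp only:)
    then have "e ^ (4 * m + 6) * H ^ (2 * m + 1) / c\<^sub>1 \<le> e ^ 4 * \<Lambda> ^ (2 * m + 1) / c\<^sub>1"
      using c1 by (intro divide_right_mono) auto
    then show ?thesis using inv_ns by simp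
  qed
  have E2: "H / (n * \<sigma>\<^sup>2) \<le> e\<^sup>2 * (\<Lambda> ^ (2 * m + 2) / c\<^sub>1)"
  proof -
    have "H / (n * \<sigma>\<^sup>2) \<le> H * (e ^ 4 * (\<Lambda> ^ (2 * m + 1) / c\<^sub>1))"
      using mult_left_mono[OF E1, of H] H by simp
    also have "\<dots> = (H * e\<^sup>2) * (e\<^sup>2 * (\<Lambda> ^ (2 * m + 1) / c\<^sub>1))" by (simp add: eval_nat_numeral)
    also have "\<dots> \<le> \<Lambda> * (e\<^sup>2 * (\<Lambda> ^ (2 * m + 1) / c\<^sub>1))"
      using He c1 \<Lambda> by (intro mult_right_mono) auto
    finally show ?thesis by (simp add: mult_ac)
  qed
  \<comment> \<open>The bound on \<open>Q\<close> cancels all but one factor of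
    \<open>H ^ (2 * m + 1)\<close>, so \<Lambda> appears only to the first power.\<close>
  have E3: "(1 / H) ^ (2 * m) / (n * \<sigma>\<^sup>2) \<le> e ^ 4 * (\<Lambda> / c\<^sub>1)"
  proof -
    have "(1 / H) ^ (2 * m) / (n * \<sigma>\<^sup>2) = (1 / H) ^ (2 * m) * (1 / (n * \<sigma>\<^sup>2))" by simp
    also have "\<dots> \<le> (1 / H) ^ (2 * m) * (e ^ (4 * m + 6) * H ^ (2 * m + 1) / c\<^sub>1)"
      using inv_ns H by (intro mult_left_mono) auto
    also have "\<dots> = e ^ (4 * m) * e ^ 4 * ((H * e\<^sup>2) / c\<^sub>1)"
      using H by (simp add: power_one_over power_add eval_nat_numeral)
    also have "\<dots> \<le> 1 * e ^ 4 * (\<Lambda> / c\<^sub>1)"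
      using He e c1 H by (intro mult_mono divide_right_mono power_le_one) auto
    finally show ?thesis by simp
  qed
  have sq: "sqrt (n * \<sigma>\<^sup>2) = sqrt n * \<sigma>" using sigma_pos by (simp add: real_sqrt_mult)
  have se4: "sqrt (e ^ 4 * x) = e\<^sup>2 * sqrt x" for x
  proof -
    have "e ^ 4 = (e\<^sup>2)\<^sup>2" by simp
    then show ?thesis by (simp only: real_sqrt_mult real_sqrt_abs abs_power2)
  qed
  have F1: "1 / (sqrt n * \<sigma>) \<le> e\<^sup>2 * sqrt (\<Lambda> ^ (2 * m + 1) / c\<^sub>1)"
    using real_sqrt_le_mono[OF E1] unfolding se4 by (simp only: real_sqrt_divide sq real_sqrt_one)
  have F3: "(1 / 2 ^ j) ^ m / (sqrt n * \<sigma>) \<le> e\<^sup>2 * sqrt (\<Lambda> / c\<^sub>1)"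
  proof -
    have "sqrt ((1 / H) ^ (2 * m) / (n * \<sigma>\<^sup>2)) = (1 / H) ^ m / (sqrt n * \<sigma>)"
      unfolding real_sqrt_divide sq power_even_eq using H by simp
    then show ?thesis using real_sqrt_le_mono[OF E3] unfolding se4 H_def by simp
  qed
  have beta: "n * T.\<beta> \<le> 2 * U * (e\<^sup>2 * sqrt (\<Lambda> / c\<^sub>1))"
    using beta_bound mult_left_mono[OF F3, of "2 * U"] U_nonneg by linarith
  have C\<rho>: "0 \<le> C\<^sub>\<rho>" unfolding C\<^sub>\<rho>_def by simp
  have C2: "0 \<le> C\<^sub>2" using order_trans[OF abs_ge_zero g_le_Bg] unfolding C\<^sub>2_def by simp
  have rho: "n * (sqrt n * T.\<rho>) \<le> e\<^sup>2 * (2 * C\<^sub>\<rho> * sqrt (\<Lambda> ^ (2 * m + 1) / c\<^sub>1))"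
  proof -
    have "n * (sqrt n * T.\<rho>) \<le> n * (sqrt n * (C\<^sub>\<rho> / (n * (real n - 1) * \<sigma>)))"
      using rho_bound N by (intro mult_left_mono) auto
    also have "\<dots> \<le> n * (sqrt n * (C\<^sub>\<rho> / (n * (real n / 2) * \<sigma>)))"
      using N sigma_pos C\<rho> by (intro mult_left_mono divide_left_mono mult_right_mono mult_pos_pos) auto
    also have "\<dots> = 2 * C\<^sub>\<rho> * (1 / (sqrt n * \<sigma>))"
      using N sigma_pos by (simp add: field_simps real_sqrt_mult_self)
    also have "\<dots> \<le> 2 * C\<^sub>\<rho> * (e\<^sup>2 * sqrt (\<Lambda> ^ (2 * m + 1) / c\<^sub>1))"
      using F1 C\<rho> by (intro mult_left_mono) auto
    finally show ?thesis by (simp only: mult_ac)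
  qed
  have tau: "n * (8 * n * T.\<tau>2) \<le> e\<^sup>2 * (32 * C\<^sub>2 * \<Lambda> ^ (2 * m + 2) / c\<^sub>1)"
  proof -
    have "n * (8 * n * T.\<tau>2) \<le> n * (8 * n * (C\<^sub>2 * H / (\<sigma> * sqrt n * (real n - 1))\<^sup>2))"
      using tau2_bound N unfolding H_def by (intro mult_left_mono) auto
    also have "\<dots> \<le> n * (8 * n * (C\<^sub>2 * H / (\<sigma> * sqrt n * (real n / 2))\<^sup>2))"
      using N sigma_pos C2 H by (intro mult_left_mono divide_left_mono mult_left_mono power_mono mult_pos_pos zero_less_power) auto
    also have "\<dots> = 32 * C\<^sub>2 * (H / (n * \<sigma>\<^sup>2))"
      using N sigma_pos by (simp add: power_mult_distrib power_divide field_simps power2_eq_square)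
    also have "\<dots> \<le> 32 * C\<^sub>2 * (e\<^sup>2 * (\<Lambda> ^ (2 * m + 2) / c\<^sub>1))"
      using E2 C2 by (intro mult_left_mono) auto
    finally show ?thesis by (simp add: mult_ac)
  qed
  define Cf where "Cf = 2 * C\<^sub>\<rho> * sqrt (\<Lambda> ^ (2 * m + 1) / c\<^sub>1) + 32 * C\<^sub>2 * \<Lambda> ^ (2 * m + 2) / c\<^sub>1"
  have rt: "n * (sqrt n * T.\<rho> + 8 * n * T.\<tau>2) \<le> e\<^sup>2 * Cf"
    using rho tau unfolding Cf_def by (simp add: distrib_left)
  \<comment> \<open>\<open>ln w \<le> w - 1\<close> with \<open>w = 1 / sqrt e\<close> spends only a
    multiple of \<open>1 / sqrt e\<close> on the logarithm. Of the factor \<open>e\<^sup>2\<close>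
    this leaves \<open>e * sqrt e\<close>, and the spare \<open>sqrt e\<close> absorbs the constants
    depending on \<open>f\<close>.\<close>
  have ln: "ln ((1 + e\<^sup>2) / e\<^sup>2) \<le> 4 / sqrt e"
  proof -
    have e2: "e\<^sup>2 \<le> 1" using e by (simp add: power_le_one)
    define w where "w = 1 / sqrt e"
    have w: "0 < w" using e by (simp add: w_def)
    have "w ^ 4 = 1 / e\<^sup>2"
    proof -
      have "sqrt e ^ 4 = (sqrt e ^ 2) ^ 2" by simp
      then show ?thesis using e by (simp add: w_def power_divide)
    qed
    then have "(1 + e\<^sup>2) / e\<^sup>2 \<le> 2 * w ^ 4"
      using e e2 by (simp add: divide_right_mono)
    then have "ln ((1 + e\<^sup>2) / e\<^sup>2) \<le> ln (2 * w ^ 4)"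
      using e w by (subst ln_le_cancel_iff) (auto intro!: divide_pos_pos add_pos_pos)
    also have "\<dots> = ln 2 + 4 * ln w" using w by (simp add: ln_mult ln_realpow)
    also have "\<dots> \<le> 1 + 4 * (w - 1)"
      using ln_le_minus_one[of 2] ln_le_minus_one[OF w] by simp
    finally show ?thesis unfolding w_def by simp
  qed
  have sqe: "e\<^sup>2 / sqrt e = e * sqrt e" using e by (simp add: power2_eq_square field_simps)
  have ne2: "1 \<le> n * e\<^sup>2"
  proof -
    have "real n * e ^ (4 * m + 6) \<le> real n * e\<^sup>2"
      using e by (intro mult_left_mono power_decreasing) auto
    then show ?thesis using ne by simp
  qed
  have sn: "1 / sqrt n \<le> e\<^sup>2"
  proof -
    have "sqrt (1 / n) = e ^ (2 * m + 3)"
      unfolding ninv using e by (intro real_sqrt_unique) (auto simp: power_mult[symmetric] algebra_simps)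
    also have "\<dots> \<le> e\<^sup>2" using e by (intro power_decreasing) auto
    finally show ?thesis by (simp add: real_sqrt_divide)
  qed
  \<comment> \<open>The first \<open>e\<close> is the absorbed part. In the second summand
    \<open>64 = 4 * 8 * 2\<close> belongs to the third moments and \<open>8 = 4 * 2\<close> to the
    discretization of time.\<close>
  define \<eta> where "\<eta> = e + (64 * U * sqrt (\<Lambda> / c\<^sub>1) + 8) * e"
  have close: "\<bar>(\<integral>X. Phi ((z - T.ustat \<xi> h n X) / e) \<partial>T.P) - Phi (z / sqrt (1 + e\<^sup>2))\<bar> \<le> \<eta>" for z
  proof -
    have "\<bar>(\<integral>X. Phi ((z - T.ustat \<xi> h n X) / e) \<partial>T.P) - Phi (z / sqrt (1 + e\<^sup>2))\<bar>
      \<le> 2 * ln ((1 + e\<^sup>2) / e\<^sup>2) * (n * (sqrt n * T.\<rho> + 8 * n * T.\<tau>2)) + 4 * (8 * n * T.\<beta> + 2 / sqrt n) / e"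
      by (rule T.ustat_smoothed_normal_approximation[OF e(1) ne2])
    also have "\<dots> \<le> 2 * (4 / sqrt e) * (e\<^sup>2 * Cf) + 4 * (8 * (2 * U * (e\<^sup>2 * sqrt (\<Lambda> / c\<^sub>1))) + 2 * e\<^sup>2) / e"
    proof (rule add_mono)
      have "0 \<le> T.\<rho>" "0 \<le> T.\<tau>2"
        by (auto simp: T.\<rho>_def T.\<tau>2_def intro!: Bochner_Integration.integral_nonneg)
      then have "0 \<le> n * (sqrt n * T.\<rho> + 8 * n * T.\<tau>2)" by simp
      then show "2 * ln ((1 + e\<^sup>2) / e\<^sup>2) * (n * (sqrt n * T.\<rho> + 8 * n * T.\<tau>2)) \<le> 2 * (4 / sqrt e) * (e\<^sup>2 * Cf)"
        using ln e by (intro mult_mono[OF _ rt]) auto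
      have "8 * n * T.\<beta> \<le> 8 * (2 * U * (e\<^sup>2 * sqrt (\<Lambda> / c\<^sub>1)))" "2 / sqrt n \<le> 2 * e\<^sup>2"
        using mult_left_mono[OF beta, of 8] mult_left_mono[OF sn, of 2] by (simp_all add: mult.assoc)
      then show "4 * (8 * n * T.\<beta> + 2 / sqrt n) / e \<le> 4 * (8 * (2 * U * (e\<^sup>2 * sqrt (\<Lambda> / c\<^sub>1))) + 2 * e\<^sup>2) / e"
        using e by (intro divide_right_mono mult_left_mono add_mono) auto
    qed
    also have "2 * (4 / sqrt e) * (e\<^sup>2 * Cf) = e * (Cf * (8 * sqrt e))"
    proof -
      have "2 * (4 / sqrt e) * (e\<^sup>2 * Cf) = (e\<^sup>2 / sqrt e) * (8 * Cf)" by simp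
      then show ?thesis unfolding sqe by (simp only: mult_ac)
    qed
    also have "\<dots> \<le> e * 1" using small e unfolding Cf_def by (intro mult_left_mono) auto
    also have "4 * (8 * (2 * U * (e\<^sup>2 * sqrt (\<Lambda> / c\<^sub>1))) + 2 * e\<^sup>2) / e = (64 * U * sqrt (\<Lambda> / c\<^sub>1) + 8) * e"
      using e by (simp add: field_simps power2_eq_square)
    finally show ?thesis unfolding \<eta>_def by simp
  qed
  have Tm: "T.ustat \<xi> h n \<in> borel_measurable T.P" by (rule T.ustat_meas) simp
  have "\<bar>T.P.prob {X \<in> space T.P. T.ustat \<xi> h n X \<le> z} - Phi z\<bar> \<le> 2 * \<eta> + 15 * e"
    by (rule T.P.Kolmogorov_smoothing[OF Tm e close])
  also have "2 * \<eta> + 15 * e = (33 + 128 * U * sqrt (\<Lambda> / c\<^sub>1)) * e" unfolding \<eta>_def by (simp add: algebra_simps)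
  finally show ?thesis unfolding ustat_eq_L_stat \<sigma>_def sample_law_def .
qed

end

section \<open>Uniform constants and the threshold for the level\<close>

theorem theorem6p2:
  fixes r d N\<^sub>S :: nat and \<phi> \<psi> :: "real \<Rightarrow> real" and \<Delta>\<^sub>1 \<Delta>\<^sub>2 p C\<^sub>1 :: real
  assumes "1 \<le> r"
    and "regular_wavelet_basis r \<phi> \<psi>"
    and "vanishing_moments r \<psi> d"
    and "\<exists>\<delta>\<^sub>1. 0 < \<delta>\<^sub>1 \<and> \<delta>\<^sub>1 < 1 \<and> (\<forall>x\<in>{0<..1 + \<delta>\<^sub>1}. \<psi> x \<noteq> 0)"
    and "0 < \<Delta>\<^sub>1" and "\<Delta>\<^sub>1 \<le> \<Delta>\<^sub>2"
    and "0 < p" and "p < 1"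
    and "0 < C\<^sub>1"
  shows "\<exists>C>0. \<forall>f\<in>S_class d \<Delta>\<^sub>1 \<Delta>\<^sub>2 N\<^sub>S. \<forall>m. prob_density f \<longrightarrow> has_index f m \<longrightarrow>
           (let g = enriched p (xi (d + 2)) f in
            \<exists>N::nat. \<forall>j\<ge>N. \<forall>n::nat. real n \<ge> C\<^sub>1 * 2 ^ (j * (2 * m + 3)) \<longrightarrow>
              (SUP z::real.
                 (\<P>(X in sample_law n g.
                      sqrt (real n) / (2 * sigma_tilde \<psi> j g) *
                        (L_stat \<psi> n j X - (l2_norm (wavelet_proj \<psi> j g))\<^sup>2) \<le> z)
                  - cdf std_normal_distribution z)\<^sup>2)
              \<le> C * real n powr (- 1 / (2 * real m + 3)))"
proof -
  obtain S :: nat where S: "supp \<psi> = {0..real S}" and rC: "C_k_on r UNIV \<psi>"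
    and orth: "\<And>k l. l2_inner (\<lambda>x. \<psi> (x - of_int k)) (\<lambda>x. \<psi> (x - of_int l)) = (if k = l then 1 else 0)"
    using assms(2) unfolding regular_wavelet_basis_def associated_wavelet_def l2_orthonormal_basis_def by blast
  have cont: "continuous_on UNIV \<psi>"
    using C_k_on_UNIV_isCont_deriv[OF rC, of 0] by (simp add: continuous_at_imp_continuous_on)
  have vanish: "\<psi> x = 0" if "x \<notin> {0..real S}" for x
    using that closure_subset[of "{x. \<psi> x \<noteq> 0}"] S unfolding supp_def by blast
  have "bounded (\<psi> ` {0..real S})"
    using cont by (intro compact_imp_bounded compact_continuous_image continuous_on_subset[OF cont]) auto
  then obtain A where A: "0 < A" "\<And>x. x \<in> {0..real S} \<Longrightarrow> norm (\<psi> x) \<le> A"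
    unfolding bounded_pos by auto
  interpret W: compact_wavelet \<psi> S d A
  proof
    show "\<bar>\<psi> x\<bar> \<le> A" for x using A vanish[of x] by (cases "x \<in> {0..real S}") auto
    show "(\<integral>x. x ^ i * \<psi> x \<partial>lborel) = 0" if "i \<le> d" for i
      using assms(3) that unfolding vanishing_moments_def by blast
  qed (use cont vanish orth in \<open>auto simp: l2_inner_def\<close>)
  obtain \<delta> where \<delta>: "0 < \<delta>" "\<delta> < 1" and nz: "\<And>x. x \<in> {0<..1 + \<delta>} \<Longrightarrow> \<psi> x \<noteq> 0"
    using assms(4) by blast
  obtain c\<^sub>0 where c0: "0 < c\<^sub>0" "\<And>m b. m \<le> d \<Longrightarrow> b \<in> {\<delta>..1 + \<delta>} \<Longrightarrow> c\<^sub>0 \<le> \<bar>W.jump_coef m b\<bar>"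
    using W.jump_coef_lower[OF \<delta> nz] by blast
  define U where "U = (real S + 1) * A * (\<Delta>\<^sub>2 * (A * (real S + 1) ^ (d + 1)) + 1)"
  define e\<^sub>0 where "e\<^sub>0 = (1 - p) * \<Delta>\<^sub>1 * c\<^sub>0 / (2 * fact d)"
  define x\<^sub>0 where "x\<^sub>0 = p * (xi_const (d + 2) * (11/16) ^ (d + 3))"
  \<comment> \<open>The factor 1/2 is what remains of the integral after the square of the squared
    norm has been subtracted in the variance.\<close>
  define c\<^sub>1 where "c\<^sub>1 = x\<^sub>0 * e\<^sub>0\<^sup>2 / 2"
  \<comment> \<open>\<open>1 / C\<^sub>1\<close> comes from the condition on \<open>n\<close>; the 1
    makes the powers of \<Lambda> increase with the exponent.\<close>
  define \<Lambda> where "\<Lambda> = max 1 (1 / C\<^sub>1)"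
  define C where "C = 33 + 128 * U * sqrt (\<Lambda> / c\<^sub>1)"
  have c1: "0 < c\<^sub>1" unfolding c\<^sub>1_def x\<^sub>0_def e\<^sub>0_def using assms c0 xi_const_pos[of "d + 2"] by simp
  have \<Lambda>: "1 \<le> \<Lambda>" "1 / C\<^sub>1 \<le> \<Lambda>" unfolding \<Lambda>_def by auto
  have "0 \<le> U" unfolding U_def using A assms by simp
  then have C: "0 < C" unfolding C_def using c1 \<Lambda> by (intro add_pos_nonneg) auto
  show ?thesis
    unfolding Let_def
  proof (intro exI[of _ "C\<^sup>2"] conjI ballI allI impI)
    show "0 < C\<^sup>2" using C by simp
    fix f m assume f: "f \<in> S_class d \<Delta>\<^sub>1 \<Delta>\<^sub>2 N\<^sub>S" and dens: "prob_density f" and ind: "has_index f m"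
    obtain m' as where supp: "supp f \<subseteq> {-1..1}" and pw: "piecewise_smooth f m' as" and m': "m' \<le> d"
      and jumps: "\<forall>a\<in>set as. \<Delta>\<^sub>1 \<le> \<bar>left_deriv_lim m' f a - right_deriv_lim m' f a\<bar> \<and>
                        \<bar>left_deriv_lim m' f a - right_deriv_lim m' f a\<bar> \<le> \<Delta>\<^sub>2"
      using f unfolding S_class_def by blast
    have "m' = m" using pw ind has_index_unique unfolding has_index_def by blast
    note pw = pw[unfolded this] and m = m'[unfolded this] and jumps = jumps[unfolded this]
    define g where "g = enriched p (xi (d + 2)) f"
    interpret D: S_density \<psi> S d A \<Delta>\<^sub>1 \<Delta>\<^sub>2 p \<delta> c\<^sub>0 f g m as
    proof (unfold_locales, fold g_def)
      show "f x = 0" if "x \<notin> {-1..1}" for x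
        using that closure_subset[of "{x. f x \<noteq> 0}"] supp unfolding supp_def by blast
      show "\<Delta>\<^sub>1 \<le> \<bar>left_deriv_lim m f a - right_deriv_lim m f a\<bar> \<and>
          \<bar>left_deriv_lim m f a - right_deriv_lim m f a\<bar> \<le> \<Delta>\<^sub>2" if "a \<in> set as" for a
        using jumps that by (rule bspec)
      show "c\<^sub>0 \<le> \<bar>W.jump_coef m b\<bar>" if "b \<in> {\<delta>..1 + \<delta>}" for b by (rule c0(2)[OF m that])
      show "\<psi> x \<noteq> 0" if "x \<in> {0<..1 + \<delta>}" for x by (rule nz[OF that])
    qed (fact pw m dens assms(5,7,8) \<delta> c0(1) refl)+
    have eqs: "D.U = U" "D.e\<^sub>0 = e\<^sub>0" "D.x\<^sub>0 = x\<^sub>0"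
      unfolding D.U_def U_def D.e\<^sub>0_def e\<^sub>0_def D.x\<^sub>0_def x\<^sub>0_def by simp_all
    define V where "V = (\<lambda>j. \<integral>x. (wavelet_proj \<psi> j g x)\<^sup>2 * g x \<partial>lborel)"
    obtain N\<^sub>0 where N0': "\<forall>j\<ge>N\<^sub>0. (\<forall>x. \<bar>wavelet_proj \<psi> j g x\<bar> \<le> U * (1 / 2 ^ j) ^ m) \<and>
        x\<^sub>0 * e\<^sub>0\<^sup>2 * (1 / 2 ^ j) ^ (2 * m + 1) \<le> V j \<and>
        (\<integral>x. (wavelet_proj \<psi> j g x)\<^sup>2 \<partial>lborel)\<^sup>2 \<le> V j / 2"
      using D.projection_asymptotics unfolding eqs V_def by (elim exE)
    have N0: "\<bar>wavelet_proj \<psi> j g x\<bar> \<le> U * (1 / 2 ^ j) ^ m"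
      "x\<^sub>0 * e\<^sub>0\<^sup>2 * (1 / 2 ^ j) ^ (2 * m + 1) \<le> V j"
      "(\<integral>x. (wavelet_proj \<psi> j g x)\<^sup>2 \<partial>lborel)\<^sup>2 \<le> V j / 2" if "j \<ge> N\<^sub>0" for j x
      using N0' that by blast+
    define C\<^sub>\<rho> where "C\<^sub>\<rho> = sqrt (2 * (D.Bg\<^sup>2 + U\<^sup>2))"
    define C\<^sub>2 where "C\<^sub>2 = 4 * (((real S + 1) * A\<^sup>2)\<^sup>2 * D.Bg * (2 * S) + 3 * U\<^sup>2)"
    define Cf where "Cf = 2 * C\<^sub>\<rho> * sqrt (\<Lambda> ^ (2 * m + 1) / c\<^sub>1) + 32 * C\<^sub>2 * \<Lambda> ^ (2 * m + 2) / c\<^sub>1"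
    have Cf: "0 \<le> Cf"
      using order_trans[OF abs_ge_zero D.g_le_Bg] c1 \<Lambda> unfolding Cf_def C\<^sub>\<rho>_def C\<^sub>2_def by simp
    \<comment> \<open>The first threshold forces \<open>n \<ge> 2\<close>. The second gives
      \<open>Cf * (8 * sqrt e) \<le> 1\<close>, with a fourth power because
      \<open>sqrt e ^ 4 = e\<^sup>2\<close>, which is at most
      \<open>\<Lambda> / 2 ^ j\<close>.\<close>
    obtain N\<^sub>1 where N1: "\<And>j. j \<ge> N\<^sub>1 \<Longrightarrow> 1 / 2 ^ j \<le> min (1 / (2 * \<Lambda>)) (1 / (\<Lambda> * (8 * Cf + 1) ^ 4))"
      using inverse_power2_eventually_le[of "min (1 / (2 * \<Lambda>)) (1 / (\<Lambda> * (8 * Cf + 1) ^ 4))"] Cf \<Lambda>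
      by (auto simp: add_nonneg_pos)
    show "\<exists>N::nat. \<forall>j\<ge>N. \<forall>n::nat. real n \<ge> C\<^sub>1 * 2 ^ (j * (2 * m + 3)) \<longrightarrow>
              (SUP z::real.
                 (\<P>(X in sample_law n (enriched p (xi (d + 2)) f).
                      sqrt (real n) / (2 * sigma_tilde \<psi> j (enriched p (xi (d + 2)) f)) *
                        (L_stat \<psi> n j X - (l2_norm (wavelet_proj \<psi> j (enriched p (xi (d + 2)) f)))\<^sup>2) \<le> z)
                  - cdf std_normal_distribution z)\<^sup>2)
              \<le> C\<^sup>2 * real n powr (- 1 / (2 * real m + 3))"
      unfolding g_def[symmetric]
    proof (intro exI[of _ "max N\<^sub>0 N\<^sub>1"] allI impI)
      fix j n :: nat assume "max N\<^sub>0 N\<^sub>1 \<le> j" and n: "C\<^sub>1 * 2 ^ (j * (2 * m + 3)) \<le> real n"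
      then have j: "N\<^sub>0 \<le> j" "N\<^sub>1 \<le> j" by auto
      define H :: real where "H = 2 ^ j"
      have H: "1 \<le> H" unfolding H_def by simp
      have N1': "2 * \<Lambda> \<le> H" "\<Lambda> * (8 * Cf + 1) ^ 4 \<le> H"
      proof -
        have inv: "x \<le> H" if "1 / H \<le> 1 / x" "0 < x" for x
          using that H by (simp add: field_simps)
        show "2 * \<Lambda> \<le> H" "\<Lambda> * (8 * Cf + 1) ^ 4 \<le> H"
          by (rule inv; use N1[OF j(2)] \<Lambda> Cf in \<open>simp add: H_def add_nonneg_pos\<close>)+
      qed
      have Hn: "H ^ (2 * m + 3) \<le> \<Lambda> * n"
      proof -
        have "C\<^sub>1 * H ^ (2 * m + 3) \<le> n" using n unfolding H_def power_mult .
        then have "H ^ (2 * m + 3) \<le> (1 / C\<^sub>1) * n" using assms(9) by (simp add: pos_le_divide_eq mult.commute)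
        also have "\<dots> \<le> \<Lambda> * n" using \<Lambda> by (intro mult_right_mono) auto
        finally show ?thesis .
      qed
      have n2: "n \<ge> 2"
      proof -
        have "2 * \<Lambda> \<le> H ^ 1" using N1' by simp
        also have "\<dots> \<le> H ^ (2 * m + 3)" using H by (intro power_increasing) auto
        also have "\<dots> \<le> \<Lambda> * n" by (rule Hn)
        finally have "\<Lambda> * 2 \<le> \<Lambda> * real n" by simp
        then show ?thesis using \<Lambda> by simp
      qed
      \<comment> \<open>Twice \<open>2 * m + 3\<close>, so that \<open>e\<^sup>2\<close> is the rate
        of the theorem.\<close>
      define k where "k = 4 * m + 6"
      define e where "e = real n powr (- 1 / real k)"
      have "e \<le> real n powr 0" unfolding e_def using n2 by (intro powr_mono) auto
      then have e: "0 < e" "e \<le> 1" using n2 by (auto simp: e_def)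
      have ek: "e ^ k = 1 / n"
      proof -
        have "e ^ k = real n powr ((- 1 / real k) * real k)"
          using e by (simp add: e_def powr_realpow[symmetric] powr_powr)
        also have "(- 1 / real k) * real k = - 1" by (simp add: k_def)
        finally show ?thesis using n2 by (simp add: powr_minus divide_inverse)
      qed
      have e2: "e\<^sup>2 = real n powr (- 1 / (2 * real m + 3))"
      proof -
        have "e\<^sup>2 = real n powr ((- 1 / real k) * 2)"
          using e by (simp add: e_def powr_realpow[symmetric] powr_powr)
        also have "(- 1 / real k) * 2 = - 1 / (2 * real m + 3)" by (simp add: k_def field_simps)
        finally show ?thesis .
      qed
      \<comment> \<open>Raising to the power \<open>2 * m + 3\<close> turns \<open>e\<^sup>2\<close>
        into \<open>1 / n\<close>, where the condition on \<open>n\<close> applies.\<close>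
      have He: "H * e\<^sup>2 \<le> \<Lambda>"
      proof (rule power_le_imp_le_base)
        have "(H * e\<^sup>2) ^ Suc (2 * m + 2) = H ^ (2 * m + 3) * e ^ k"
        proof -
          have "Suc (2 * m + 2) = 2 * m + 3" "k = 2 * (2 * m + 3)" by (simp_all add: k_def)
          then show ?thesis by (simp only: power_mult_distrib power_mult)
        qed
        also have "\<dots> = H ^ (2 * m + 3) / n" by (simp add: ek)
        also have "\<dots> \<le> \<Lambda>" using Hn n2 by (simp add: field_simps)
        also have "\<dots> = \<Lambda> ^ 1" by simp
        also have "\<dots> \<le> \<Lambda> ^ Suc (2 * m + 2)" using \<Lambda> by (intro power_increasing) auto
        finally show "(H * e\<^sup>2) ^ Suc (2 * m + 2) \<le> \<Lambda> ^ Suc (2 * m + 2)" .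
      qed (use \<Lambda> in simp)
      have small: "Cf * (8 * sqrt e) \<le> 1"
      proof -
        have "H * ((8 * Cf + 1) * sqrt e) ^ 4 = (H * e\<^sup>2) * (8 * Cf + 1) ^ 4"
        proof -
          have "sqrt e ^ 4 = (sqrt e ^ 2) ^ 2" by simp
          then show ?thesis using e by (simp add: power_mult_distrib)
        qed
        also have "\<dots> \<le> \<Lambda> * (8 * Cf + 1) ^ 4" using He by (intro mult_right_mono) auto
        also have "\<dots> \<le> H * 1" using N1' by simp
        finally have "((8 * Cf + 1) * sqrt e) ^ 4 \<le> 1 ^ 4" using H by simp
        then have "(8 * Cf + 1) * sqrt e \<le> 1"
          using power_le_imp_le_base[of "(8 * Cf + 1) * sqrt e" 3 1] by (simp add: eval_nat_numeral)
        moreover have "0 \<le> sqrt e" using e by simp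
        moreover have "(8 * Cf + 1) * sqrt e = Cf * (8 * sqrt e) + sqrt e" by (simp add: algebra_simps)
        ultimately show ?thesis by linarith
      qed
      interpret X: S_sample \<psi> S d A \<Delta>\<^sub>1 \<Delta>\<^sub>2 p \<delta> c\<^sub>0 f g m as j n
      proof
        show "2 \<le> n" by (rule n2)
        show "\<bar>wavelet_proj \<psi> j g x\<bar> \<le> D.U * (1 / 2 ^ j) ^ m" for x unfolding eqs by (rule N0(1)[OF j(1)])
        have "0 < V j"
        proof -
          have "0 < x\<^sub>0 * e\<^sub>0\<^sup>2 * (1 / 2 ^ j) ^ (2 * m + 1)" using c1 unfolding c\<^sub>1_def by simp
          then show ?thesis using N0(2)[OF j(1)] by linarith
        qed
        then show "(\<integral>x. (wavelet_proj \<psi> j g x)\<^sup>2 \<partial>lborel)\<^sup>2 < (\<integral>x. (wavelet_proj \<psi> j g x)\<^sup>2 * g x \<partial>lborel)"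
          using N0(3)[OF j(1)] unfolding V_def by linarith
      qed
      have "X.\<sigma>\<^sup>2 = V j - (\<integral>x. (wavelet_proj \<psi> j g x)\<^sup>2 \<partial>lborel)\<^sup>2"
        unfolding X.sigma_square X.\<theta>_def V_def by (subst X.integral_M) auto
      then have sigma: "c\<^sub>1 * (1 / 2 ^ j) ^ (2 * m + 1) \<le> X.\<sigma>\<^sup>2"
        using N0(2,3)[OF j(1)] unfolding c\<^sub>1_def by argo
      show "(SUP z::real. (\<P>(X in sample_law n g. sqrt (real n) / (2 * sigma_tilde \<psi> j g) *
                        (L_stat \<psi> n j X - (l2_norm (wavelet_proj \<psi> j g))\<^sup>2) \<le> z) - Phi z)\<^sup>2)
              \<le> C\<^sup>2 * real n powr (- 1 / (2 * real m + 3))"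
      proof (rule cSUP_least)
        fix z :: real
        have "\<bar>measure (sample_law n g) {X \<in> space (sample_law n g).
            sqrt n / (2 * sigma_tilde \<psi> j g) * (L_stat \<psi> n j X - (l2_norm (wavelet_proj \<psi> j g))\<^sup>2) \<le> z} - Phi z\<bar>
          \<le> (33 + 128 * D.U * sqrt (\<Lambda> / c\<^sub>1)) * e"
        proof (rule X.Kolmogorov_bound[OF e _ _ c1 sigma])
          show "real n * e ^ (4 * m + 6) = 1" using ek n2 by (simp add: k_def[symmetric])
          show "2 ^ j * e\<^sup>2 \<le> \<Lambda>" using He by (simp add: H_def)
          show "(2 * X.C\<^sub>\<rho> * sqrt (\<Lambda> ^ (2 * m + 1) / c\<^sub>1) + 32 * X.C\<^sub>2 * \<Lambda> ^ (2 * m + 2) / c\<^sub>1) * (8 * sqrt e) \<le> 1"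
            using small unfolding Cf_def C\<^sub>\<rho>_def C\<^sub>2_def X.C\<^sub>\<rho>_def X.C\<^sub>2_def eqs .
        qed
        from power_mono[OF this abs_ge_zero, of 2]
        show "(\<P>(X in sample_law n g. sqrt (real n) / (2 * sigma_tilde \<psi> j g) *
            (L_stat \<psi> n j X - (l2_norm (wavelet_proj \<psi> j g))\<^sup>2) \<le> z) - Phi z)\<^sup>2
          \<le> C\<^sup>2 * real n powr (- 1 / (2 * real m + 3))"
          unfolding eqs C_def[symmetric] e2[symmetric] by (simp add: power_mult_distrib)
      qed simp
    qed
  qed
qed

end
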